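(* Let $\mathfrak{s}=(s_1,\dots,s_r)\in\mathbb{N}^r$ and let $v\in A$ be monic irreducible with $q_v=q^{\deg v}$. Set $B_{w,v}:=\min_{n\ge0}\{q_v^n-nw\}$. Then $$\operatorname{ord}_v(\zeta_A(\mathfrak{s})_v)\ge B_{\operatorname{wt}(\mathfrak{s}),v}-\frac{\operatorname{wt}(\mathfrak{s})-\operatorname{dep}(\mathfrak{s})-\operatorname{ht}(\mathfrak{s})}{q_v-1}.$$ In particular, $\zeta_A(\mathfrak{s})_v\in A_v$ if $q_v\ge\operatorname{wt}(\mathfrak{s})$.
   Context: $q$ a prime power, $A=\mathbb{F}_q[\theta]$, $k=\mathbb{F}_q(\theta)$, $\operatorname{ord}_v$ the $v$-adic valuation with $\operatorname{ord}_v(v)=1$, $|\cdot|_v$ the corresponding absolute value, $k_v$ the completion, $A_v$ its valuation ring, $\mathbb{C}_v$ the completion of an algebraic closure of $k_v$, $\mathfrak{m}_v$ the maximal ideal of its valuation ring, $\overline{k}\subset\mathbb{C}_v$ fixed. For $\mathfrak{s}\in\mathbb{N}^r$: $\operatorname{wt}(\mathfrak{s})=\sum s_i$, $\operatorname{dep}(\mathfrak{s})=r$, $\operatorname{ht}(\mathfrak{s})=\#\{i: s_i\ne1\}$. Constants: $[i]:=\theta^{q^i}-\theta$; $D_0=L_0=1$, $D_i=[i][i-1]^q\cdots[1]^{q^{i-1}}$, $L_i=(-1)^i[i]\cdots[1]$; for $n=\sum_j n_jq^j$ ($0\le n_j<q$), $\Gamma_{n+1}=\prod_jD_j^{n_j}$;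 $\Gamma_{\mathfrak{s}}=\Gamma_{s_1}\cdots\Gamma_{s_r}$. $t$-module and $v$-adic CMSPL: for $\mathfrak{t}=(t_1,\dots,t_r)\in\mathbb{N}^r$, $\mathbf{w}\in\overline{k}^r$, put $d_\ell=t_\ell+\dots+t_r$, $d=\sum d_\ell$; $N=\mathrm{diag}(N_1,\dots,N_r)$ with $N_\ell$ the $d_\ell\times d_\ell$ matrix with $1$'s on the superdiagonal; $E$ the block matrix with $d_\ell\times d_m$ blocks $E[\ell m]$, zero for $\ell>m$, and for $\ell\le m$ with only bottom-left entry (row $d_\ell$, column $1$) possibly nonzero, equal to $1$ if $\ell=m$ and $(-1)^{m-\ell}\prod_{e=\ell}^{m-1}w_e$ if $\ell<m$. $G_{\mathfrak{t},\mathbf{w}}$ is $\mathbb{G}_a^d$ with the $\mathbb{F}_q$-algebra map $\rho:\mathbb{F}_q[t]\to\mathrm{Mat}_d(\overline{k}[\tau])$, $\rho_t=\theta I_d+N+E\tau$ ($\tau$ the $q$-th power Frobenius, $\tau\alpha=\alpha^q\tau$). Its logarithm $\log_G=\sum_{i\ge0}P_i\tau^i$, $P_0=I_d$, is the unique formal series with $\log_G\circ\rho_t=(\theta I_d+N)\circ\log_G$, evaluated as $\sum_iP_ix^{(i)}$. The point $\mathbf{v}_{\mathfrak{t},\mathbf{w}}\in\overline{k}^d$ has all entries $0$ except the last entry of the $\ell$-th block, equal to $(-1)^{r-\ell}w_\ell\cdots w_r$. For $\mathfrak{s}\in\mathbb{N}^r$ and $\mathbf{u}\in\overline{k}^r$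 with $|u_i|_v\le1$, with reversals $\tilde{\mathfrak{s}}=(s_r,\dots,s_1)$, $\tilde{\mathbf{u}}=(u_r,\dots,u_1)$, there is nonzero $a\in\mathbb{F}_q[t]$ with all coordinates of $\rho_a(\mathbf{v}_{\tilde{\mathfrak{s}},\tilde{\mathbf{u}}})$ in $\mathfrak{m}_v$, and $\operatorname{Li}^\star_{\mathfrak{s}}(\mathbf{u})_v:=\frac{(-1)^{r-1}}{a(\theta)}\times$ the $\operatorname{wt}(\mathfrak{s})$-th coordinate of the convergent $\log_{G_{\tilde{\mathfrak{s}},\tilde{\mathbf{u}}}}(\rho_a(\mathbf{v}_{\tilde{\mathfrak{s}},\tilde{\mathbf{u}}}))$ (independent of $a$). Anderson–Thakur polynomials: with $t$ a new variable, $F_0=1$, $F_i=\prod_{j=1}^{i}(t^{q^i}-\theta^{q^j})$, the polynomials $H_n\in A[t]$ are defined by $\big(1-\sum_{i\ge0}\frac{F_i}{D_i|_{\theta=t}}x^{q^i}\big)^{-1}=\sum_{n\ge0}\frac{H_n}{\Gamma_{n+1}|_{\theta=t}}x^n$. $v$-adic MZV: write $H_{s_i-1}(t)=\sum_{j=0}^{m_i}u_{ij}t^j$ with $u_{ij}\in A$, $u_{im_i}\ne0$; $\mathbf{J}_{\mathfrak{s}}=\{0,\dots,m_1\}\times\dots\times\{0,\dots,m_r\}$; for $\mathbf{j}\in\mathbf{J}_{\mathfrak{s}}$, $\mathbf{u}_{\mathbf{j}}=(u_{1j_1},\dots,u_{rj_r})$ and $a_{\mathbf{j}}=t^{j_1+\dots+j_r}$.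 For $\mathbf{w}=(w_1,\dots,w_{r-1})\in\{0,1\}^{r-1}$, $\mathbf{w}(\mathfrak{s})$ is the index obtained from $(s_1,\dots,s_r)$ by replacing, for each $i$ with $w_i=1$, the comma between $s_i$ and $s_{i+1}$ by addition; $\mathbf{w}^\times(\mathbf{u})$ is obtained from $(u_1,\dots,u_r)$ by replacing the corresponding commas by multiplication. Then $$\zeta_A(\mathfrak{s})_v:=\frac{1}{\Gamma_{\mathfrak{s}}}\sum_{\mathbf{j}\in\mathbf{J}_{\mathfrak{s}}}\sum_{\mathbf{w}\in\{0,1\}^{r-1}}(-1)^{r-1}a_{\mathbf{j}}(\theta)(-1)^{\operatorname{dep}(\mathbf{w}(\mathfrak{s}))-1}\operatorname{Li}^\star_{\mathbf{w}(\mathfrak{s})}(\mathbf{w}^\times(\mathbf{u}_{\mathbf{j}}))_v\in k_v.$$ *)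

theory Defs
  imports
    "Jordan_Normal_Form.Matrix"
    "HOL-Computational_Algebra.Polynomial_Factorial"
    "HOL-Computational_Algebra.Formal_Power_Series"
    "HOL-Library.Extended_Real"
    "HOL-Library.Cardinality"
    "HOL-Analysis.Elementary_Metric_Spaces"
begin

text \<open>
  The finite field \<open>\<F>\<^sub>q\<close> is a type \<open>'a :: {finite, field}\<close> with \<open>q = CARD('a)\<close>; then
  \<open>A = 'a poly\<close> (in the variable \<open>\<theta>\<close>), \<open>k = 'a poly fract\<close>, and \<open>A[t] = 'a poly poly\<close> with \<open>t\<close> the
  outer variable.  The operator ring \<open>\<F>\<^sub>q[t]\<close> is also \<open>'a poly\<close>, so that the passage
  \<open>a \<mapsto> a(\<theta>)\<close> from \<open>\<F>\<^sub>q[t]\<close> to \<open>A\<close> is the identity.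
\<close>

section \<open>Carlitz constants and Anderson--Thakur polynomials\<close>

definition bracket :: "nat \<Rightarrow> 'a::{finite,field} poly" where
  "bracket i = monom 1 (CARD('a) ^ i) - monom 1 1"

definition carlitz_D :: "nat \<Rightarrow> 'a::{finite,field} poly" where
  "carlitz_D i = (\<Prod>k=1..i. bracket k ^ (CARD('a) ^ (i - k)))"

text \<open>
  \<open>carlitz_gamma m\<close> is \<open>\<Gamma>\<^sub>m\<close>, given by the base-\<open>q\<close> digits of \<open>m - 1\<close>, for \<open>m \<ge> 1\<close>; the digits of
  index \<open>j \<ge> m\<close> vanish.
\<close>

definition carlitz_gamma :: "nat \<Rightarrow> 'a::{finite,field} poly" where
  "carlitz_gamma m = (\<Prod>j<m. carlitz_D j ^ ((m - 1) div CARD('a) ^ j mod CARD('a)))"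

definition subst_theta_t :: "'a::{finite,field} poly \<Rightarrow> 'a poly poly" where
  "subst_theta_t p = map_poly (\<lambda>c. [:c:]) p"

definition AT_F :: "nat \<Rightarrow> 'a::{finite,field} poly poly" where
  "AT_F i = (\<Prod>j=1..i. monom 1 (CARD('a) ^ i) - [:monom 1 (CARD('a) ^ j):])"

text \<open>
  The series \<open>\<Sum>\<^sub>i F\<^sub>i / D\<^sub>i|\<^bsub>\<theta>=t\<^esub> x^(q^i)\<close> over the field \<open>k(t)\<close>; the inner sum has at most one term.
\<close>

definition AT_series :: "'a::{finite,field} poly poly fract fps" where
  "AT_series = Abs_fps (\<lambda>n. \<Sum>i | CARD('a) ^ i = n.
     to_fract (AT_F i) / to_fract (subst_theta_t (carlitz_D i)))"

definition AT_poly :: "nat \<Rightarrow> 'a::{finite,field} poly poly" where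
  "AT_poly = (THE H. inverse (1 - AT_series) =
     Abs_fps (\<lambda>n. to_fract (H n) / to_fract (subst_theta_t (carlitz_gamma (n + 1)))))"


section \<open>The fields \<open>k\<^sub>v\<close> and \<open>\<complex>\<^sub>v\<close>\<close>

definition q_at :: "'a::{finite,field} poly \<Rightarrow> nat" where
  "q_at v = CARD('a) ^ degree v"

text \<open>
  The library's \<open>multiplicity\<close> would require the sort \<open>field_gcd\<close> for the coefficients.
\<close>

definition ord_poly :: "'a::{finite,field} poly \<Rightarrow> 'a poly \<Rightarrow> nat" where
  "ord_poly v a = (GREATEST n. v ^ n dvd a)"

definition algebraic_over :: "'c::field set \<Rightarrow> 'c \<Rightarrow> bool" where
  "algebraic_over K x \<longleftrightarrow> (\<exists>p. p \<noteq> 0 \<and> (\<forall>i. coeff p i \<in> K) \<and> poly p x = 0)"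

text \<open>
  The completion of \<open>k\<close> is its closure in the complete field \<open>\<complex>\<^sub>v\<close>.
\<close>

definition k_at :: "('a::{finite,field} poly fract \<Rightarrow> 'c::{field,metric_space}) \<Rightarrow> 'c set" where
  "k_at \<iota> = closure (range \<iota>)"

abbreviation absv :: "'c::{field,metric_space} \<Rightarrow> real" where
  "absv x \<equiv> dist x 0"

definition A_at :: "('a::{finite,field} poly fract \<Rightarrow> 'c::{field,metric_space}) \<Rightarrow> 'c set" where
  "A_at \<iota> = {x \<in> k_at \<iota>. absv x \<le> 1}"

text \<open>
  \<open>\<complex>\<^sub>v\<close> is determined up to isometric isomorphism over \<open>k\<close> as a complete, algebraically closed
  field, with a nonarchimedean absolute value extending that of \<open>k\<close>, in which the algebraic closure
  of \<open>k\<^sub>v\<close> is dense.  Completeness and algebraic closedness are in the sort of \<open>'c\<close>.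
  The absolute value is normalised by \<open>|v|\<^sub>v = 1 / q\<^sub>v\<close>.
\<close>

locale C_at = field_hom \<iota>
  for v :: "'a::{finite,field} poly"
    and \<iota> :: "'a poly fract \<Rightarrow> 'c::{alg_closed_field,complete_space}" +
  assumes dist_translate: "\<And>x y z::'c. dist (x + z) (y + z) = dist x y"
    and absv_mult: "\<And>x y::'c. absv (x * y) = absv x * absv y"
    and absv_ultrametric: "\<And>x y::'c. absv (x + y) \<le> max (absv x) (absv y)"
    and absv_k: "\<And>a b. a \<noteq> 0 \<Longrightarrow> b \<noteq> 0 \<Longrightarrow>
      absv (\<iota> (Fract a b)) =
        real (q_at v) powr (real (ord_poly v b) - real (ord_poly v a))"
    and dense: "closure {x. algebraic_over (k_at \<iota>) x} = UNIV"

definition ord_at :: "'a::{finite,field} poly \<Rightarrow> 'c::{field,metric_space} \<Rightarrow> ereal" where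
  "ord_at v x = (if x = 0 then \<infinity> else ereal (- log (real (q_at v)) (absv x)))"

definition emb :: "('a::{finite,field} poly fract \<Rightarrow> 'c::field) \<Rightarrow> 'a poly \<Rightarrow> 'c" where
  "emb \<iota> a = \<iota> (to_fract a)"

definition theta :: "('a::{finite,field} poly fract \<Rightarrow> 'c::field) \<Rightarrow> 'c" where
  "theta \<iota> = emb \<iota> (monom 1 1)"


section \<open>Twisted power series with matrix coefficients\<close>

text \<open>
  A function \<open>P :: nat \<Rightarrow> 'c mat\<close> with values in \<open>carrier_mat d d\<close> stands for the series
  \<open>\<Sum>\<^sub>i P\<^sub>i \<tau>^i\<close>, where \<open>\<tau> \<alpha> = \<alpha>^q \<tau>\<close>; polynomials in \<open>\<tau>\<close> are the series of finite support.
\<close>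

definition tw_mult :: "nat \<Rightarrow> nat \<Rightarrow> (nat \<Rightarrow> 'c::field mat) \<Rightarrow> (nat \<Rightarrow> 'c mat) \<Rightarrow> nat \<Rightarrow> 'c mat" where
  "tw_mult q d P Q n = mat d d (\<lambda>ij. \<Sum>i\<le>n. (P i * map_mat (\<lambda>x. x ^ (q ^ i)) (Q (n - i))) $$ ij)"

definition tw_const :: "nat \<Rightarrow> 'c::field mat \<Rightarrow> nat \<Rightarrow> 'c mat" where
  "tw_const d M n = (if n = 0 then M else 0\<^sub>m d d)"

definition tw_power :: "nat \<Rightarrow> nat \<Rightarrow> (nat \<Rightarrow> 'c::field mat) \<Rightarrow> nat \<Rightarrow> nat \<Rightarrow> 'c mat" where
  "tw_power q d P k = (tw_mult q d P ^^ k) (tw_const d (1\<^sub>m d))"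

text \<open>
  Coordinatewise value \<open>\<Sum>\<^sub>i P\<^sub>i x^(i)\<close>; the sum is finite if \<open>P\<close> is a polynomial in \<open>\<tau>\<close>.
\<close>

definition tw_eval ::
    "nat \<Rightarrow> nat \<Rightarrow> (nat \<Rightarrow> 'c::{field,metric_space} mat) \<Rightarrow> 'c vec \<Rightarrow> 'c vec" where
  "tw_eval q d P x = vec d (\<lambda>j. \<Sum>i. (P i *\<^sub>v map_vec (\<lambda>y. y ^ (q ^ i)) x) $ j)"


section \<open>The \<open>t\<close>-module and its logarithm\<close>

text \<open>
  Blocks and coordinates are numbered from \<open>0\<close>: block \<open>l\<close> has size \<open>blk_size t l\<close> and occupies the
  coordinates from \<open>blk_start t l\<close> to \<open>blk_start t (l + 1) - 1\<close>.
\<close>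

definition blk_size :: "nat list \<Rightarrow> nat \<Rightarrow> nat" where
  "blk_size t l = sum_list (drop l t)"

definition blk_start :: "nat list \<Rightarrow> nat \<Rightarrow> nat" where
  "blk_start t l = (\<Sum>m<l. blk_size t m)"

definition tm_dim :: "nat list \<Rightarrow> nat" where
  "tm_dim t = (\<Sum>l<length t. blk_size t l)"

definition tm_N :: "nat list \<Rightarrow> 'c::field mat" where
  "tm_N t = diag_block_mat
     (map (\<lambda>l. mat (blk_size t l) (blk_size t l) (\<lambda>(i, j). if j = i + 1 then 1 else 0))
       [0..<length t])"

definition tm_E :: "nat list \<Rightarrow> 'c::field list \<Rightarrow> 'c mat" where
  "tm_E t w = mat (tm_dim t) (tm_dim t) (\<lambda>(i, j).
     \<Sum>l<length t. \<Sum>m\<in>{l..<length t}.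
       if i = blk_start t (l + 1) - 1 \<and> j = blk_start t m
       then (- 1) ^ (m - l) * (\<Prod>e\<in>{l..<m}. w ! e) else 0)"

definition tm_lin ::
    "('a::{finite,field} poly fract \<Rightarrow> 'c::field) \<Rightarrow> nat list \<Rightarrow> 'c mat" where
  "tm_lin \<iota> t = theta \<iota> \<cdot>\<^sub>m 1\<^sub>m (tm_dim t) + tm_N t"

definition tm_rho_t ::
    "('a::{finite,field} poly fract \<Rightarrow> 'c::field) \<Rightarrow> nat list \<Rightarrow> 'c list \<Rightarrow> nat \<Rightarrow> 'c mat" where
  "tm_rho_t \<iota> t w n =
     (if n = 0 then tm_lin \<iota> t else if n = 1 then tm_E t w else 0\<^sub>m (tm_dim t) (tm_dim t))"

definition tm_rho ::
    "('a::{finite,field} poly fract \<Rightarrow> 'c::field) \<Rightarrow> nat list \<Rightarrow> 'c list \<Rightarrow> 'a poly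
      \<Rightarrow> nat \<Rightarrow> 'c mat" where
  "tm_rho \<iota> t w a n = mat (tm_dim t) (tm_dim t) (\<lambda>ij. \<Sum>k\<le>degree a.
     emb \<iota> [:coeff a k:] * tw_power CARD('a) (tm_dim t) (tm_rho_t \<iota> t w) k n $$ ij)"

definition tm_log ::
    "('a::{finite,field} poly fract \<Rightarrow> 'c::field) \<Rightarrow> nat list \<Rightarrow> 'c list \<Rightarrow> nat \<Rightarrow> 'c mat" where
  "tm_log \<iota> t w = (THE P. (\<forall>n. P n \<in> carrier_mat (tm_dim t) (tm_dim t))
     \<and> P 0 = 1\<^sub>m (tm_dim t)
     \<and> tw_mult CARD('a) (tm_dim t) P (tm_rho_t \<iota> t w)
       = tw_mult CARD('a) (tm_dim t) (tw_const (tm_dim t) (tm_lin \<iota> t)) P)"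

definition tm_point :: "nat list \<Rightarrow> 'c::field list \<Rightarrow> 'c vec" where
  "tm_point t w = vec (tm_dim t) (\<lambda>i. \<Sum>l<length t.
     if i = blk_start t (l + 1) - 1
     then (- 1) ^ (length t - (l + 1)) * (\<Prod>e\<in>{l..<length t}. w ! e) else 0)"


section \<open>\<open>v\<close>-adic star polylogarithms and \<open>v\<close>-adic multiple zeta values\<close>

definition tm_rho_point ::
    "('a::{finite,field} poly fract \<Rightarrow> 'c::{field,metric_space}) \<Rightarrow> nat list \<Rightarrow> 'c list
      \<Rightarrow> 'a poly \<Rightarrow> 'c vec" where
  "tm_rho_point \<iota> t w a = tw_eval CARD('a) (tm_dim t) (tm_rho \<iota> t w a) (tm_point t w)"

definition admissible ::
    "('a::{finite,field} poly fract \<Rightarrow> 'c::{field,metric_space}) \<Rightarrow> nat list \<Rightarrow> 'c list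
      \<Rightarrow> 'a poly \<Rightarrow> bool" where
  "admissible \<iota> t w a \<longleftrightarrow> a \<noteq> 0 \<and> (\<forall>j<tm_dim t. absv (tm_rho_point \<iota> t w a $ j) < 1)"

text \<open>
  \<open>Li_star \<iota> s u\<close> is meant for \<open>u\<close> with entries algebraic over \<open>k\<close> and of absolute value at most \<open>1\<close>;
  an admissible \<open>a\<close> then exists and the value does not depend on its choice.
\<close>

definition Li_star ::
    "('a::{finite,field} poly fract \<Rightarrow> 'c::{field,metric_space}) \<Rightarrow> nat list \<Rightarrow> 'c list \<Rightarrow> 'c" where
  "Li_star \<iota> s u =
     (let t = rev s; w = rev u; a = (SOME a. admissible \<iota> t w a) in
       (- 1) ^ (length s - 1) / emb \<iota> a *
         tw_eval CARD('a) (tm_dim t) (tm_log \<iota> t w) (tm_rho_point \<iota> t w a) $ (sum_list s - 1))"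

text \<open>
  \<open>merge f w xs\<close> replaces the comma after the \<open>i\<close>-th entry of \<open>xs\<close> by the operation \<open>f\<close> whenever the
  \<open>i\<close>-th entry of \<open>w\<close> is \<open>True\<close>; here \<open>{0,1}\<close> is rendered as \<open>bool\<close>.
\<close>

fun merge :: "('b \<Rightarrow> 'b \<Rightarrow> 'b) \<Rightarrow> bool list \<Rightarrow> 'b list \<Rightarrow> 'b list" where
  "merge f (b # bs) (x # y # xs) =
     (if b then merge f bs (f x y # xs) else x # merge f bs (y # xs))"
| "merge f _ xs = xs"

definition index_J :: "'a::{finite,field} itself \<Rightarrow> nat list \<Rightarrow> nat list set" where
  "index_J _ s = {j. length j = length s \<and>
     (\<forall>i<length s. j ! i \<le> degree (AT_poly (s ! i - 1) :: 'a poly poly))}"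

definition index_u ::
    "('a::{finite,field} poly fract \<Rightarrow> 'c::field) \<Rightarrow> nat list \<Rightarrow> nat list \<Rightarrow> 'c list" where
  "index_u \<iota> s j = map (\<lambda>i. emb \<iota> (coeff (AT_poly (s ! i - 1)) (j ! i))) [0..<length s]"

definition zeta_at ::
    "('a::{finite,field} poly fract \<Rightarrow> 'c::{field,metric_space}) \<Rightarrow> nat list \<Rightarrow> 'c" where
  "zeta_at \<iota> s = 1 / emb \<iota> (prod_list (map carlitz_gamma s)) *
     (\<Sum>j\<in>index_J TYPE('a) s. \<Sum>w\<in>{w. length w = length s - 1}.
       (- 1) ^ (length s - 1) * theta \<iota> ^ sum_list j *
       (- 1) ^ (length (merge (+) w s) - 1) *
       Li_star \<iota> (merge (+) w s) (merge (*) w (index_u \<iota> s j)))"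


section \<open>The bound\<close>

definition wt :: "nat list \<Rightarrow> nat" where "wt s = sum_list s"
definition dep :: "nat list \<Rightarrow> nat" where "dep s = length s"
definition ht :: "nat list \<Rightarrow> nat" where "ht s = card {i. i < length s \<and> s ! i \<noteq> 1}"

definition B_at :: "nat \<Rightarrow> 'a::{finite,field} poly \<Rightarrow> int" where
  "B_at w v = (LEAST b. \<exists>n::nat. b = int (q_at v ^ n) - int (n * w))"

end

theory Submission
  imports Defs "Jordan_Normal_Form.Char_Poly"
begin

text \<open>
  Only one coordinate of \<open>log\<^sub>G\<close> enters, namely the one given by the row \<open>R\<^sub>n\<close> of the \<open>n\<close>-th coefficient
  that ends the first block.  It satisfies \<open>R\<^sub>n ([n] + N) = - R\<^sub>n\<^sub>-\<^sub>1 E^(n-1)\<close>, and since \<open>E\<close> is integral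
  with nonzero columns only at block starts, and \<open>ord\<^sub>v [n]\<close> is \<open>1\<close> or \<open>0\<close> according to whether \<open>deg v\<close>
  divides \<open>n\<close>, its entries have valuation at least \<open>- wt \<lfloor>n / deg v\<rfloor>\<close>.

  The polynomial \<open>a = \<Prod>\<^sub>l (v^(d\<^sub>l) - 1)\<close> is a \<open>v\<close>-adic unit which annihilates the integral points of the
  \<open>t\<close>-module modulo \<open>v\<close>: on the \<open>l\<close>-th block, once the later blocks vanish, \<open>(t - \<theta>)^(d\<^sub>l)\<close> acts on the
  first coordinate as the Frobenius, hence \<open>v(t)^(d\<^sub>l) \<equiv> (\<Prod>\<^sub>i (t - \<theta>^(q^i)))^(d\<^sub>l)\<close> acts as the
  \<open>q\<^sub>v\<close>-power map, which is the identity on \<open>A/v\<close>.  So the logarithm is evaluated at a point of valuation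
  at least \<open>1\<close>, its \<open>n\<close>-th term has valuation at least \<open>q^n - wt \<lfloor>n / deg v\<rfloor> \<ge> B\<close>, and so has every
  \<open>Li\<^sup>\<star>\<close>.  The remaining loss is the valuation of the Carlitz factorials, bounded as in Legendre's formula.
\<close>

section \<open>Finite fields\<close>

text \<open>\<open>Li_star\<close> chooses its \<open>a\<close> arbitrarily: such an
  \<open>a\<close> may be divisible by v, and the point it produces may lie anywhere in the open
  unit polydisc, so neither the denominator nor the logarithm can be estimated directly. The way out
  is that the relevant coordinate of the logarithm is F_q[t]-linear on the whole polydisc, t acting
  as multiplication by \<theta>. This makes the quotient independent of \<open>a\<close>, and one
  well-behaved annihilator can replace the chosen one.

  Valuation at least 1, and not merely positive, comes from arithmetic: an element of A in the
  maximal ideal is divisible by v, whereas C_v contains elements of arbitrarily small positive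
  valuation. The point is therefore followed as a vector over A as well as modulo the maximal ideal.
  It is such a vector because the arguments of the polylogarithms are products of coefficients of
  Anderson-Thakur polynomials. Merging keeps both this property and the weight, so a single exponent
  B serves all summands of the zeta value.\<close>

lemma two_le_card_field: "2 \<le> CARD('a::{finite,field})"
proof -
  have "card {0, 1 :: 'a} \<le> CARD('a)" by (rule card_mono) auto
  thus ?thesis by simp
qed

text \<open>Multiplication by a unit permutes the units, so their product absorbs the factor
  x^(q-1).\<close>

lemma finite_field_pow_card: "x ^ CARD('a) = (x :: 'a::{finite,field})"
proof (cases "x = 0")
  case True
  thus ?thesis by simp
next
  case False
  let ?U = "UNIV - {0 :: 'a}"
  have bij: "bij_betw ((*) x) ?U ?U"
    by (rule bij_betw_byWitness[where f' = "\<lambda>y. y / x"]) (use False in auto)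
  have "prod (\<lambda>y. y) ?U = (\<Prod>y\<in>?U. x * y)"
    by (rule prod.reindex_bij_betw[OF bij, symmetric])
  also have "\<dots> = x ^ card ?U * prod (\<lambda>y. y) ?U"
    by (simp add: prod.distrib)
  finally have "x ^ card ?U = 1" by simp
  moreover have "CARD('a) = Suc (card ?U)"
    by (rule card_Suc_Diff1[symmetric]) auto
  ultimately show ?thesis by (simp only: power_Suc mult_1_right)
qed

text \<open>The polynomial (X+1)^q - X^q - 1 has degree below q and vanishes at all q elements of
  the field, hence is zero. This gives additivity of the q-th power without writing q as a power of
  the characteristic.\<close>

lemma finite_field_binomial_eq_0:
  assumes "0 < k" "k < CARD('a)"
  shows "of_nat (CARD('a) choose k) = (0 :: 'a::{finite,field})"
proof -
  let ?q = "CARD('a)"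
  define p :: "'a poly" where "p = (\<Sum>k\<in>{1..<?q}. monom (of_nat (?q choose k)) k)"
  have coeff: "coeff p k = (if 0 < k \<and> k < ?q then of_nat (?q choose k) else 0)" for k
    by (auto simp: p_def coeff_sum if_distrib cong: if_cong)
  have deg: "degree p < ?q"
    by (rule degree_lessI) (use two_le_card_field[where 'a = 'a] in \<open>auto simp: coeff\<close>)
  have "poly p x = 0" for x
  proof -
    have "{..?q} = insert 0 (insert ?q {1..<?q})" by auto
    hence "(x + 1) ^ ?q = x ^ ?q + 1 + (\<Sum>k\<in>{1..<?q}. of_nat (?q choose k) * x ^ k)"
      by (subst binomial_ring) simp
    thus ?thesis by (simp add: finite_field_pow_card p_def poly_sum poly_monom)
  qed
  hence "p = 0"
    using deg poly_roots_degree[of p] by (cases "p = 0") auto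
  thus ?thesis using coeff[of k] assms by simp
qed


section \<open>The absolute value\<close>

locale place = C_at v \<iota>
  for v :: "'a::{finite,field} poly"
    and \<iota> :: "'a poly fract \<Rightarrow> 'c::{alg_closed_field,complete_space}" +
  fixes q :: nat
  assumes q_card: "CARD('a) = q" and monic: "lead_coeff v = 1" and irred: "irreducible v"
begin

abbreviation qv :: nat where "qv \<equiv> q_at v"
abbreviation dv :: nat where "dv \<equiv> degree v"
abbreviation em :: "'a poly \<Rightarrow> 'c" where "em \<equiv> emb \<iota>"
abbreviation \<theta> :: 'c where "\<theta> \<equiv> theta \<iota>"
definition kappa :: "'a \<Rightarrow> 'c" where "kappa c = em [:c:]"

sublocale em: inj_idom_hom em
  by unfold_locales (auto simp: emb_def hom_add hom_mult hom_0)

sublocale kappa: field_hom kappa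
  by unfold_locales (simp_all add: kappa_def flip: one_pCons em.hom_add em.hom_mult)

lemma v_nz: "v \<noteq> 0" using irred by auto

lemma dv_pos: "0 < dv"
  using irred by (auto simp: irreducible_def is_unit_iff_degree)

lemma q_ge_2: "2 \<le> q"
  using two_le_card_field[where 'a = 'a] by (simp add: q_card)

lemma qv_eq: "qv = q ^ dv"
  by (simp add: q_at_def q_card)

lemma qv_ge_2: "2 \<le> qv"
proof -
  have "q ^ 1 \<le> q ^ dv" by (rule power_increasing) (use dv_pos q_ge_2 in auto)
  thus ?thesis using q_ge_2 by (simp add: qv_eq)
qed

lemma binomial_eq_0:
  assumes "0 < k" "k < q"
  shows "of_nat (q choose k) = (0 :: 'c)"
proof -
  have "kappa (of_nat (q choose k)) = 0"
    using finite_field_binomial_eq_0[where 'a = 'a and k = k] assms by (simp add: q_card)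
  thus ?thesis by (simp only: kappa.hom_of_nat)
qed

lemma frob_add: "(x + y :: 'c) ^ q = x ^ q + y ^ q"
proof -
  have "{..q} = insert 0 (insert q {1..<q})" using q_ge_2 by auto
  hence "(x + y) ^ q = x ^ q + y ^ q + (\<Sum>k\<in>{1..<q}. of_nat (q choose k) * x ^ k * y ^ (q - k))"
    using q_ge_2 by (subst binomial_ring) simp
  thus ?thesis by (simp add: binomial_eq_0)
qed

lemma frobn_add: "(x + y :: 'c) ^ (q ^ n) = x ^ (q ^ n) + y ^ (q ^ n)"
  by (induction n arbitrary: x y) (simp_all add: power_mult frob_add)

lemma frobn_minus: "(- x :: 'c) ^ (q ^ n) = - (x ^ (q ^ n))"
proof -
  have "x ^ (q ^ n) + (- x) ^ (q ^ n) = 0 ^ (q ^ n)"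
    using frobn_add[of x "- x" n] by simp
  thus ?thesis using q_ge_2 by (simp add: power_0_left minus_unique)
qed

lemma frobn_diff: "(x - y :: 'c) ^ (q ^ n) = x ^ (q ^ n) - y ^ (q ^ n)"
  using frobn_add[of x "- y" n] by (simp only: frobn_minus add_uminus_conv_diff)

lemma frobn_sum: "(\<Sum>i\<in>I. f i :: 'c) ^ (q ^ n) = (\<Sum>i\<in>I. f i ^ (q ^ n))"
  using q_ge_2
  by (induction I rule: infinite_finite_induct) (simp_all add: frobn_add power_0_left)

lemma kappa_frobn: "kappa c ^ (q ^ n) = kappa c"
proof (induction n)
  case (Suc n)
  have "kappa c ^ q = kappa c"
    using finite_field_pow_card[of c] by (simp add: q_card flip: kappa.hom_power)
  thus ?case using Suc by (simp add: power_mult mult.commute)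
qed simp

lemma dist_eq_absv: "dist x y = absv (x - y :: 'c)"
  using dist_translate[where x = x and y = y and z = "- y"] by simp

lemma absv_1 [simp]: "absv (1 :: 'c) = 1"
proof -
  have "absv (1 :: 'c) * absv (1 :: 'c) = absv (1 * 1 :: 'c)" by (rule absv_mult[symmetric])
  thus ?thesis by simp
qed

lemma absv_minus [simp]: "absv (- x :: 'c) = absv x"
  using dist_eq_absv[of 0 x] by (simp add: dist_commute)

lemma absv_power: "absv (x ^ n :: 'c) = absv x ^ n"
  by (induction n) (simp_all add: absv_mult)

lemma absv_divide: "absv (x / y :: 'c) = absv x / absv y"
proof (cases "y = 0")
  case False
  have "absv (x / y) * absv y = absv x"
    by (simp add: False flip: absv_mult)
  thus ?thesis using False by (simp add: field_simps)
qed simp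

lemma absv_prod: "absv (\<Prod>i\<in>I. f i :: 'c) = (\<Prod>i\<in>I. absv (f i))"
  by (induction I rule: infinite_finite_induct) (simp_all add: absv_mult)

lemma absv_diff_le: "absv (x - y :: 'c) \<le> max (absv x) (absv y)"
  using absv_ultrametric[of x "- y"] by simp

lemma absv_sum_le:
  assumes "\<And>i. i \<in> I \<Longrightarrow> absv (f i :: 'c) \<le> B" and "0 \<le> B"
  shows "absv (\<Sum>i\<in>I. f i) \<le> B"
  using assms(1)
proof (induction I rule: infinite_finite_induct)
  case (insert i I)
  thus ?case using absv_ultrametric[of "f i" "sum f I"] by fastforce
qed (use assms(2) in auto)

lemma absv_sum_less:
  assumes "\<And>i. i \<in> I \<Longrightarrow> absv (f i :: 'c) < B" and "0 < B"
  shows "absv (\<Sum>i\<in>I. f i) < B"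
  using assms(1)
proof (induction I rule: infinite_finite_induct)
  case (insert i I)
  thus ?case using absv_ultrametric[of "f i" "sum f I"] by fastforce
qed (use assms(2) in auto)

lemma absv_neg_one_power [simp]: "absv ((- 1) ^ n :: 'c) = 1"
  by (simp add: absv_power)

text \<open>The degree of \<open>p\<close> bounds the exponents, so the \<open>GREATEST\<close> in
  \<open>ord_poly\<close> is attained.\<close>

lemma ord_poly_props:
  assumes "p \<noteq> 0"
  shows "v ^ ord_poly v p dvd p" and "v ^ n dvd p \<Longrightarrow> n \<le> ord_poly v p"
proof -
  have bound: "n \<le> degree p" if "v ^ n dvd p" for n
  proof -
    have "n * dv \<le> degree p"
      using dvd_imp_degree_le[OF that assms] by (simp add: degree_power_eq v_nz mult.commute)
    moreover have "n \<le> n * dv" using dv_pos by simp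
    ultimately show ?thesis by (rule order_trans[rotated])
  qed
  show "v ^ ord_poly v p dvd p"
    unfolding ord_poly_def by (rule GreatestI_nat[of _ 0 "degree p"]) (use bound in auto)
  show "n \<le> ord_poly v p" if "v ^ n dvd p"
    unfolding ord_poly_def by (rule Greatest_le_nat[where b = "degree p"]) (use bound that in auto)
qed

lemma absv_em: "p \<noteq> 0 \<Longrightarrow> absv (em p) = real qv powr (- real (ord_poly v p))"
proof -
  assume p: "p \<noteq> 0"
  \<comment> \<open>\<open>absv_k\<close> speaks of fractions; the denominator 1 has to contribute
    order 0.\<close>
  have "ord_poly v 1 = 0"
  proof (rule ccontr)
    assume "ord_poly v 1 \<noteq> 0"
    hence "v dvd v ^ ord_poly v 1" by simp
    hence "v dvd 1" using ord_poly_props(1)[of 1] by (rule dvd_trans) simp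
    thus False using irred by (simp add: irreducible_def)
  qed
  thus ?thesis using absv_k[OF p, of 1] by (simp add: emb_def to_fract_def)
qed

lemma absv_em_le_1: "absv (em p) \<le> 1"
proof (cases "p = 0")
  case False
  have "real qv powr (- real (ord_poly v p)) \<le> real qv powr 0"
    by (rule powr_mono) (use qv_ge_2 in auto)
  thus ?thesis using False qv_ge_2 by (simp add: absv_em)
qed simp

text \<open>Orders of elements of A are integers, so no absolute value lies strictly between 1/q_v
  and 1. On C_v, whose value group is dense, this gap does not exist.\<close>

lemma absv_em_less_1:
  assumes "absv (em p) < 1"
  shows "absv (em p) \<le> 1 / real qv"
proof (cases "p = 0")
  case False
  have "ord_poly v p \<noteq> 0"
    using assms absv_em[OF False] qv_ge_2 by (intro notI) simp
  hence "real qv powr (- real (ord_poly v p)) \<le> real qv powr (- 1)"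
    by (intro powr_mono) (use qv_ge_2 in auto)
  thus ?thesis using absv_em[OF False] qv_ge_2 by (simp add: powr_minus_divide)
qed simp

lemma absv_em_v: "absv (em v) < 1"
proof -
  have "1 \<le> ord_poly v v" using ord_poly_props(2)[OF v_nz, of 1] by simp
  hence "real qv powr (- real (ord_poly v v)) < real qv powr 0"
    by (intro powr_less_mono) (use qv_ge_2 in auto)
  thus ?thesis using absv_em[OF v_nz] qv_ge_2 by simp
qed

lemma absv_theta_le_1: "absv \<theta> \<le> 1"
  unfolding theta_def by (rule absv_em_le_1)

lemma absv_kappa_le_1: "absv (kappa c) \<le> 1"
  unfolding kappa_def by (rule absv_em_le_1)

section \<open>Congruence modulo the maximal ideal of the valuation ring\<close>

definition cg :: "'c \<Rightarrow> 'c \<Rightarrow> bool" (infix "\<simeq>" 50) where "x \<simeq> y \<longleftrightarrow> absv (x - y) < 1"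

lemma cg_refl [simp]: "x \<simeq> x" by (simp add: cg_def)

lemma cg_sym: "x \<simeq> y \<Longrightarrow> y \<simeq> x"
  unfolding cg_def using absv_minus[of "x - y"] by simp

lemma cg_trans [trans]: "x \<simeq> y \<Longrightarrow> y \<simeq> z \<Longrightarrow> x \<simeq> z"
  unfolding cg_def using absv_ultrametric[of "x - y" "y - z"] by simp

lemma cg_eq_trans [trans]: "x = y \<Longrightarrow> y \<simeq> z \<Longrightarrow> x \<simeq> z"
  and eq_cg_trans [trans]: "x \<simeq> y \<Longrightarrow> y = z \<Longrightarrow> x \<simeq> z" by simp_all

lemma cg_add: "x \<simeq> y \<Longrightarrow> x' \<simeq> y' \<Longrightarrow> x + x' \<simeq> y + y'"
  unfolding cg_def using absv_ultrametric[of "x - y" "x' - y'"] by (simp add: algebra_simps)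

lemma cg_diff: "x \<simeq> y \<Longrightarrow> x' \<simeq> y' \<Longrightarrow> x - x' \<simeq> y - y'"
  unfolding cg_def using absv_diff_le[of "x - y" "x' - y'"] by (simp add: algebra_simps)

lemma cg_mult:
  assumes "x \<simeq> y" "x' \<simeq> y'" "absv x \<le> 1" "absv y' \<le> 1"
  shows "x * x' \<simeq> y * y'"
proof -
  have "x * x' - y * y' = x * (x' - y') + (x - y) * y'" by (simp add: algebra_simps)
  moreover have "absv (x * (x' - y')) < 1"
    using assms mult_left_le_one_le[of "absv (x' - y')" "absv x"]
    by (simp add: absv_mult cg_def)
  moreover have "absv ((x - y) * y') < 1"
    using assms mult_right_le_one_le[of "absv (x - y)" "absv y'"]
    by (simp add: absv_mult cg_def)
  ultimately show ?thesis
    unfolding cg_def using absv_ultrametric[of "x * (x' - y')" "(x - y) * y'"] by simp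
qed

lemma cg_mult_left: "x \<simeq> y \<Longrightarrow> absv c \<le> 1 \<Longrightarrow> c * x \<simeq> c * y"
  using mult_left_le_one_le[of "absv (x - y)" "absv c"]
  by (simp add: cg_def absv_mult flip: right_diff_distrib)

lemma cg_sum: "(\<And>i. i \<in> I \<Longrightarrow> f i \<simeq> g i) \<Longrightarrow> (\<Sum>i\<in>I. f i) \<simeq> (\<Sum>i\<in>I. g i)"
  unfolding cg_def by (simp add: absv_sum_less flip: sum_subtractf)

lemma cg_frobn: "x \<simeq> y \<Longrightarrow> x ^ (q ^ n) \<simeq> y ^ (q ^ n)"
  using q_ge_2 by (simp add: cg_def absv_power power_less_one_iff flip: frobn_diff)

lemma cg_0_iff: "x \<simeq> 0 \<longleftrightarrow> absv x < 1" by (simp add: cg_def)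

lemma absv_eq_1_cg: "x \<simeq> y \<Longrightarrow> absv y = 1 \<Longrightarrow> absv x = 1"
  using absv_ultrametric[of "x - y" y] absv_ultrametric[of "y - x" x] absv_minus[of "x - y"]
  by (auto simp: cg_def max_def split: if_splits)

section \<open>A root of \<open>v\<close> close to \<open>\<theta>\<close>\<close>

text \<open>
  The residue field \<open>A/v\<close> is realised inside \<open>\<complex>\<^sub>v\<close> as \<open>\<F>\<^sub>q(\<beta>)\<close>, where \<open>\<beta>\<close> is a root of \<open>v\<close> congruent to
  \<open>\<theta>\<close>; this makes the factorisation of \<open>v\<close> modulo \<open>v\<close> an identity in a field.
\<close>

definition ev :: "'a poly \<Rightarrow> 'c \<Rightarrow> 'c" where "ev p x = poly (map_poly kappa p) x"

lemma ev_simps [simp]: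
  "ev 0 x = 0" "ev (pCons a p) x = kappa a + x * ev p x"
  "ev (p + p') x = ev p x + ev p' x" "ev (p - p') x = ev p x - ev p' x"
  "ev (p * p') x = ev p x * ev p' x" "ev (monom 1 n) x = x ^ n"
proof -
  interpret mp: map_poly_comm_ring_hom kappa ..
  show
    "ev 0 x = 0" "ev (pCons a p) x = kappa a + x * ev p x"
    "ev (p + p') x = ev p x + ev p' x" "ev (p - p') x = ev p x - ev p' x"
    "ev (p * p') x = ev p x * ev p' x" "ev (monom 1 n) x = x ^ n"
    by (simp_all add: ev_def kappa.map_poly_pCons_hom mp.hom_add mp.hom_minus mp.hom_mult poly_monom)
qed

lemma em_pCons: "em (pCons a p) = kappa a + \<theta> * em p"
proof -
  have "pCons a p = [:a:] + monom 1 1 * p" by (simp add: monom_Suc)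
  thus ?thesis by (simp only: em.hom_add em.hom_mult kappa_def theta_def)
qed

lemma em_eq_ev: "em p = ev p \<theta>"
  by (induction p) (simp_all add: em_pCons)

lemma ev_frobn: "ev p (x ^ (q ^ n)) = ev p x ^ (q ^ n)"
  using q_ge_2 by (induction p) (simp_all add: frobn_add kappa_frobn power_mult_distrib power_0_left)

text \<open>The value v(\<theta>) is the product of \<theta> - x over the roots x of v. It has
  absolute value below 1, so one of the factors has too.\<close>

lemma ex_close_root: "\<exists>\<beta>. ev v \<beta> = 0 \<and> \<theta> \<simeq> \<beta>"
proof (rule ccontr)
  assume far: "\<not> ?thesis"
  define vC where "vC = map_poly kappa v"
  have "vC \<noteq> 0" using v_nz by (simp add: vC_def)
  moreover have "lead_coeff vC = 1"
    using monic by (simp add: vC_def)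
  ultimately obtain A where A: "vC = (\<Prod>x\<in>#A. [:-x, 1:])"
    using alg_closed_imp_factorization[of vC] by auto
  have ge: "1 \<le> absv (\<theta> - x)" if "x \<in># A" for x
  proof -
    have "poly vC x = 0"
      unfolding A poly_prod_mset prod_mset_zero_iff using that by force
    thus ?thesis using far by (auto simp: cg_def ev_def vC_def not_less)
  qed
  have "1 \<le> absv (\<Prod>x\<in>#B. \<theta> - x)" if "set_mset B \<subseteq> set_mset A" for B
    using that
  proof (induction B)
    case (add x B)
    have "1 * 1 \<le> absv (\<theta> - x) * absv (\<Prod>x\<in>#B. \<theta> - x)"
      by (rule mult_mono) (use add ge in auto)
    thus ?case by (simp add: absv_mult)
  qed simp
  moreover have "em v = (\<Prod>x\<in>#A. \<theta> - x)"
  proof -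
    have "poly (\<Prod>x\<in>#B. [:-x, 1:]) \<theta> = (\<Prod>x\<in>#B. \<theta> - x)" for B
      by (induction B) (simp_all add: algebra_simps)
    thus ?thesis using A by (simp add: em_eq_ev ev_def vC_def)
  qed
  ultimately show False using absv_em_v by fastforce
qed

definition beta :: 'c where "beta = (SOME \<beta>. ev v \<beta> = 0 \<and> \<theta> \<simeq> \<beta>)"

lemma ev_v_beta: "ev v beta = 0" and theta_cg_beta: "\<theta> \<simeq> beta"
  using someI_ex[OF ex_close_root] by (simp_all add: beta_def)

text \<open>v is the minimal polynomial of \<open>beta\<close> over F_q: a nonzero polynomial of
  least degree vanishing at \<open>beta\<close> divides v by division with remainder. If its degree
  were below that of v, irreducibility would make it a constant, which does not vanish.\<close>

lemma ev_beta_eq_0: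
  assumes "ev p beta = 0" "degree p < dv"
  shows "p = 0"
proof (rule ccontr)
  assume "p \<noteq> 0"
  define Z where "Z p \<longleftrightarrow> p \<noteq> 0 \<and> ev p beta = 0" for p
  have "Z p" using \<open>p \<noteq> 0\<close> assms(1) by (simp add: Z_def)
  then obtain m where "Z m" and "\<forall>p'. Z p' \<longrightarrow> degree m \<le> degree p'"
    using ex_has_least_nat[of Z p degree] by blast
  hence m: "m \<noteq> 0" "ev m beta = 0"
    and least: "\<And>p'. p' \<noteq> 0 \<Longrightarrow> ev p' beta = 0 \<Longrightarrow> degree m \<le> degree p'"
    by (auto simp: Z_def)
  have "ev (v mod m) beta = 0"
  proof -
    have "v = v div m * m + v mod m" by simp
    hence "ev v beta = ev (v div m * m + v mod m) beta" by (rule arg_cong)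
    thus ?thesis unfolding ev_simps using m ev_v_beta by simp
  qed
  hence "v mod m = 0"
    using least[of "v mod m"] degree_mod_less[of m v] m(1) by force
  hence "m dvd v" by auto
  then obtain r where r: "v = m * r" ..
  hence "m dvd 1 \<or> r dvd 1" using irreducibleD[OF irred] by blast
  moreover have "degree m < dv" using least[OF \<open>p \<noteq> 0\<close> assms(1)] assms(2) by simp
  moreover have "r \<noteq> 0" using r v_nz by auto
  moreover have "dv = degree m + degree r"
    unfolding r using m(1) \<open>r \<noteq> 0\<close> by (rule degree_mult_eq)
  ultimately have "degree m = 0"
    using m(1) by (auto simp: is_unit_iff_degree)
  then obtain c where "m = [:c:]" by (rule degree_eq_zeroE)
  thus False using m by (simp add: ev_def)
qed

text \<open>If the q^k-power map fixes \<open>beta\<close>, it fixes all of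
  F_q(\<open>beta\<close>), whose q^\<open>dv\<close> elements are the values at \<open>beta\<close>
  of polynomials given by coefficient lists of length \<open>dv\<close>. But X^(q^k) - X has at most
  q^k roots.\<close>

lemma beta_frobn_period_ge:
  assumes "0 < k" "beta ^ (q ^ k) = beta"
  shows "dv \<le> k"
proof -
  define X where "X = {xs :: 'a list. length xs = dv}"
  define f where "f xs = ev (Poly xs) beta" for xs :: "'a list"
  have "inj_on f X"
  proof (rule inj_onI)
    fix xs ys assume xy: "xs \<in> X" "ys \<in> X" "f xs = f ys"
    have "degree (Poly xs - Poly ys) < dv"
      by (rule degree_lessI) (use xy dv_pos in \<open>auto simp: X_def coeff_Poly_eq nth_default_def\<close>)
    hence "Poly xs = Poly ys"
      using ev_beta_eq_0[of "Poly xs - Poly ys"] xy(3) by (simp add: f_def)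
    thus "xs = ys"
      using xy by (intro nth_equalityI) (auto simp: X_def poly_eq_iff nth_default_def coeff_Poly_eq split: if_splits)
  qed
  hence card: "card (f ` X) = q ^ dv"
    using card_lists_length_eq[of "UNIV :: 'a set" dv] by (simp add: card_image X_def q_card)
  define g :: "'c poly" where "g = monom 1 (q ^ k) - monom 1 1"
  have "1 < q ^ k" using q_ge_2 assms(1) by (intro one_less_power) auto
  hence g: "degree g = q ^ k"
    using degree_add_eq_left[of "- monom 1 1 :: 'c poly" "monom 1 (q ^ k)"]
    by (simp add: g_def degree_monom_eq)
  have "f ` X \<subseteq> {x. poly g x = 0}"
    by (auto simp: g_def poly_monom f_def assms(2) simp flip: ev_frobn)
  moreover have "g \<noteq> 0" using g q_ge_2 by auto
  ultimately have "card (f ` X) \<le> card {x. poly g x = 0}"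
    by (intro card_mono poly_roots_finite)
  also have "\<dots> \<le> q ^ k" using poly_roots_degree[OF \<open>g \<noteq> 0\<close>] g by simp
  finally have "q ^ dv \<le> q ^ k" using card by simp
  thus ?thesis using power_le_imp_le_exp[of q dv k] q_ge_2 by linarith
qed

lemma beta_frobn_cancel:
  assumes "beta ^ (q ^ i) = beta ^ (q ^ j)" "i \<le> j"
  shows "beta ^ (q ^ (j - i)) = beta"
proof -
  have "q ^ j = q ^ (j - i) * q ^ i" using assms(2) by (simp flip: power_add)
  hence "(beta ^ (q ^ (j - i)) - beta) ^ (q ^ i) = 0"
    using assms(1) by (simp add: frobn_diff power_mult)
  thus ?thesis by simp
qed

lemma beta_frobn_inj: "inj_on (\<lambda>i. beta ^ (q ^ i)) {..<dv}"
proof (rule linorder_inj_onI)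
  fix i j assume "i < j" "i \<in> {..<dv}" "j \<in> {..<dv}"
  thus "beta ^ (q ^ i) \<noteq> beta ^ (q ^ j)"
    using beta_frobn_cancel[of i j] beta_frobn_period_ge[of "j - i"] by fastforce
qed auto

lemma beta_frobn_root: "ev v (beta ^ (q ^ i)) = 0"
  using q_ge_2 by (simp add: ev_frobn ev_v_beta)

text \<open>The conjugates with exponents i = 0, ..., \<open>dv\<close> are all roots of v, which
  has only \<open>dv\<close> of them, so two coincide. Cancelling Frobenius gives a period of at
  most \<open>dv\<close>, and a smaller one is excluded by
  \<open>beta_frobn_period_ge\<close>.\<close>

lemma beta_period: "beta ^ (q ^ dv) = beta"
proof -
  have "\<not> inj_on (\<lambda>i. beta ^ (q ^ i)) {..dv}"
  proof
    assume "inj_on (\<lambda>i. beta ^ (q ^ i)) {..dv}"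
    hence "Suc dv = card ((\<lambda>i. beta ^ (q ^ i)) ` {..dv})" by (simp add: card_image)
    also have "\<dots> \<le> card {x. poly (map_poly kappa v) x = 0}"
      by (rule card_mono) (use beta_frobn_root v_nz in \<open>auto simp: ev_def poly_roots_finite\<close>)
    also have "\<dots> \<le> dv" using poly_roots_degree[of "map_poly kappa v"] v_nz by simp
    finally show False by simp
  qed
  then obtain i j where "i < j" "j \<le> dv" "beta ^ (q ^ i) = beta ^ (q ^ j)"
    by (auto simp: inj_on_def) (metis linorder_neqE_nat)
  moreover from this have "j - i = dv"
    using beta_frobn_cancel[of i j] beta_frobn_period_ge[of "j - i"] by auto
  ultimately show ?thesis using beta_frobn_cancel[of i j] by simp
qed

text \<open>Both sides are monic of degree \<open>dv\<close> and agree at the \<open>dv\<close>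
  distinct conjugates of \<open>beta\<close>.\<close>

lemma v_factorization: "map_poly kappa v = (\<Prod>i<dv. [:- (beta ^ (q ^ i)), 1:])"
proof (rule poly_eqI_degree_lead_coeff[where n = dv and A = "(\<lambda>i. beta ^ (q ^ i)) ` {..<dv}"])
  have deg: "degree (\<Prod>i<n. [:- (beta ^ (q ^ i)), 1:]) = n" for n
    by (subst degree_prod_eq_sum_degree) auto
  show "degree (\<Prod>i<dv. [:- (beta ^ (q ^ i)), 1:]) \<le> dv" by (simp add: deg)
  have "lead_coeff (\<Prod>i<dv. [:- (beta ^ (q ^ i)), 1:]) = 1"
    by (simp add: lead_coeff_prod)
  thus "coeff (map_poly kappa v) dv = coeff (\<Prod>i<dv. [:- (beta ^ (q ^ i)), 1:]) dv"
    using monic by (simp add: deg)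
  show "dv \<le> card ((\<lambda>i. beta ^ (q ^ i)) ` {..<dv})"
    by (simp add: card_image beta_frobn_inj)
next
  fix x assume "x \<in> (\<lambda>i. beta ^ (q ^ i)) ` {..<dv}"
  thus "poly (map_poly kappa v) x = poly (\<Prod>i<dv. [:- (beta ^ (q ^ i)), 1:]) x"
    using beta_frobn_root by (auto simp: ev_def poly_prod)
qed simp_all

lemma ev_beta_frob_dv: "ev p beta ^ (q ^ dv) = ev p beta"
  by (simp add: beta_period flip: ev_frobn)

text \<open>A fixed point of the q_v-power map has an absolute value with the same property, hence 0
  or 1. So distinct elements of F_q(\<open>beta\<close>) are incongruent, and congruence inside this
  field is equality.\<close>

lemma absv_ev_beta: "absv (ev p beta) = (if ev p beta = 0 then 0 else 1)"
proof -
  let ?x = "absv (ev p beta)"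
  have "?x ^ (q ^ dv) = ?x" by (simp add: ev_beta_frob_dv flip: absv_power)
  moreover obtain m where m: "q ^ dv = Suc m" "m \<noteq> 0"
    using qv_ge_2 unfolding qv_eq by (cases "q ^ dv") auto
  ultimately have "?x = 0 \<or> ?x ^ m = 1" by auto
  thus ?thesis using m(2) power_eq_imp_eq_base[of ?x m 1] by auto
qed

lemma absv_beta_le_1: "absv beta \<le> 1"
  using absv_ev_beta[of "monom 1 1"] by (auto split: if_splits)

section \<open>Reduction of A modulo v, and the valuation of the brackets\<close>

lemma em_cg_ev_beta: "em p \<simeq> ev p beta"
proof (induction p)
  case (pCons a p)
  show ?case unfolding em_pCons ev_simps
    by (intro cg_add cg_mult cg_refl theta_cg_beta pCons.IH absv_theta_le_1) (simp add: absv_ev_beta)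
qed simp

lemma em_frob_dv: "em p ^ (q ^ dv) \<simeq> em p"
  using cg_frobn[OF em_cg_ev_beta, of p dv] em_cg_ev_beta[of p]
  by (metis ev_beta_frob_dv cg_sym cg_trans)

lemma beta_frobn_mod: "beta ^ (q ^ (i * dv + r)) = beta ^ (q ^ r)"
proof (induction i)
  case (Suc i)
  have "q ^ (Suc i * dv + r) = q ^ dv * q ^ (i * dv + r)" by (simp add: power_add)
  thus ?case using Suc by (simp add: power_mult beta_period)
qed simp

lemma em_bracket: "em (bracket i) = \<theta> ^ (q ^ i) - \<theta>"
  by (simp add: em_eq_ev bracket_def q_card)

lemma bracket_nz: "0 < i \<Longrightarrow> bracket i \<noteq> (0 :: 'a poly)"
proof
  assume "0 < i" "bracket i = (0 :: 'a poly)"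
  hence "coeff (monom 1 (q ^ i) :: 'a poly) 1 = 1"
    by (simp add: bracket_def q_card)
  moreover have "1 < q ^ i" using q_ge_2 \<open>0 < i\<close> by (intro one_less_power) auto
  ultimately show False using q_ge_2 \<open>0 < i\<close> by (simp split: if_splits)
qed

text \<open>The derivative of [i] is -1, so [i] is squarefree and v divides it at most once.\<close>

lemma absv_bracket_ge:
  assumes "0 < i"
  shows "1 / real qv \<le> absv (em (bracket i))"
proof -
  have "\<not> v ^ 2 dvd bracket i"
  proof
    assume "v ^ 2 dvd bracket i"
    then obtain r where r: "bracket i = v ^ 2 * r" ..
    have "v dvd pderiv (bracket i)"
      unfolding r by (simp add: pderiv_mult pderiv_power_Suc power2_eq_square)
    \<comment> \<open>Since q is the binomial coefficient (q choose 1), it vanishes in the field,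
      and the leading monomial of [i] has derivative 0.\<close>
    moreover have "(of_nat q :: 'a) = 0"
      using finite_field_binomial_eq_0[where 'a = 'a and k = 1] q_ge_2 by (simp add: q_card)
    hence "pderiv (bracket i) = (- 1 :: 'a poly)"
      using assms by (simp add: bracket_def pderiv_diff pderiv_monom q_card one_pCons monom_0 power_0_left)
    ultimately show False using irred by (simp add: irreducible_def)
  qed
  moreover have "v ^ 2 dvd bracket i" if "2 \<le> ord_poly v (bracket i)"
    using le_imp_power_dvd[OF that] ord_poly_props(1)[OF bracket_nz[OF assms]] by (rule dvd_trans)
  ultimately have "ord_poly v (bracket i) \<le> 1" by linarith
  hence "real qv powr (- 1) \<le> real qv powr (- real (ord_poly v (bracket i)))"
    by (intro powr_mono) (use qv_ge_2 in auto)
  thus ?thesis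
    using absv_em[OF bracket_nz[OF assms]] qv_ge_2 by (simp add: powr_minus_divide)
qed

text \<open>Modulo the maximal ideal [i] becomes \<open>beta\<close>^(q^i) - \<open>beta\<close>.
  This lies in F_q(\<open>beta\<close>), so it is small only if it vanishes, and Frobenius has exact
  order \<open>dv\<close> on \<open>beta\<close>.\<close>

lemma absv_bracket:
  assumes "0 < i"
  shows "absv (em (bracket i)) = (if dv dvd i then 1 / real qv else 1)"
proof -
  have cg: "em (bracket i) \<simeq> beta ^ (q ^ i) - beta"
    using em_cg_ev_beta[of "bracket i"] by (simp add: bracket_def q_card)
  have red: "beta ^ (q ^ i) = beta ^ (q ^ (i mod dv))"
    using beta_frobn_mod[of "i div dv" "i mod dv"] by simp
  show ?thesis
  proof (cases "dv dvd i")
    case True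
    hence "absv (em (bracket i)) < 1" using cg red by (simp add: cg_0_iff)
    thus ?thesis using absv_em_less_1 absv_bracket_ge[OF assms] True by force
  next
    case False
    hence "beta ^ (q ^ i) \<noteq> beta"
      using beta_frobn_period_ge[of "i mod dv"] red mod_less_divisor[OF dv_pos, of i]
    by (auto simp: dvd_eq_mod_eq_0)
    hence "absv (beta ^ (q ^ i) - beta) = 1"
      using absv_ev_beta[of "bracket i"] by (simp add: bracket_def q_card)
    thus ?thesis using absv_eq_1_cg[OF cg] False by simp
  qed
qed

end

section \<open>Polynomials acting through an operator\<close>

text \<open>Vectors are functions on the naturals, so that one definition covers both the action of
  t on the coordinates of a point and the shift acting on sequences.\<close>

definition pact :: "((nat \<Rightarrow> 'b) \<Rightarrow> nat \<Rightarrow> 'b) \<Rightarrow> 'b::comm_ring_1 poly \<Rightarrow> (nat \<Rightarrow> 'b) \<Rightarrow> nat \<Rightarrow> 'b" where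
  "pact T f y j = (\<Sum>k\<le>degree f. coeff f k * (T ^^ k) y j)"

lemma pact_degree_le:
  "degree f \<le> n \<Longrightarrow> pact T f y j = (\<Sum>k\<le>n. coeff f k * (T ^^ k) y j)"
  unfolding pact_def by (rule sum.mono_neutral_left) (auto simp: coeff_eq_0)

lemma pact_0 [simp]: "pact T 0 y j = 0"
  by (simp add: pact_def)

lemma pact_pCons [simp]: "pact T (pCons c f) y j = c * y j + pact T f (T y) j"
proof -
  have "pact T (pCons c f) y j = (\<Sum>k\<le>Suc (degree f). coeff (pCons c f) k * (T ^^ k) y j)"
    by (rule pact_degree_le) (rule degree_pCons_le)
  also have "\<dots> = c * y j + (\<Sum>k\<le>degree f. coeff f k * (T ^^ Suc k) y j)"
    by (subst sum.atMost_Suc_shift) simp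
  finally show ?thesis by (simp only: pact_def funpow_Suc_right comp_def)
qed

lemma pact_1 [simp]: "pact T 1 y j = y j"
  by (simp add: one_pCons)

lemma pact_add: "pact T (f + g) y j = pact T f y j + pact T g y j"
  using pact_degree_le[of f "max (degree f) (degree g)" T y j]
    pact_degree_le[of g "max (degree f) (degree g)" T y j]
    pact_degree_le[of "f + g" "max (degree f) (degree g)" T y j]
  by (simp add: degree_add_le distrib_right sum.distrib)

lemma pact_smult: "pact T (smult c f) y j = c * pact T f y j"
  using pact_degree_le[of "smult c f" "degree f" T y j]
  by (simp add: degree_smult_le pact_def sum_distrib_left mult.assoc)

lemma pact_diff: "pact T (f - g) y j = pact T f y j - pact T g y j"
  using pact_add[of T f "- g" y j] pact_smult[of T "- 1" g y j] by simp

lemma pact_linear: "pact T [:- c, 1:] y j = T y j - c * y j"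
  by simp

text \<open>\<open>C\<close> collects the scalars that commute with \<open>T\<close>: all of them
  for the shift, but only the image of F_q for the action of t, which involves the
  Frobenius.\<close>

locale operator_action =
  fixes T :: "(nat \<Rightarrow> 'b::comm_ring_1) \<Rightarrow> nat \<Rightarrow> 'b" and C :: "'b set"
  assumes T_add: "T (\<lambda>j. y j + z j) = (\<lambda>j. T y j + T z j)"
    and T_scale: "c \<in> C \<Longrightarrow> T (\<lambda>j. c * y j) = (\<lambda>j. c * T y j)"
begin

lemma T_0: "T (\<lambda>j. 0) = (\<lambda>j. 0)"
proof
  fix j
  show "T (\<lambda>j. 0) j = 0" using fun_cong[OF T_add[of "\<lambda>j. 0" "\<lambda>j. 0"], of j] by simp
qed

lemma pact_commute:
  "(\<And>k. coeff f k \<in> C) \<Longrightarrow> T (pact T f y) = pact T f (T y)"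
proof (induction f arbitrary: y)
  case 0
  have "pact T 0 y = (\<lambda>j. 0)" for y by (rule ext) simp
  thus ?case by (simp add: T_0)
next
  case (pCons c f)
  have "coeff f k \<in> C" for k using pCons.prems[of "Suc k"] by simp
  hence IH: "T (pact T f z) = pact T f (T z)" for z by (rule pCons.IH)
  have "pact T (pCons c f) y = (\<lambda>j. c * y j + pact T f (T y) j)" by (rule ext) simp
  hence "T (pact T (pCons c f) y) = (\<lambda>j. c * T y j + pact T f (T (T y)) j)"
    using pCons.prems[of 0] by (simp add: T_add T_scale IH)
  also have "\<dots> = pact T (pCons c f) (T y)" by (rule ext) simp
  finally show ?case .
qed

text \<open>Only the coefficients of \<open>g\<close> have to be moved past \<open>T\<close>, so
  only they are required to lie in \<open>C\<close>.\<close>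

lemma pact_mult:
  assumes "\<And>k. coeff g k \<in> C"
  shows "pact T (f * g) y j = pact T f (pact T g y) j"
proof (induction f arbitrary: y)
  case (pCons c f)
  have "pact T (pCons c f * g) y j = c * pact T g y j + pact T (f * g) (T y) j"
    by (simp add: mult_pCons_left pact_add pact_smult)
  thus ?case by (simp add: pCons.IH pact_commute[OF assms])
qed simp

end

definition shift_seq :: "(nat \<Rightarrow> 'b) \<Rightarrow> nat \<Rightarrow> 'b" where "shift_seq u k = u (Suc k)"

lemma shift_seq_funpow: "(shift_seq ^^ n) u k = u (k + n)"
  by (induction n arbitrary: k) (simp_all add: shift_seq_def)

interpretation shift_seq: operator_action shift_seq UNIV
  by unfold_locales (auto simp: shift_seq_def)

section \<open>Integral polynomials acting by the shift, and Frobenius sequences\<close>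

context place begin

definition integral_poly :: "'c poly \<Rightarrow> bool" where
  "integral_poly f \<longleftrightarrow> (\<forall>k. absv (coeff f k) \<le> 1)"

lemma integral_poly_1: "integral_poly 1"
  by (simp add: integral_poly_def)

lemma integral_poly_linear: "absv c \<le> 1 \<Longrightarrow> integral_poly [:- c, 1:]"
  by (auto simp: integral_poly_def coeff_pCons split: nat.split)

lemma integral_poly_mult: "integral_poly f \<Longrightarrow> integral_poly g \<Longrightarrow> integral_poly (f * g)"
  unfolding integral_poly_def coeff_mult
  by (intro allI absv_sum_le) (auto simp: absv_mult mult_le_one)

lemma integral_poly_power: "integral_poly f \<Longrightarrow> integral_poly (f ^ n)"
  by (induction n) (simp_all add: integral_poly_1 integral_poly_mult)

lemma integral_poly_prod: "(\<And>i. i \<in> I \<Longrightarrow> integral_poly (f i)) \<Longrightarrow> integral_poly (\<Prod>i\<in>I. f i)"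
  by (induction I rule: infinite_finite_induct) (simp_all add: integral_poly_1 integral_poly_mult)

lemma pact_shift_cg:
  assumes "integral_poly f" "\<And>k. u k \<simeq> u' k"
  shows "pact shift_seq f u k \<simeq> pact shift_seq f u' k"
  unfolding pact_def shift_seq_funpow
  by (rule cg_sum, rule cg_mult_left) (use assms in \<open>auto simp: integral_poly_def\<close>)

sublocale frob: inj_idom_hom "\<lambda>x::'c. x ^ q"
  using q_ge_2 by unfold_locales (auto simp: frob_add power_mult_distrib power_0_left)

lemma pact_shift_frob:
  "pact shift_seq (f :: 'c poly) u k ^ q = pact shift_seq (map_poly (\<lambda>x. x ^ q) f) (\<lambda>k. u k ^ q) k"
  using frobn_sum[of "\<lambda>n. coeff f n * u (k + n)" "{..degree f}" 1]
  by (simp add: pact_def shift_seq_funpow power_mult_distrib)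

text \<open>
  A sequence on which \<open>(t - \<beta>)^n\<close> acts as the Frobenius modulo the maximal ideal: iterating, the
  conjugate factors of \<open>v\<close> pile up and \<open>v^n\<close> acts as the \<open>q\<^sub>v\<close>-power map.
\<close>

lemma frobenius_sequence_iterate:
  assumes "\<And>k. u k ^ q \<simeq> pact shift_seq ([:- beta, 1:] ^ n) u k"
  shows "u k ^ (q ^ j) \<simeq> pact shift_seq (\<Prod>i<j. [:- (beta ^ (q ^ i)), 1:] ^ n) u k"
proof (induction j arbitrary: k)
  case (Suc j)
  define G where "G = (\<Prod>i<j. [:- (beta ^ (q ^ i)), 1:] ^ n)"
  define G' where "G' = (\<Prod>i<j. [:- (beta ^ (q ^ Suc i)), 1:] ^ n)"
  interpret mp: map_poly_comm_ring_hom "\<lambda>x::'c. x ^ q" ..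
  have G': "map_poly (\<lambda>x. x ^ q) G = G'"
  proof -
    have "map_poly (\<lambda>x. x ^ q) [:- (beta ^ (q ^ i)), 1:] = [:- (beta ^ (q ^ Suc i)), 1:]" for i
      using frobn_minus[of "beta ^ (q ^ i)" 1]
      by (simp add: frob.map_poly_pCons_hom mult.commute flip: power_mult)
    thus ?thesis by (simp add: G_def G'_def mp.hom_prod mp.hom_power)
  qed
  have int: "integral_poly G'"
    unfolding G'_def
    by (intro integral_poly_prod integral_poly_power integral_poly_linear)
      (simp add: absv_power power_le_one absv_beta_le_1)
  have "u k ^ (q ^ Suc j) = (u k ^ (q ^ j)) ^ (q ^ 1)" by (simp add: mult.commute flip: power_mult)
  also have "\<dots> \<simeq> pact shift_seq G u k ^ (q ^ 1)"
    unfolding G_def by (rule cg_frobn) (rule Suc.IH)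
  also have "pact shift_seq G u k ^ (q ^ 1) = pact shift_seq G' (\<lambda>k. u k ^ q) k"
    by (simp add: pact_shift_frob G')
  also have "\<dots> \<simeq> pact shift_seq G' (pact shift_seq ([:- beta, 1:] ^ n) u) k"
    by (rule pact_shift_cg[OF int]) (rule assms)
  also have "\<dots> = pact shift_seq (G' * [:- beta, 1:] ^ n) u k"
    by (simp add: shift_seq.pact_mult)
  also have "G' * [:- beta, 1:] ^ n = (\<Prod>i<Suc j. [:- (beta ^ (q ^ i)), 1:] ^ n)"
    unfolding prod.lessThan_Suc_shift G'_def by (simp add: mult.commute)
  finally show ?case .
qed simp

text \<open>After \<open>dv\<close> iterations the accumulated conjugate factors are exactly those
  of v^n, by \<open>v_factorization\<close>.\<close>

lemma frobenius_sequence_v: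
  assumes "\<And>k. u k ^ q \<simeq> pact shift_seq ([:- beta, 1:] ^ n) u k"
  shows "pact shift_seq (map_poly kappa (v ^ n)) u k \<simeq> u k ^ (q ^ dv)"
proof -
  interpret mp: map_poly_comm_ring_hom kappa ..
  have "map_poly kappa (v ^ n) = (\<Prod>i<dv. [:- (beta ^ (q ^ i)), 1:] ^ n)"
    by (simp add: mp.hom_power v_factorization prod_power_distrib)
  thus ?thesis using frobenius_sequence_iterate[OF assms, of k dv] by (simp add: cg_sym)
qed

end

section \<open>Blocks\<close>

text \<open>Tells whether coordinates i and i+1 belong to the same block, that is, whether row i of
  \<open>tm_N\<close> contains a 1; it is false beyond the last block. The recursion peels off the
  first block, as \<open>diag_block_mat\<close> does.\<close>

primrec has_next :: "nat list \<Rightarrow> nat \<Rightarrow> bool" where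
  "has_next [] i \<longleftrightarrow> False"
| "has_next (x # t) i \<longleftrightarrow> (if i < x + sum_list t then Suc i < x + sum_list t
     else has_next t (i - (x + sum_list t)))"

lemma blk_size_0: "blk_size t 0 = sum_list t"
  by (simp add: blk_size_def)

lemma blk_size_Cons_0 [simp]: "blk_size (x # t) 0 = x + sum_list t"
  and blk_size_Cons_Suc [simp]: "blk_size (x # t) (Suc l) = blk_size t l"
  by (simp_all add: blk_size_def)

lemma blk_start_0 [simp]: "blk_start t 0 = 0"
  and blk_start_Suc: "blk_start t (Suc l) = blk_start t l + blk_size t l"
  by (simp_all add: blk_start_def)

lemma blk_start_Cons_Suc [simp]: "blk_start (x # t) (Suc l) = x + sum_list t + blk_start t l"
  unfolding blk_start_def sum.lessThan_Suc_shift by simp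

lemma tm_dim_eq: "tm_dim t = blk_start t (length t)"
  by (simp add: tm_dim_def blk_start_def)

lemma tm_dim_simps [simp]: "tm_dim [] = 0" "tm_dim (x # t) = x + sum_list t + tm_dim t"
  by (simp_all add: tm_dim_eq)

lemma blk_start_mono: "l \<le> l' \<Longrightarrow> blk_start t l \<le> blk_start t l'"
  unfolding blk_start_def by (rule sum_mono2) auto

lemma blk_start_add_size: "l < l' \<Longrightarrow> blk_start t l + blk_size t l \<le> blk_start t l'"
  using blk_start_mono[of "Suc l" l' t] by (simp add: blk_start_Suc)

lemma blk_index_less: "l < length t \<Longrightarrow> k < blk_size t l \<Longrightarrow> blk_start t l + k < tm_dim t"
  using blk_start_add_size[of l "length t" t] by (simp add: tm_dim_eq)

lemma blk_index_inject:
  assumes "blk_start t l + k = blk_start t l' + k'" "k < blk_size t l" "k' < blk_size t l'"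
  shows "l = l' \<and> k = k'"
  using assms blk_start_add_size[of l l' t] blk_start_add_size[of l' l t]
  by (cases l l' rule: linorder_cases) auto

lemma blk_index_exists:
  "i < tm_dim t \<Longrightarrow> \<exists>l<length t. \<exists>k<blk_size t l. i = blk_start t l + k"
proof (induction t arbitrary: i)
  case (Cons x t)
  show ?case
  proof (cases "i < x + sum_list t")
    case True
    thus ?thesis by (intro exI[of _ 0]) auto
  next
    case False
    hence "i - (x + sum_list t) < tm_dim t" using Cons.prems by auto
    then obtain l k where "l < length t" "k < blk_size t l" "i - (x + sum_list t) = blk_start t l + k"
      using Cons.IH[of "i - (x + sum_list t)"] by auto
    thus ?thesis using False by (intro exI[of _ "Suc l"]) auto
  qed
qed simp

lemma has_next_blk:
  "l < length t \<Longrightarrow> k < blk_size t l \<Longrightarrow> has_next t (blk_start t l + k) \<longleftrightarrow> Suc k < blk_size t l"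
proof (induction t arbitrary: l)
  case (Cons x t)
  thus ?case by (cases l) auto
qed simp

lemma has_next_less: "has_next t i \<Longrightarrow> Suc i < tm_dim t"
proof (induction t arbitrary: i)
  case (Cons x t)
  show ?case
  proof (cases "i < x + sum_list t")
    case True
    thus ?thesis using Cons.prems by auto
  next
    case False
    hence "Suc (i - (x + sum_list t)) < tm_dim t" using Cons by simp
    thus ?thesis using False by simp
  qed
qed simp

lemma blk_size_le: "blk_size t l \<le> sum_list t"
proof -
  have "sum_list t = sum_list (take l t) + sum_list (drop l t)"
    by (metis append_take_drop_id sum_list_append)
  thus ?thesis by (simp add: blk_size_def)
qed

lemma blk_size_pos:
  assumes "\<forall>n\<in>set t. 1 \<le> n" "l < length t"
  shows "0 < blk_size t l"
proof -
  have "drop l t = t ! l # drop (Suc l) t" using assms(2) by (simp add: Cons_nth_drop_Suc)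
  moreover have "1 \<le> t ! l" using assms by simp
  ultimately show ?thesis by (simp add: blk_size_def)
qed

lemma tm_N_Cons:
  "tm_N (x # t) = four_block_mat
     (mat (x + sum_list t) (x + sum_list t) (\<lambda>(i, j). if j = i + 1 then 1 else 0))
     (0\<^sub>m (x + sum_list t) (dim_col (tm_N t :: 'c::field mat)))
     (0\<^sub>m (dim_row (tm_N t :: 'c mat)) (x + sum_list t)) (tm_N t :: 'c mat)"
proof -
  have "[0..<length (x # t)] = 0 # map Suc [0..<length t]"
    by (simp add: map_Suc_upt upt_conv_Cons del: upt_Suc)
  thus ?thesis unfolding tm_N_def by (simp add: Let_def comp_def del: upt_Suc)
qed

lemma tm_N_carrier: "tm_N t \<in> carrier_mat (tm_dim t) (tm_dim t)"
proof (induction t)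
  case (Cons x t)
  thus ?case unfolding tm_N_Cons by auto
qed (auto simp: tm_N_def)

lemma tm_N_index:
  "i < tm_dim t \<Longrightarrow> j < tm_dim t \<Longrightarrow>
     tm_N t $$ (i, j) = (if has_next t i \<and> j = Suc i then 1 else 0 :: 'c::field)"
proof (induction t arbitrary: i j)
  case (Cons x t)
  let ?s = "x + sum_list t"
  have dims: "dim_row (tm_N t :: 'c mat) = tm_dim t" "dim_col (tm_N t :: 'c mat) = tm_dim t"
    using tm_N_carrier[of t, where 'a = 'c] by auto
  have *: "i - ?s < tm_dim t" if "\<not> i < ?s" using Cons.prems that by auto
  have **: "j - ?s < tm_dim t" if "\<not> j < ?s" using Cons.prems that by auto
  show ?case
    unfolding tm_N_Cons using Cons.prems * ** Cons.IH[of "i - ?s" "j - ?s"]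
    by (subst index_mat_four_block) (auto simp: dims)
qed simp

lemma blk_end_eq:
  assumes "0 < blk_size t l"
  shows "blk_start t (l + 1) - 1 = blk_start t l + (blk_size t l - 1)"
  using assms by (simp add: blk_start_Suc)

section \<open>Elements of C_v coming from A\<close>

context place begin

lemma range_em_add: "x \<in> range em \<Longrightarrow> y \<in> range em \<Longrightarrow> x + y \<in> range em"
  by (auto simp flip: em.hom_add)
lemma range_em_mult: "x \<in> range em \<Longrightarrow> y \<in> range em \<Longrightarrow> x * y \<in> range em"
  by (auto simp flip: em.hom_mult)
lemma range_em_0 [simp]: "0 \<in> range em" by (rule range_eqI[of _ _ 0]) simp
lemma range_em_1 [simp]: "1 \<in> range em" by (rule range_eqI[of _ _ 1]) simp
lemma range_em_minus: "x \<in> range em \<Longrightarrow> - x \<in> range em"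
  by (auto simp flip: em.hom_uminus)
lemma range_em_kappa [simp]: "kappa c \<in> range em" by (simp add: kappa_def)
lemma range_em_theta [simp]: "\<theta> \<in> range em" by (simp add: theta_def)
lemma range_em_power: "x \<in> range em \<Longrightarrow> x ^ n \<in> range em"
  by (induction n) (simp_all add: range_em_mult)
lemma range_em_sum: "(\<And>i. i \<in> I \<Longrightarrow> f i \<in> range em) \<Longrightarrow> (\<Sum>i\<in>I. f i) \<in> range em"
  by (induction I rule: infinite_finite_induct) (simp_all add: range_em_add)
lemma range_em_prod: "(\<And>i. i \<in> I \<Longrightarrow> f i \<in> range em) \<Longrightarrow> (\<Prod>i\<in>I. f i) \<in> range em"
  by (induction I rule: infinite_finite_induct) (simp_all add: range_em_mult)

lemma range_em_absv: "x \<in> range em \<Longrightarrow> absv x \<le> 1"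
  using absv_em_le_1 by auto

end

text \<open>The entries of \<open>w\<close> are taken in the image of A, which is where the
  arguments occurring in the zeta value lie; this keeps the coordinates of all points in A and gives
  access to \<open>absv_em_less_1\<close>.\<close>

locale tmodule = place v \<iota> q
  for v :: "'a::{finite,field} poly"
    and \<iota> :: "'a poly fract \<Rightarrow> 'c::{alg_closed_field,complete_space}"
    and q :: nat +
  fixes t :: "nat list" and w :: "'c list"
  assumes t_pos: "\<forall>n\<in>set t. 1 \<le> n" and t_ne: "t \<noteq> []"
    and w_length: "length w = length t" and w_em: "set w \<subseteq> range em"
begin

abbreviation d :: nat where "d \<equiv> tm_dim t"
abbreviation st :: "nat \<Rightarrow> nat" where "st \<equiv> blk_start t"
abbreviation sz :: "nat \<Rightarrow> nat" where "sz \<equiv> blk_size t"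
abbreviation r :: nat where "r \<equiv> length t"
abbreviation EE :: "nat \<Rightarrow> nat \<Rightarrow> 'c" where "EE i j \<equiv> tm_E t w $$ (i, j)"

lemma sz_pos: "l < r \<Longrightarrow> 0 < sz l"
  by (rule blk_size_pos[OF t_pos])

lemma EE_index:
  "i < d \<Longrightarrow> j < d \<Longrightarrow> EE i j = (\<Sum>l<r. \<Sum>m\<in>{l..<r}.
     if i = st (l + 1) - 1 \<and> j = st m then (- 1) ^ (m - l) * (\<Prod>e\<in>{l..<m}. w ! e) else 0)"
  by (simp add: tm_E_def)

lemma EE_nonzero:
  assumes "EE i j \<noteq> 0" "i < d" "j < d"
  shows "\<exists>l m. l \<le> m \<and> m < r \<and> i = st l + (sz l - 1) \<and> j = st m"
proof (rule ccontr)
  assume no: "\<not> ?thesis"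
  have "EE i j = 0"
    unfolding EE_index[OF assms(2,3)]
  proof (intro sum.neutral ballI)
    fix l m assume lm: "l \<in> {..<r}" "m \<in> {l..<r}"
    thus "(if i = st (l + 1) - 1 \<and> j = st m then (- 1) ^ (m - l) * (\<Prod>e\<in>{l..<m}. w ! e) else 0) = 0"
      using no blk_end_eq[OF sz_pos, of l] by auto
  qed
  thus False using assms(1) by simp
qed

lemma EE_diag:
  assumes "l < r"
  shows "EE (st l + (sz l - 1)) (st l) = 1"
proof -
  have d: "st l + (sz l - 1) < d" "st l < d"
    using blk_index_less[OF assms, of "sz l - 1"] blk_index_less[OF assms, of 0] sz_pos[OF assms] by auto
  have "EE (st l + (sz l - 1)) (st l) = (\<Sum>l'<r. \<Sum>m\<in>{l'..<r}. if l' = l \<and> m = l then 1 else 0)"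
    unfolding EE_index[OF d]
  proof (intro sum.cong refl)
    fix l' m assume lm: "l' \<in> {..<r}" "m \<in> {l'..<r}"
    \<comment> \<open>Blocks of positive size have distinct ends and distinct starts, so a single
      pair of the double sum survives.\<close>
    have "st l + (sz l - 1) = st (l' + 1) - 1 \<longleftrightarrow> l' = l"
      using blk_end_eq[OF sz_pos, of l'] lm sz_pos[OF assms] sz_pos[of l']
        blk_index_inject[of t l "sz l - 1" l' "sz l' - 1"] by auto
    moreover have "st l = st m \<longleftrightarrow> m = l"
      using blk_index_inject[of t l 0 m 0] sz_pos[OF assms] sz_pos[of m] lm by auto
    ultimately show "(if st l + (sz l - 1) = st (l' + 1) - 1 \<and> st l = st m
        then (- 1) ^ (m - l') * (\<Prod>e\<in>{l'..<m}. w ! e) else 0) = (if l' = l \<and> m = l then 1 else 0)"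
      by auto
  qed
  also have "\<dots> = (\<Sum>l'<r. if l' = l then 1 else 0)"
    by (rule sum.cong) (use assms in \<open>auto simp: sum.delta\<close>)
  also have "\<dots> = 1" using assms by simp
  finally show ?thesis .
qed

lemma w_nth_em: "e < r \<Longrightarrow> w ! e \<in> range em"
  using w_em w_length by (metis nth_mem subsetD)

lemma EE_em: "i < d \<Longrightarrow> j < d \<Longrightarrow> EE i j \<in> range em"
  unfolding EE_index
  by (intro range_em_sum)
    (auto intro!: range_em_mult range_em_prod range_em_power range_em_minus w_nth_em)

text \<open>The map \<open>\<rho>\<^sub>t\<close> on coordinates.\<close>

definition S :: "(nat \<Rightarrow> 'c) \<Rightarrow> nat \<Rightarrow> 'c" where
  "S y i = (if i < d then \<theta> * y i + (if has_next t i then y (Suc i) else 0)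
     + (\<Sum>k<d. EE i k * y k ^ q) else 0)"

sublocale S: operator_action S "range kappa"
proof
  fix y z :: "nat \<Rightarrow> 'c"
  show "S (\<lambda>j. y j + z j) = (\<lambda>j. S y j + S z j)"
    by (rule ext) (simp add: S_def frob_add algebra_simps sum.distrib)
  fix c assume "c \<in> range kappa"
  hence "c ^ q = c" using kappa_frobn[where n = 1] by auto
  thus "S (\<lambda>j. c * y j) = (\<lambda>j. c * S y j)"
    by (intro ext) (simp add: S_def power_mult_distrib algebra_simps sum_distrib_left)
qed

definition act :: "'a poly \<Rightarrow> (nat \<Rightarrow> 'c) \<Rightarrow> nat \<Rightarrow> 'c" where
  "act a = pact S (map_poly kappa a)"

lemma act_simps:
  "act 0 y j = 0" "act (pCons c a) y j = kappa c * y j + act a (S y) j"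
  "act 1 y j = y j" "act (a - b) y j = act a y j - act b y j"
  "act (a * b) y = act a (act b y)" "S (act a y) = act a (S y)"
proof -
  interpret mp: map_poly_comm_ring_hom kappa ..
  show "act 0 y j = 0" "act (pCons c a) y j = kappa c * y j + act a (S y) j"
    "act 1 y j = y j" "act (a - b) y j = act a y j - act b y j"
    by (simp_all add: act_def kappa.map_poly_pCons_hom mp.hom_minus pact_diff)
  show "act (a * b) y = act a (act b y)"
    by (rule ext) (simp add: act_def mp.hom_mult S.pact_mult)
  show "S (act a y) = act a (S y)" by (simp add: act_def S.pact_commute)
qed

text \<open>E has nonzero rows only at block ends. Inside a block t - \<theta> therefore just reads
  off the next coordinate.\<close>

lemma S_block_next:
  assumes "l < r" "Suc k < sz l"
  shows "S y (st l + k) = \<theta> * y (st l + k) + y (st l + Suc k)"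
proof -
  have id: "st l + k < d" by (rule blk_index_less) (use assms in auto)
  have "EE (st l + k) j = 0" if "j < d" for j
  proof (rule ccontr)
    assume "EE (st l + k) j \<noteq> 0"
    from EE_nonzero[OF this id that]
    obtain l' m' where "l' \<le> m'" "m' < r" "st l + k = st l' + (sz l' - 1)" by blast
    hence "k = sz l - 1"
      using blk_index_inject[of t l k l' "sz l' - 1"] assms sz_pos[of l'] by auto
    thus False using assms by simp
  qed
  thus ?thesis using assms by (simp add: S_def id has_next_blk)
qed

lemma S_block_end:
  assumes "l < r"
  shows "S y (st l + (sz l - 1)) =
    \<theta> * y (st l + (sz l - 1)) + (\<Sum>k<d. EE (st l + (sz l - 1)) k * y k ^ q)"
  using assms sz_pos[OF assms] has_next_blk[of l t "sz l - 1"] blk_index_less[of l t "sz l - 1"]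
  by (simp add: S_def)


section \<open>Annihilation modulo \<open>v\<close>\<close>

text \<open>E couples a block only to itself and to later blocks, so these conditions cut out a set
  stable under t, and blocks can be annihilated from the last one backwards. Membership in the image
  of A is included because the q_v-power map is the identity modulo v only there.\<close>

definition vanish_from :: "nat \<Rightarrow> (nat \<Rightarrow> 'c) \<Rightarrow> bool" where
  "vanish_from l y \<longleftrightarrow> (\<forall>j<d. y j \<in> range em) \<and>
     (\<forall>m k. l \<le> m \<longrightarrow> m < r \<longrightarrow> k < sz m \<longrightarrow> absv (y (st m + k)) < 1)"

lemma absv_mult_less_1: "absv x \<le> 1 \<Longrightarrow> absv y < 1 \<Longrightarrow> absv (x * y :: 'c) < 1"
  using mult_left_le_one_le[of "absv y" "absv x"] by (simp add: absv_mult)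

text \<open>The index set \<open>K\<close> is free so that the diagonal entry of E can be split off
  in \<open>S_block_end_cg\<close>.\<close>

lemma EE_sum_less:
  assumes "m < r" "K \<subseteq> {..<d}"
    and "\<And>m'. m \<le> m' \<Longrightarrow> m' < r \<Longrightarrow> st m' \<in> K \<Longrightarrow> absv (y (st m')) < 1"
  shows "absv (\<Sum>k\<in>K. EE (st m + (sz m - 1)) k * y k ^ q) < 1"
proof (rule absv_sum_less)
  fix k assume k: "k \<in> K"
  let ?i = "st m + (sz m - 1)"
  have id: "?i < d" using blk_index_less[OF assms(1), of "sz m - 1"] sz_pos[OF assms(1)] by simp
  have kd: "k < d" using k assms(2) by auto
  show "absv (EE ?i k * y k ^ q) < 1"
  proof (cases "EE ?i k = 0")
    case False
    from EE_nonzero[OF this id kd]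
    obtain l m' where m': "l \<le> m'" "m' < r" "?i = st l + (sz l - 1)" "k = st m'" by blast
    hence "l = m"
      using blk_index_inject[of t m "sz m - 1" l "sz l - 1"] sz_pos[of m] sz_pos[of l] assms(1) by auto
    hence "absv (y k) < 1" using assms(3)[of m'] m' k by simp
    hence "absv (y k ^ q) < 1" using q_ge_2 by (simp add: absv_power power_less_one_iff)
    thus ?thesis using EE_em[OF id kd] by (intro absv_mult_less_1 range_em_absv)
  qed simp
qed simp

lemma S_em: "(\<And>j. j < d \<Longrightarrow> y j \<in> range em) \<Longrightarrow> i < d \<Longrightarrow> S y i \<in> range em"
  using has_next_less[of t i]
  by (auto simp: S_def intro!: range_em_add range_em_mult range_em_sum range_em_power EE_em)

lemma vanish_from_S:
  assumes "vanish_from l y"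
  shows "vanish_from l (S y)"
proof -
  have "absv (S y (st m + k)) < 1" if m: "l \<le> m" "m < r" "k < sz m" for m k
  proof -
    have y: "absv (y (st m' + k)) < 1" if "l \<le> m'" "m' < r" "k < sz m'" for m' k
      using assms that by (simp add: vanish_from_def)
    have less: "absv (\<theta> * y (st m + k)) < 1"
      by (intro absv_mult_less_1 absv_theta_le_1 y m)
    show ?thesis
    proof (cases "Suc k < sz m")
      case True
      have "S y (st m + k) = \<theta> * y (st m + k) + y (st m + Suc k)"
        by (rule S_block_next[OF m(2) True])
      thus ?thesis using absv_ultrametric[of "\<theta> * y (st m + k)" "y (st m + Suc k)"] less
          y[OF m(1,2) True] by auto
    next
      case False
      hence k: "k = sz m - 1" using m(3) by simp
      hence "S y (st m + k) = \<theta> * y (st m + k) + (\<Sum>j<d. EE (st m + (sz m - 1)) j * y j ^ q)"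
        using S_block_end[OF m(2)] by simp
      moreover have "absv (\<Sum>j<d. EE (st m + (sz m - 1)) j * y j ^ q) < 1"
        by (rule EE_sum_less) (use m y[of _ 0] sz_pos in auto)
      ultimately show ?thesis
        using absv_ultrametric[of "\<theta> * y (st m + k)"
            "\<Sum>j<d. EE (st m + (sz m - 1)) j * y j ^ q"] less by simp
    qed
  qed
  moreover have "S y j \<in> range em" if "j < d" for j
    using assms that by (intro S_em) (auto simp: vanish_from_def)
  ultimately show ?thesis by (simp add: vanish_from_def)
qed

lemma vanish_from_act: "vanish_from l y \<Longrightarrow> vanish_from l (act a y)"
proof (induction a arbitrary: y)
  case 0
  thus ?case by (simp add: vanish_from_def act_simps)
next
  case (pCons c a)
  have 1: "vanish_from l (act a (S y))" by (rule pCons.IH) (rule vanish_from_S[OF pCons.prems])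
  show ?case unfolding vanish_from_def act_simps
  proof (intro conjI allI impI)
    fix j assume "j < d"
    thus "kappa c * y j + act a (S y) j \<in> range em"
      using 1 pCons.prems by (intro range_em_add range_em_mult) (auto simp: vanish_from_def)
  next
    fix m k assume m: "l \<le> m" "m < r" "k < sz m"
    have "absv (kappa c * y (st m + k)) < 1"
      using m pCons.prems by (intro absv_mult_less_1 absv_kappa_le_1) (auto simp: vanish_from_def)
    moreover have "absv (act a (S y) (st m + k)) < 1" using 1 m by (simp add: vanish_from_def)
    ultimately show "absv (kappa c * y (st m + k) + act a (S y) (st m + k)) < 1"
      using absv_ultrametric[of "kappa c * y (st m + k)" "act a (S y) (st m + k)"] by simp
  qed
qed

lemma vanish_from_funpow: "vanish_from l y \<Longrightarrow> vanish_from l ((S ^^ n) y)"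
  by (induction n) (simp_all add: vanish_from_S)

text \<open>When the later blocks vanish modulo v, only the diagonal entry 1 of E survives: at the
  end of the block t - \<theta> yields the Frobenius of the first coordinate.\<close>

lemma S_block_end_cg:
  assumes "vanish_from (Suc l) y" "l < r"
  shows "S y (st l + (sz l - 1)) \<simeq> \<theta> * y (st l + (sz l - 1)) + y (st l) ^ q"
proof -
  have st: "st l < d" using blk_index_less[OF assms(2), of 0] sz_pos[OF assms(2)] by simp
  have "(\<Sum>k<d. EE (st l + (sz l - 1)) k * y k ^ q) =
      y (st l) ^ q + (\<Sum>k\<in>{..<d} - {st l}. EE (st l + (sz l - 1)) k * y k ^ q)"
    using st by (subst sum.remove[of _ "st l"]) (simp_all add: EE_diag[OF assms(2), unfolded One_nat_def])
  also have "\<dots> \<simeq> y (st l) ^ q + 0"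
  proof (rule cg_add[OF cg_refl], unfold cg_0_iff, rule EE_sum_less[OF assms(2)])
    fix m' assume "l \<le> m'" "m' < r" "st m' \<in> {..<d} - {st l}"
    moreover from this have "Suc l \<le> m'" by (cases "m' = l") auto
    ultimately show "absv (y (st m')) < 1"
      using assms(1) sz_pos[of m'] unfolding vanish_from_def by (metis add.right_neutral)
  qed auto
  finally show ?thesis unfolding S_block_end[OF assms(2)] by (intro cg_add) simp_all
qed

text \<open>On the sequence of first coordinates of t^k y, the shift is the action of t. By
  \<open>S_block_next\<close> each factor t - \<theta> climbs one coordinate, and \<theta> may be
  replaced by \<open>beta\<close> up to congruence.\<close>

lemma block_sequence_pact:
  assumes "vanish_from (Suc l) y" "l < r" "m < sz l"
  shows "pact shift_seq ([:- beta, 1:] ^ m) (\<lambda>k. (S ^^ k) y (st l)) k \<simeq> (S ^^ k) y (st l + m)"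
  using assms(3)
proof (induction m arbitrary: k)
  case (Suc m)
  let ?p = "pact shift_seq ([:- beta, 1:] ^ m) (\<lambda>k. (S ^^ k) y (st l))"
  have IH: "?p k \<simeq> (S ^^ k) y (st l + m)" for k by (rule Suc.IH) (use Suc.prems in simp)
  have "pact shift_seq ([:- beta, 1:] ^ Suc m) (\<lambda>k. (S ^^ k) y (st l)) k = ?p (Suc k) - beta * ?p k"
    unfolding power_Suc by (subst shift_seq.pact_mult) (simp_all add: pact_linear shift_seq_def)
  also have "\<dots> \<simeq> (S ^^ Suc k) y (st l + m) - \<theta> * (S ^^ k) y (st l + m)"
  proof (intro cg_diff IH cg_mult)
    show "beta \<simeq> \<theta>" by (rule cg_sym) (rule theta_cg_beta)
    have "st l + m < d" by (rule blk_index_less) (use assms Suc.prems in auto)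
    thus "absv ((S ^^ k) y (st l + m)) \<le> 1"
      using vanish_from_funpow[OF assms(1), of k] by (simp add: vanish_from_def range_em_absv)
  qed (rule absv_beta_le_1)
  also have "(S ^^ Suc k) y (st l + m) - \<theta> * (S ^^ k) y (st l + m) = (S ^^ k) y (st l + Suc m)"
    using S_block_next[OF assms(2) Suc.prems, of "(S ^^ k) y"] by simp
  finally show ?case .
qed simp

text \<open>One more factor steps off the end of the block, and there E returns the Frobenius of the
  first coordinate.\<close>

lemma block_sequence_frobenius:
  assumes "vanish_from (Suc l) y" "l < r"
  shows "(S ^^ k) y (st l) ^ q \<simeq> pact shift_seq ([:- beta, 1:] ^ sz l) (\<lambda>k. (S ^^ k) y (st l)) k"
proof -
  obtain m where m: "sz l = Suc m" using sz_pos[OF assms(2)] by (cases "sz l") auto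
  let ?p = "pact shift_seq ([:- beta, 1:] ^ m) (\<lambda>k. (S ^^ k) y (st l))"
  have p: "?p k \<simeq> (S ^^ k) y (st l + m)" for k
    by (rule block_sequence_pact[OF assms]) (simp add: m)
  have "pact shift_seq ([:- beta, 1:] ^ sz l) (\<lambda>k. (S ^^ k) y (st l)) k = ?p (Suc k) - beta * ?p k"
    unfolding power_Suc m by (subst shift_seq.pact_mult) (simp_all add: pact_linear shift_seq_def)
  also have "\<dots> \<simeq> (S ^^ Suc k) y (st l + m) - \<theta> * (S ^^ k) y (st l + m)"
  proof (intro cg_diff p cg_mult)
    show "beta \<simeq> \<theta>" by (rule cg_sym) (rule theta_cg_beta)
    have "st l + m < d" by (rule blk_index_less) (use assms m in auto)
    thus "absv ((S ^^ k) y (st l + m)) \<le> 1"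
      using vanish_from_funpow[OF assms(1), of k] by (simp add: vanish_from_def range_em_absv)
  qed (rule absv_beta_le_1)
  also have "\<dots> \<simeq> (\<theta> * (S ^^ k) y (st l + m) + (S ^^ k) y (st l) ^ q) - \<theta> * (S ^^ k) y (st l + m)"
    using S_block_end_cg[OF vanish_from_funpow[OF assms(1)] assms(2), of k]
    by (intro cg_diff) (simp_all add: m)
  finally show ?thesis by (simp add: cg_sym)
qed

text \<open>The first coordinate is governed by \<open>frobenius_sequence_v\<close> and Fermat's
  theorem in A/v. The others follow along the block: coordinate k+1 is obtained from coordinate k by
  t - \<theta>, for y and for its image alike, and t commutes with the action of v^n.\<close>

lemma act_v_power_block:
  assumes "vanish_from (Suc l) y" "l < r" "k < sz l"
  shows "act (v ^ sz l) y (st l + k) \<simeq> y (st l + k)"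
  using assms(1,3)
proof (induction k arbitrary: y)
  case 0
  define u where "u = (\<lambda>k. (S ^^ k) y (st l))"
  have "act (v ^ sz l) y (st l) = pact shift_seq (map_poly kappa (v ^ sz l)) u 0"
    by (simp add: act_def pact_def shift_seq_funpow u_def)
  also have "\<dots> \<simeq> u 0 ^ (q ^ dv)"
    by (rule frobenius_sequence_v)
      (use block_sequence_frobenius[OF 0(1) assms(2)] in \<open>simp add: u_def\<close>)
  also have "\<dots> \<simeq> u 0"
  proof -
    have "st l < d" using blk_index_less[OF assms(2), of 0] sz_pos[OF assms(2)] by simp
    hence "u 0 \<in> range em" using 0 by (simp add: vanish_from_def u_def)
    thus ?thesis using em_frob_dv by auto
  qed
  finally show ?case by (simp add: u_def)
next
  case (Suc k)
  let ?b = "v ^ sz l"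
  have step: "z (st l + Suc k) = S z (st l + k) - \<theta> * z (st l + k)" for z
    using S_block_next[OF assms(2) Suc.prems(2)] by simp
  have "act ?b y (st l + Suc k) = act ?b (S y) (st l + k) - \<theta> * act ?b y (st l + k)"
    by (simp only: step act_simps)
  also have "\<dots> \<simeq> S y (st l + k) - \<theta> * y (st l + k)"
    using Suc.prems by (intro cg_diff cg_mult_left Suc.IH absv_theta_le_1 vanish_from_S) auto
  also have "\<dots> = y (st l + Suc k)" by (simp only: step)
  finally show ?case .
qed

lemma vanish_from_act_v_power:
  assumes "vanish_from (Suc l) y" "l < r"
  shows "vanish_from l (act (v ^ sz l - 1) y)"
  unfolding vanish_from_def
proof (intro conjI allI impI)
  have 1: "vanish_from (Suc l) (act (v ^ sz l - 1) y)" by (rule vanish_from_act[OF assms(1)])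
  show "act (v ^ sz l - 1) y j \<in> range em" if "j < d" for j
    using 1 that by (simp add: vanish_from_def)
  fix m k assume m: "l \<le> m" "m < r" "k < sz m"
  show "absv (act (v ^ sz l - 1) y (st m + k)) < 1"
  proof (cases "m = l")
    case True
    thus ?thesis using act_v_power_block[OF assms, of k] m by (simp add: act_simps cg_def)
  next
    case False
    thus ?thesis using 1 m by (simp add: vanish_from_def)
  qed
qed

definition annihilator :: "'a poly" where
  "annihilator = (\<Prod>m<r. v ^ sz m - 1)"

lemma absv_annihilator: "absv (em annihilator) = 1"
proof -
  have "absv (em (v ^ sz m - 1)) = 1" if "m < r" for m
  proof -
    have "em (v ^ sz m - 1) \<simeq> - 1"
      using absv_em_v sz_pos[OF that]
      by (simp add: cg_def em.hom_minus em.hom_power absv_power power_less_one_iff)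
    thus ?thesis by (rule absv_eq_1_cg) simp
  qed
  thus ?thesis by (simp add: annihilator_def em.hom_prod absv_prod)
qed

lemma act_annihilator:
  assumes "\<And>j. j < d \<Longrightarrow> y j \<in> range em" "j < d"
  shows "act annihilator y j \<in> range em" "absv (act annihilator y j) < 1"
proof -
  \<comment> \<open>\<open>n\<close> counts the blocks already annihilated, starting from the last
    one; each new factor acts on a point whose later blocks already vanish modulo v.\<close>
  have "vanish_from (r - n) (act (\<Prod>m\<in>{r - n..<r}. v ^ sz m - 1) y)" if "n \<le> r" for n
    using that
  proof (induction n)
    case 0
    show ?case using assms(1) by (simp add: vanish_from_def act_simps)
  next
    case (Suc n)
    have eq: "{r - Suc n..<r} = insert (r - Suc n) {r - n..<r}" using Suc.prems by auto
    have "vanish_from (Suc (r - Suc n)) (act (\<Prod>m\<in>{r - n..<r}. v ^ sz m - 1) y)"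
      using Suc by (simp add: Suc_diff_Suc)
    hence "vanish_from (r - Suc n)
        (act (v ^ sz (r - Suc n) - 1) (act (\<Prod>m\<in>{r - n..<r}. v ^ sz m - 1) y))"
      by (rule vanish_from_act_v_power) (use Suc.prems in auto)
    moreover have "r - Suc n \<notin> {r - n..<r}" using Suc.prems by auto
    ultimately show ?case unfolding eq by (simp only: prod.insert finite_atLeastLessThan act_simps(5) not_False_eq_True)
  qed
  from this[of r] have 0: "vanish_from 0 (act annihilator y)"
    by (simp add: annihilator_def lessThan_atLeast0)
  thus "act annihilator y j \<in> range em" using assms(2) by (simp add: vanish_from_def)
  obtain l k where "l < r" "k < sz l" "j = st l + k" using blk_index_exists[OF assms(2)] by auto
  thus "absv (act annihilator y j) < 1" using 0 by (simp add: vanish_from_def)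
qed

end

lemma mat_mult_index:
  assumes "A \<in> carrier_mat n n" "B \<in> carrier_mat n n" "i < n" "j < n"
  shows "(A * B) $$ (i, j) = (\<Sum>k<n. A $$ (i, k) * B $$ (k, j))"
  using assms by (simp add: scalar_prod_def atLeast0LessThan)

lemma mult_mat_vec_index:
  assumes "A \<in> carrier_mat n n" "x \<in> carrier_vec n" "i < n"
  shows "(A *\<^sub>v x) $ i = (\<Sum>k<n. A $$ (i, k) * x $ k)"
  using assms by (simp add: scalar_prod_def atLeast0LessThan)

section \<open>Elements of C_v coming from k\<close>

context place begin

lemma range_iota_add: "x \<in> range \<iota> \<Longrightarrow> y \<in> range \<iota> \<Longrightarrow> x + y \<in> range \<iota>"
  by (auto simp flip: hom_add)
lemma range_iota_mult: "x \<in> range \<iota> \<Longrightarrow> y \<in> range \<iota> \<Longrightarrow> x * y \<in> range \<iota>"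
  by (auto simp flip: hom_mult)
lemma range_iota_minus: "x \<in> range \<iota> \<Longrightarrow> - x \<in> range \<iota>"
  by (auto simp flip: hom_uminus)
lemma range_iota_divide: "x \<in> range \<iota> \<Longrightarrow> y \<in> range \<iota> \<Longrightarrow> x / y \<in> range \<iota>"
  by (auto simp flip: hom_div)
lemma range_iota_0 [simp]: "0 \<in> range \<iota>" by (rule range_eqI[of _ _ 0]) simp
lemma range_iota_1 [simp]: "1 \<in> range \<iota>" by (rule range_eqI[of _ _ 1]) simp
lemma range_iota_power: "x \<in> range \<iota> \<Longrightarrow> x ^ n \<in> range \<iota>"
  by (induction n) (simp_all add: range_iota_mult)
lemma range_iota_sum: "(\<And>i. i \<in> I \<Longrightarrow> f i \<in> range \<iota>) \<Longrightarrow> (\<Sum>i\<in>I. f i) \<in> range \<iota>"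
  by (induction I rule: infinite_finite_induct) (simp_all add: range_iota_add)

lemma range_em_subset: "range em \<subseteq> range \<iota>"
  by (auto simp: emb_def)

end

context tmodule begin

section \<open>The logarithm\<close>

abbreviation has_prev :: "nat \<Rightarrow> bool" where "has_prev j \<equiv> 0 < j \<and> has_next t (j - 1)"

lemma q_pos: "0 < q ^ n" using q_ge_2 by simp

lemma lin_carrier: "tm_lin \<iota> t \<in> carrier_mat d d"
  using tm_N_carrier[of t, where 'a = 'c] by (simp add: tm_lin_def)

lemma E_carrier: "tm_E t w \<in> carrier_mat d d"
  by (simp add: tm_E_def)

lemma rho_t_carrier: "tm_rho_t \<iota> t w n \<in> carrier_mat d d"
  by (simp add: tm_rho_t_def lin_carrier E_carrier)

lemma lin_index:
  assumes "i < d" "j < d"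
  shows "tm_lin \<iota> t $$ (i, j) = (if j = i then \<theta> else if has_next t i \<and> j = Suc i then 1 else 0)"
proof -
  have "dim_row (tm_N t :: 'c mat) = d" "dim_col (tm_N t :: 'c mat) = d"
    using tm_N_carrier[of t, where 'a = 'c] by auto
  thus ?thesis using assms by (auto simp: tm_lin_def tm_N_index)
qed

lemma lin_sum_left_frob:
  assumes "i < d"
  shows "(\<Sum>k<d. tm_lin \<iota> t $$ (i, k) ^ (q ^ n) * f k) =
    \<theta> ^ (q ^ n) * f i + (if has_next t i then f (Suc i) else 0)"
proof -
  have "(\<Sum>k<d. tm_lin \<iota> t $$ (i, k) ^ (q ^ n) * f k) =
      (\<Sum>k<d. (if k = i then \<theta> ^ (q ^ n) * f k else 0)
        + (if k = Suc i then if has_next t i then f k else 0 else 0))"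
    by (rule sum.cong) (use assms q_pos[of n] in \<open>auto simp: lin_index power_0_left\<close>)
  also have "\<dots> = \<theta> ^ (q ^ n) * f i + (if Suc i < d then if has_next t i then f (Suc i) else 0 else 0)"
    using assms by (simp add: sum.distrib)
  also have "\<dots> = \<theta> ^ (q ^ n) * f i + (if has_next t i then f (Suc i) else 0)"
    using has_next_less[of t i] by auto
  finally show ?thesis .
qed

lemma lin_sum_left:
  "i < d \<Longrightarrow> (\<Sum>k<d. tm_lin \<iota> t $$ (i, k) * f k) = \<theta> * f i + (if has_next t i then f (Suc i) else 0)"
  using lin_sum_left_frob[of i 0 f] by simp

lemma lin_sum_right:
  assumes "j < d"
  shows "(\<Sum>k<d. f k * tm_lin \<iota> t $$ (k, j) ^ (q ^ n)) =
    f j * \<theta> ^ (q ^ n) + (if has_prev j then f (j - 1) else 0)"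
proof -
  have "(\<Sum>k<d. f k * tm_lin \<iota> t $$ (k, j) ^ (q ^ n)) =
      (\<Sum>k<d. (if k = j then f k * \<theta> ^ (q ^ n) else 0) + (if k = j - 1 then if has_prev j then f k else 0 else 0))"
    by (rule sum.cong) (use assms q_pos[of n] in \<open>auto simp: lin_index power_0_left\<close>)
  also have "\<dots> = f j * \<theta> ^ (q ^ n) + (if has_prev j then f (j - 1) else 0)"
    using assms less_imp_diff_less[OF assms, of 1] by (simp add: sum.distrib)
  finally show ?thesis .
qed

lemma map_mat_frob_0: "map_mat (\<lambda>x::'c. x ^ (q ^ n)) (0\<^sub>m d d) = 0\<^sub>m d d"
  using q_pos[of n] by (intro eq_matI) (auto simp: power_0_left)

text \<open>Since \<rho>_t has degree 1 in \<tau>, only the summands n and n-1 of the convolution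
  are nonzero.\<close>

lemma tw_mult_rho_t_right:
  assumes P: "\<And>n. P n \<in> carrier_mat d d" and ij: "i < d" "j < d"
  shows "tw_mult q d P (tm_rho_t \<iota> t w) n $$ (i, j) =
    P n $$ (i, j) * \<theta> ^ (q ^ n) + (if has_prev j then P n $$ (i, j - 1) else 0)
    + (if n = 0 then 0 else \<Sum>k<d. P (n - 1) $$ (i, k) * EE k j ^ (q ^ (n - 1)))"
proof -
  let ?f = "\<lambda>m. (P m * map_mat (\<lambda>x. x ^ (q ^ m)) (tm_rho_t \<iota> t w (n - m))) $$ (i, j)"
  have top: "?f n = P n $$ (i, j) * \<theta> ^ (q ^ n) + (if has_prev j then P n $$ (i, j - 1) else 0)"
    using lin_carrier ij lin_sum_right[OF ij(2), of "\<lambda>k. P n $$ (i, k)" n]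
    by (subst mat_mult_index[OF P]) (simp_all add: tm_rho_t_def)
  have "tw_mult q d P (tm_rho_t \<iota> t w) n $$ (i, j) = sum ?f {..n}"
    using ij by (simp add: tw_mult_def)
  also have "\<dots> = ?f n + (if n = 0 then 0 else ?f (n - 1))"
  proof (cases n)
    case (Suc m)
    have "sum ?f {..n} = sum ?f {m, n}"
    proof (rule sum.mono_neutral_right)
      show "\<forall>k\<in>{..n} - {m, n}. ?f k = 0"
      proof
        fix k assume "k \<in> {..n} - {m, n}"
        hence "n - k \<noteq> 0" "n - k \<noteq> 1" using Suc by auto
        thus "?f k = 0" using P ij by (simp add: tm_rho_t_def map_mat_frob_0 right_mult_zero_mat[OF P])
      qed
    qed (use Suc in auto)
    thus ?thesis using Suc by (simp add: add.commute)
  qed simp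
  also have "(if n = 0 then 0 else ?f (n - 1)) =
      (if n = 0 then 0 else \<Sum>k<d. P (n - 1) $$ (i, k) * EE k j ^ (q ^ (n - 1)))"
  proof (cases n)
    case (Suc m)
    thus ?thesis using E_carrier ij
      by (simp add: tm_rho_t_def mat_mult_index[OF P map_carrier_mat[THEN iffD2, OF E_carrier]])
  qed simp
  finally show ?thesis unfolding top .
qed

lemma tw_mult_rho_t_left:
  assumes Q: "\<And>n. Q n \<in> carrier_mat d d" and ij: "i < d" "j < d"
  shows "tw_mult q d (tm_rho_t \<iota> t w) Q n $$ (i, j) =
    \<theta> * Q n $$ (i, j) + (if has_next t i then Q n $$ (Suc i, j) else 0)
    + (if n = 0 then 0 else \<Sum>k<d. EE i k * Q (n - 1) $$ (k, j) ^ q)"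
proof -
  let ?f = "\<lambda>m. (tm_rho_t \<iota> t w m * map_mat (\<lambda>x. x ^ (q ^ m)) (Q (n - m))) $$ (i, j)"
  have dims: "dim_row (Q m) = d" "dim_col (Q m) = d" for m using Q[of m] by auto
  have bot: "?f 0 = \<theta> * Q n $$ (i, j) + (if has_next t i then Q n $$ (Suc i, j) else 0)"
    using ij lin_sum_left[OF ij(1), of "\<lambda>k. Q n $$ (k, j)"] dims
    by (subst mat_mult_index[OF rho_t_carrier map_carrier_mat[THEN iffD2, OF Q]]) (simp_all add: tm_rho_t_def)
  have "tw_mult q d (tm_rho_t \<iota> t w) Q n $$ (i, j) = sum ?f {..n}"
    using ij by (simp add: tw_mult_def)
  also have "\<dots> = ?f 0 + (if n = 0 then 0 else ?f 1)"
  proof (cases n)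
    case (Suc m)
    have "sum ?f {..n} = sum ?f {0, 1}"
    proof (rule sum.mono_neutral_right)
      show "\<forall>k\<in>{..n} - {0, 1}. ?f k = 0"
        using ij by (auto simp: tm_rho_t_def left_mult_zero_mat[OF map_carrier_mat[THEN iffD2, OF Q]])
    qed (use Suc in auto)
    thus ?thesis using Suc by simp
  qed simp
  also have "(if n = 0 then 0 else ?f 1) =
      (if n = 0 then 0 else \<Sum>k<d. EE i k * Q (n - 1) $$ (k, j) ^ q)"
    using ij dims
    by (simp add: tm_rho_t_def mat_mult_index[OF E_carrier map_carrier_mat[THEN iffD2, OF Q]])
  finally show ?thesis unfolding bot .
qed

lemma tw_mult_const_left:
  assumes Q: "\<And>n. Q n \<in> carrier_mat d d" and ij: "i < d" "j < d"
  shows "tw_mult q d (tw_const d (tm_lin \<iota> t)) Q n $$ (i, j) =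
    \<theta> * Q n $$ (i, j) + (if has_next t i then Q n $$ (Suc i, j) else 0)"
proof -
  let ?f = "\<lambda>m. (tw_const d (tm_lin \<iota> t) m * map_mat (\<lambda>x. x ^ (q ^ m)) (Q (n - m))) $$ (i, j)"
  have dims: "dim_row (Q m) = d" "dim_col (Q m) = d" for m using Q[of m] by auto
  have "tw_mult q d (tw_const d (tm_lin \<iota> t)) Q n $$ (i, j) = sum ?f {..n}"
    using ij by (simp add: tw_mult_def)
  also have "\<dots> = sum ?f {0}"
    using ij by (intro sum.mono_neutral_right)
      (auto simp: tw_const_def left_mult_zero_mat[OF map_carrier_mat[THEN iffD2, OF Q]])
  also have "\<dots> = \<theta> * Q n $$ (i, j) + (if has_next t i then Q n $$ (Suc i, j) else 0)"
    using ij dims lin_sum_left[OF ij(1), of "\<lambda>k. Q n $$ (k, j)"]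
    by (simp add: tw_const_def mat_mult_index[OF lin_carrier map_carrier_mat[THEN iffD2, OF Q]])
  finally show ?thesis .
qed

definition log_coeffs :: "(nat \<Rightarrow> 'c mat) \<Rightarrow> bool" where
  "log_coeffs P \<longleftrightarrow> (\<forall>n. P n \<in> carrier_mat d d) \<and> P 0 = 1\<^sub>m d \<and>
     tw_mult q d P (tm_rho_t \<iota> t w) = tw_mult q d (tw_const d (tm_lin \<iota> t)) P"

text \<open>In the coefficient of \<tau>^(n+1) the scalars \<theta>^(q^(n+1)) and \<theta> from the
  two sides combine to the bracket [n+1]. The coefficient of \<tau>^0 matches because the identity
  commutes with the linear part.\<close>

lemma log_coeffs_iff:
  "log_coeffs P \<longleftrightarrow> (\<forall>n. P n \<in> carrier_mat d d) \<and> P 0 = 1\<^sub>m d \<and>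
     (\<forall>n i j. i < d \<longrightarrow> j < d \<longrightarrow>
       em (bracket (Suc n)) * P (Suc n) $$ (i, j) =
         (if has_next t i then P (Suc n) $$ (Suc i, j) else 0)
         - (if has_prev j then P (Suc n) $$ (i, j - 1) else 0)
         - (\<Sum>k<d. P n $$ (i, k) * EE k j ^ (q ^ n)))"
    (is "_ \<longleftrightarrow> ?C \<and> ?I \<and> ?R")
proof -
  have "tw_mult q d P (tm_rho_t \<iota> t w) = tw_mult q d (tw_const d (tm_lin \<iota> t)) P \<longleftrightarrow> ?R"
    if C: ?C and I: ?I
  proof -
    let ?L = "tw_mult q d P (tm_rho_t \<iota> t w)" and ?M = "tw_mult q d (tw_const d (tm_lin \<iota> t)) P"
    have car: "?L n \<in> carrier_mat d d" "?M n \<in> carrier_mat d d" for n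
      by (simp_all add: tw_mult_def)
    have Pc: "P n \<in> carrier_mat d d" for n using C by blast
    have "?L = ?M \<longleftrightarrow> (\<forall>n i j. i < d \<longrightarrow> j < d \<longrightarrow> ?L n $$ (i, j) = ?M n $$ (i, j))"
    proof
      assume *: "\<forall>n i j. i < d \<longrightarrow> j < d \<longrightarrow> ?L n $$ (i, j) = ?M n $$ (i, j)"
      show "?L = ?M"
      proof
        fix n
        note dims = carrier_matD[OF car(1)[of n]] carrier_matD[OF car(2)[of n]]
        show "?L n = ?M n"
        proof (rule eq_matI)
          fix i j assume "i < dim_row (?M n)" "j < dim_col (?M n)"
          hence "i < d" "j < d" unfolding dims .
          thus "?L n $$ (i, j) = ?M n $$ (i, j)" using * by blast
        qed (unfold dims, rule refl, rule refl)
      qed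
    qed simp
    also have "\<dots> \<longleftrightarrow> (\<forall>n i j. i < d \<longrightarrow> j < d \<longrightarrow> ?L (Suc n) $$ (i, j) = ?M (Suc n) $$ (i, j))"
    proof -
      have 0: "?L 0 $$ (i, j) = ?M 0 $$ (i, j)" if "i < d" "j < d" for i j
        unfolding tw_mult_rho_t_right[OF Pc that] tw_mult_const_left[OF Pc that] I
        using that has_next_less[of t i] by (cases j) auto
      have "?L n $$ (i, j) = ?M n $$ (i, j)"
        if "\<forall>n i j. i < d \<longrightarrow> j < d \<longrightarrow> ?L (Suc n) $$ (i, j) = ?M (Suc n) $$ (i, j)" "i < d" "j < d" for n i j
        using 0 that by (cases n) blast+
      thus ?thesis by blast
    qed
    also have "\<dots> \<longleftrightarrow> ?R"
    proof -
      have "?L (Suc n) $$ (i, j) = ?M (Suc n) $$ (i, j) \<longleftrightarrow>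
          em (bracket (Suc n)) * P (Suc n) $$ (i, j) =
         (if has_next t i then P (Suc n) $$ (Suc i, j) else 0)
         - (if has_prev j then P (Suc n) $$ (i, j - 1) else 0)
         - (\<Sum>k<d. P n $$ (i, k) * EE k j ^ (q ^ n))" if "i < d" "j < d" for n i j
        unfolding tw_mult_rho_t_right[OF Pc that] tw_mult_const_left[OF Pc that] em_bracket
        by (simp add: algebra_simps eq_diff_eq diff_eq_eq)
      thus ?thesis by simp
    qed
    finally show ?thesis .
  qed
  thus ?thesis unfolding log_coeffs_def by blast
qed

text \<open>As N is nilpotent, the matrix equation can be solved entry by entry: row i refers to row
  i+1 and column j to column j-1. The guard \<open>i < d\<close> makes the measure d - i + j
  decrease.\<close>

function logc :: "nat \<Rightarrow> nat \<Rightarrow> nat \<Rightarrow> 'c" where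
  "logc 0 i j = (if i = j then 1 else 0)"
| "logc (Suc n) i j =
     ((if i < d \<and> has_next t i then logc (Suc n) (Suc i) j else 0)
      - (if has_prev j then logc (Suc n) i (j - 1) else 0)
      - (\<Sum>k<d. logc n i k * EE k j ^ (q ^ n))) / em (bracket (Suc n))"
  by pat_completeness auto
termination
  by (relation "measures [\<lambda>(n, i, j). n, \<lambda>(n, i, j). d - i + j]") auto

declare logc.simps [simp del]

lemma em_bracket_nz: "em (bracket (Suc n)) \<noteq> 0"
  using bracket_nz[of "Suc n"] by simp

lemma log_coeffs_exists: "log_coeffs (\<lambda>n. mat d d (\<lambda>(i, j). logc n i j))"
  unfolding log_coeffs_iff
proof (intro conjI allI impI)
  show "mat d d (\<lambda>(i, j). logc 0 i j) = 1\<^sub>m d"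
    by (intro eq_matI) (auto simp: logc.simps)
  fix n i j assume ij: "i < d" "j < d"
  have "em (bracket (Suc n)) * logc (Suc n) i j = (if i < d \<and> has_next t i then logc (Suc n) (Suc i) j else 0)
      - (if has_prev j then logc (Suc n) i (j - 1) else 0)
      - (\<Sum>k<d. logc n i k * EE k j ^ (q ^ n))"
    unfolding logc.simps(2)[of n i j] using em_bracket_nz[of n] by simp
  thus "em (bracket (Suc n)) * mat d d (\<lambda>(i, j). logc (Suc n) i j) $$ (i, j) =
         (if has_next t i then mat d d (\<lambda>(i, j). logc (Suc n) i j) $$ (Suc i, j) else 0)
         - (if has_prev j then mat d d (\<lambda>(i, j). logc (Suc n) i j) $$ (i, j - 1) else 0)
         - (\<Sum>k<d. mat d d (\<lambda>(i, j). logc n i j) $$ (i, k) * EE k j ^ (q ^ n))"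
    using ij has_next_less[of t i] by (auto cong: if_cong)
qed auto

lemma log_coeffs_Suc:
  assumes "log_coeffs P" "i < d" "j < d"
  shows "em (bracket (Suc n)) * P (Suc n) $$ (i, j) =
         (if has_next t i then P (Suc n) $$ (Suc i, j) else 0)
         - (if has_prev j then P (Suc n) $$ (i, j - 1) else 0)
         - (\<Sum>k<d. P n $$ (i, k) * EE k j ^ (q ^ n))"
  using assms unfolding log_coeffs_iff by blast

lemma log_coeffs_unique:
  assumes "log_coeffs P" "log_coeffs P'"
  shows "P = P'"
proof
  have P: "P n \<in> carrier_mat d d" "P' n \<in> carrier_mat d d" for n
    using assms by (auto simp: log_coeffs_def)
  fix n
  have "P n $$ (i, j) = P' n $$ (i, j)" if "i < d" "j < d" for i j
    using that
  proof (induction n arbitrary: i j)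
    case 0
    thus ?case using assms by (simp add: log_coeffs_def)
  next
    case (Suc n)
    show ?case using Suc.prems
    \<comment> \<open>This follows the order in which \<open>logc\<close> solves the recursion; each
      entry is then determined because the bracket is nonzero.\<close>
    proof (induction "d - i + j" arbitrary: i j rule: less_induct)
      case less
      have 1: "P (Suc n) $$ (Suc i, j) = P' (Suc n) $$ (Suc i, j)" if "has_next t i"
        using has_next_less[OF that] less.prems by (intro less.hyps) auto
      have 2: "P (Suc n) $$ (i, j - 1) = P' (Suc n) $$ (i, j - 1)" if "has_prev j"
        using that less.prems by (intro less.hyps) auto
      have 3: "(\<Sum>k<d. P n $$ (i, k) * EE k j ^ (q ^ n)) = (\<Sum>k<d. P' n $$ (i, k) * EE k j ^ (q ^ n))"
        by (rule sum.cong) (use Suc.IH less.prems in auto)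
      have 4: "(if has_next t i then P (Suc n) $$ (Suc i, j) else 0) =
          (if has_next t i then P' (Suc n) $$ (Suc i, j) else 0)" using 1 by simp
      have 5: "(if has_prev j then P (Suc n) $$ (i, j - 1) else 0) =
          (if has_prev j then P' (Suc n) $$ (i, j - 1) else 0)" using 2 by (simp split: if_split)
      have "em (bracket (Suc n)) * P (Suc n) $$ (i, j) = em (bracket (Suc n)) * P' (Suc n) $$ (i, j)"
        unfolding log_coeffs_Suc[OF assms(1) less.prems] log_coeffs_Suc[OF assms(2) less.prems] 3 4 5 ..
      thus ?case using em_bracket_nz[of n] by simp
    qed
  qed
  thus "P n = P' n" using P[of n] by (intro eq_matI) auto
qed

lemma log_coeffs_tm_log: "log_coeffs (tm_log \<iota> t w)"
proof -
  have "tm_log \<iota> t w = (THE P. log_coeffs P)"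
    by (simp add: tm_log_def log_coeffs_def q_card)
  moreover have "\<exists>!P. log_coeffs P" using log_coeffs_exists log_coeffs_unique by blast
  hence "log_coeffs (THE P. log_coeffs P)" by (rule theI')
  ultimately show ?thesis by simp
qed

text \<open>The coordinate numbered wt in the definition of the polylogarithm, counted from 0. It
  ends the first block because that block has size d_1 = wt.\<close>

definition i0 :: nat where "i0 = sum_list t - 1"

definition R :: "nat \<Rightarrow> nat \<Rightarrow> 'c" where "R n j = tm_log \<iota> t w n $$ (i0, j)"

lemma i0_eq: "i0 = st 0 + (sz 0 - 1)"
  by (simp add: i0_def blk_size_0)

lemma r_pos: "0 < r" using t_ne by simp

lemma i0_less: "i0 < d"
  unfolding i0_eq by (rule blk_index_less) (use r_pos sz_pos in auto)

lemma not_has_next_i0: "\<not> has_next t i0"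
  unfolding i0_eq using has_next_blk[of 0 t "sz 0 - 1"] r_pos sz_pos[of 0] by simp

lemma R_0: "j < d \<Longrightarrow> R 0 j = (if j = i0 then 1 else 0)"
  using log_coeffs_tm_log i0_less by (auto simp: R_def log_coeffs_def)

lemma R_Suc:
  "j < d \<Longrightarrow> em (bracket (Suc n)) * R (Suc n) j =
     - (if has_prev j then R (Suc n) (j - 1) else 0) - (\<Sum>k<d. R n k * EE k j ^ (q ^ n))"
  using log_coeffs_Suc[OF log_coeffs_tm_log i0_less, of j n] not_has_next_i0 by (simp add: R_def)

lemma has_prev_blk:
  assumes "l < r" "k < sz l"
  shows "has_prev (st l + k) \<longleftrightarrow> 0 < k"
proof (cases k)
  case 0
  have "\<not> has_next t (st l - 1)" if pos: "0 < st l"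
  proof -
    obtain l' where l': "l = Suc l'" using pos by (cases l) auto
    hence "l' < r" using assms by simp
    thus ?thesis using has_next_blk[of l' t "sz l' - 1"] sz_pos[of l'] by (simp add: l' blk_start_Suc)
  qed
  thus ?thesis using 0 by auto
next
  case (Suc k')
  thus ?thesis using has_next_blk[of l t k'] assms by simp
qed

lemma EE_not_start:
  assumes "l < r" "Suc k < sz l" "i < d"
  shows "EE i (st l + Suc k) = 0"
proof (rule ccontr)
  assume nz: "EE i (st l + Suc k) \<noteq> 0"
  have jd: "st l + Suc k < d" by (rule blk_index_less) (use assms in auto)
  from EE_nonzero[OF nz assms(3) jd] obtain m where "m < r" "st l + Suc k = st m" by blast
  thus False using blk_index_inject[of t l "Suc k" m 0] assms sz_pos[of m] by simp
qed

text \<open>Passing from n to n+1, the entry at a block start is an integral combination of the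
  previous row divided by [n+1]. Each further coordinate of the block receives nothing from E and
  costs one more division. So an entry suffers at most wt divisions, and they are harmless unless
  \<open>dv\<close> divides n+1.\<close>

lemma R_bound:
  assumes "j < d"
  shows "absv (R n j) \<le> (real qv ^ sum_list t) ^ (n div dv)"
  using assms
proof (induction n arbitrary: j)
  case 0
  thus ?case by (simp add: R_0)
next
  case (Suc n)
  define M where "M = (real qv ^ sum_list t) ^ (n div dv)"
  define c where "c = (if dv dvd Suc n then real qv else 1)"
  have c: "1 \<le> c" "absv (em (bracket (Suc n))) = 1 / c"
    using qv_ge_2 absv_bracket[of "Suc n"] by (auto simp: c_def)
  have M: "0 \<le> M" by (simp add: M_def)
  have sum: "absv (\<Sum>k<d. R n k * EE k j ^ (q ^ n)) \<le> M" if "j < d" for j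
  proof (rule absv_sum_le[OF _ M])
    fix k assume k: "k \<in> {..<d}"
    have "absv (R n k) * absv (EE k j) ^ (q ^ n) \<le> M * 1"
      by (rule mult_mono)
        (use Suc.IH[of k] k M range_em_absv[OF EE_em[of k j]] that in \<open>auto simp: M_def power_le_one\<close>)
    thus "absv (R n k * EE k j ^ (q ^ n)) \<le> M" by (simp add: absv_mult absv_power)
  qed
  have absR: "absv (R (Suc n) j) = c * absv (em (bracket (Suc n)) * R (Suc n) j)" for j
    using c by (simp add: absv_mult)
  have blk: "absv (R (Suc n) (st l + k)) \<le> M * c ^ Suc k" if "l < r" "k < sz l" for l k
    using that(2)
  proof (induction k)
    case 0
    have "st l < d" using blk_index_less[OF that(1), of 0] 0 by simp
    hence "absv (em (bracket (Suc n)) * R (Suc n) (st l)) \<le> M"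
      using R_Suc[of "st l" n] has_prev_blk[OF that(1) 0] sum[of "st l"] by auto
    thus ?case using absR[of "st l"] c(1) by (simp add: mult.commute mult_right_mono)
  next
    case (Suc k)
    have "st l + Suc k < d" by (rule blk_index_less) (use that Suc.prems in auto)
    hence "em (bracket (Suc n)) * R (Suc n) (st l + Suc k) = - R (Suc n) (st l + k)"
      using R_Suc[of "st l + Suc k" n] has_prev_blk[OF that(1) Suc.prems]
        EE_not_start[OF that(1) Suc.prems] q_ge_2
      by (simp add: power_0_left)
    hence "absv (R (Suc n) (st l + Suc k)) = c * absv (R (Suc n) (st l + k))"
      using absR[of "st l + Suc k"] by simp
    also have "\<dots> \<le> c * (M * c ^ Suc k)"
      using Suc c(1) by (intro mult_left_mono) auto
    finally show ?case by (simp add: mult_ac)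
  qed
  obtain l k where lk: "l < r" "k < sz l" "j = st l + k"
    using blk_index_exists[OF Suc.prems] by auto
  have "absv (R (Suc n) j) \<le> M * c ^ Suc k" using blk[OF lk(1,2)] lk(3) by simp
  also have "\<dots> \<le> M * c ^ sum_list t"
    using lk blk_size_le[of t l] c(1) M by (intro mult_left_mono power_increasing) auto
  \<comment> \<open>The quotient by \<open>dv\<close> grows by one exactly at the steps where
    \<open>c\<close> equals q_v.\<close>
  also have "\<dots> = (real qv ^ sum_list t) ^ (Suc n div dv)"
    by (simp add: M_def c_def div_Suc dvd_eq_mod_eq_0)
  finally show ?case .
qed

lemma R_range: "j < d \<Longrightarrow> R n j \<in> range \<iota>"
proof (induction n arbitrary: j)
  case 0
  thus ?case by (simp add: R_0)
next
  case (Suc n)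
  show ?case using Suc.prems
  proof (induction j rule: less_induct)
    case (less j)
    have "R (Suc n) j = (em (bracket (Suc n)) * R (Suc n) j) / em (bracket (Suc n))"
      using em_bracket_nz[of n] by simp
    moreover have "em (bracket (Suc n)) * R (Suc n) j \<in> range \<iota>"
      unfolding R_Suc[OF less.prems] diff_conv_add_uminus
      using less Suc.IH range_em_subset EE_em
      by (intro range_iota_add range_iota_minus range_iota_sum range_iota_mult range_iota_power)
        (auto intro!: range_iota_0)
    ultimately show ?case using range_em_subset range_iota_divide by (metis rangeI subsetD)
  qed
qed

end

section \<open>Limits and series in a nonarchimedean field\<close>

lemma double_exponential_decay:
  fixes c M :: real
  assumes "0 \<le> c" "c < 1" "0 \<le> M" "2 \<le> q"
  shows "(\<lambda>n. M ^ n * c ^ (q ^ n)) \<longlonglongrightarrow> 0"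
proof (rule summable_LIMSEQ_zero)
  have "(\<lambda>n. M * c ^ n) \<longlonglongrightarrow> M * 0"
    using assms by (intro tendsto_mult tendsto_const LIMSEQ_realpow_zero)
  hence "eventually (\<lambda>n. M * c ^ n < 1 / 2) sequentially"
    by (rule order_tendstoD(2)) simp
  then obtain N where N: "\<And>n. n \<ge> N \<Longrightarrow> M * c ^ n < 1 / 2"
    unfolding eventually_sequentially by blast
  show "summable (\<lambda>n. M ^ n * c ^ (q ^ n))"
  proof (rule summable_ratio_test[where c = "1 / 2" and N = N])
    fix n assume n: "N \<le> n"
    have "n \<le> 2 ^ n" using less_exp[of n] by simp
    also have "\<dots> \<le> q ^ n" using assms(4) by (rule power_mono) simp
    finally have "c ^ (q ^ n) \<le> c ^ n" using assms by (intro power_decreasing) auto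
    hence le: "M * c ^ (q ^ n) \<le> 1 / 2" using N[OF n] mult_left_mono[of "c ^ (q ^ n)" "c ^ n" M] assms(3) by linarith
    \<comment> \<open>At least doubling the exponent splits off another factor c^(q^n), which
      together with M is at most 1/2 for large n.\<close>
    have "2 * q ^ n \<le> q * q ^ n" using assms(4) by (rule mult_le_mono1)
    hence "q ^ n + q ^ n \<le> q ^ Suc n" by (simp only: mult_2 power_Suc)
    hence "c ^ (q ^ Suc n) \<le> c ^ (q ^ n) * c ^ (q ^ n)"
      using assms by (simp add: power_decreasing flip: power_add)
    hence "M ^ Suc n * c ^ (q ^ Suc n) \<le> M ^ Suc n * (c ^ (q ^ n) * c ^ (q ^ n))"
      using assms by (intro mult_left_mono) auto
    also have "\<dots> = (M * c ^ (q ^ n)) * (M ^ n * c ^ (q ^ n))" by (simp add: mult_ac)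
    also have "\<dots> \<le> 1 / 2 * (M ^ n * c ^ (q ^ n))"
      using le assms by (intro mult_right_mono) auto
    finally show "norm (M ^ Suc n * c ^ (q ^ Suc n)) \<le> 1 / 2 * norm (M ^ n * c ^ (q ^ n))"
      using assms by simp
  qed simp
qed

context place begin

text \<open>Field and metric enter the sort of the type independently; the ultrametric inequality is
  what makes addition continuous.\<close>

lemma tendsto_addv:
  assumes "X \<longlonglongrightarrow> x" "Y \<longlonglongrightarrow> (y :: 'c)"
  shows "(\<lambda>n. X n + Y n) \<longlonglongrightarrow> x + y"
proof (rule metric_LIMSEQ_I)
  fix e :: real assume e: "0 < e"
  obtain N1 N2 where "\<And>n. n \<ge> N1 \<Longrightarrow> dist (X n) x < e" "\<And>n. n \<ge> N2 \<Longrightarrow> dist (Y n) y < e"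
    using metric_LIMSEQ_D[OF assms(1) e] metric_LIMSEQ_D[OF assms(2) e] by blast
  moreover have "dist (X n + Y n) (x + y) \<le> max (dist (X n) x) (dist (Y n) y)" for n
    using absv_ultrametric[of "X n - x" "Y n - y"] by (simp add: dist_eq_absv[of _ x] dist_eq_absv[of _ y] dist_eq_absv[of _ "x + y"] algebra_simps)
  ultimately show "\<exists>N. \<forall>n\<ge>N. dist (X n + Y n) (x + y) < e"
    by (intro exI[of _ "max N1 N2"]) (metis max.bounded_iff max_less_iff_conj order_le_less_trans)
qed

lemma tendsto_scalev:
  assumes "X \<longlonglongrightarrow> (x :: 'c)"
  shows "(\<lambda>n. c * X n) \<longlonglongrightarrow> c * x"
proof -
  have "dist (c * X n) (c * x) = absv c * dist (X n) x" for n
    by (simp add: dist_eq_absv[of _ x] dist_eq_absv[of _ "c * x"] flip: absv_mult right_diff_distrib)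
  moreover have "(\<lambda>n. absv c * dist (X n) x) \<longlonglongrightarrow> absv c * 0"
    using assms by (intro tendsto_mult tendsto_const) (simp flip: tendsto_dist_iff)
  ultimately show ?thesis by (simp add: tendsto_dist_iff[of "\<lambda>n. c * X n"])
qed

text \<open>A block of terms is no larger than its largest term, so null terms already make the
  partial sums Cauchy.\<close>

lemma convergent_sum_nonarch:
  assumes "(\<lambda>n. absv (f n :: 'c)) \<longlonglongrightarrow> 0"
  shows "convergent (\<lambda>N. \<Sum>n<N. f n)"
proof (rule Cauchy_convergent, unfold Cauchy_altdef, intro allI impI)
  fix e :: real assume e: "0 < e"
  obtain N where N: "\<And>n. n \<ge> N \<Longrightarrow> absv (f n) < e"
    using order_tendstoD(2)[OF assms e] unfolding eventually_sequentially by blast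
  have "dist (\<Sum>n<m. f n) (\<Sum>n<n. f n) < e" if "N \<le> m" "m < n" for m n
  proof -
    have "{..<n} = {..<m} \<union> {m..<n}" using that by auto
    hence "(\<Sum>n<n. f n) = (\<Sum>n<m. f n) + (\<Sum>n\<in>{m..<n}. f n)"
      by (simp add: sum.union_disjoint ivl_disj_int)
    hence "dist (\<Sum>n<m. f n) (\<Sum>n<n. f n) = absv (\<Sum>n\<in>{m..<n}. f n)"
      by (simp add: dist_eq_absv[of "\<Sum>n<m. f n"])
    also have "\<dots> < e" by (rule absv_sum_less) (use N that e in auto)
    finally show ?thesis .
  qed
  thus "\<exists>M. \<forall>m\<ge>M. \<forall>n>m. dist (\<Sum>n<m. f n) (\<Sum>n<n. f n) < e" by blast
qed

lemma absv_limit_le: "X \<longlonglongrightarrow> (x :: 'c) \<Longrightarrow> (\<And>n. absv (X n) \<le> B) \<Longrightarrow> absv x \<le> B"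
  by (rule LIMSEQ_le_const2[OF tendsto_dist[OF _ tendsto_const]]) auto

end

context tmodule begin

section \<open>The last coordinate of the first block of the logarithm\<close>

definition Lt :: "(nat \<Rightarrow> 'c) \<Rightarrow> nat \<Rightarrow> 'c" where "Lt y n = (\<Sum>j<d. R n j * y j ^ (q ^ n))"
definition L :: "(nat \<Rightarrow> 'c) \<Rightarrow> 'c" where "L y = suminf (Lt y)"
definition small :: "(nat \<Rightarrow> 'c) \<Rightarrow> bool" where "small y \<longleftrightarrow> (\<forall>j<d. absv (y j) < 1)"

abbreviation M :: real where "M \<equiv> real qv ^ sum_list t"

lemma M_ge_1: "1 \<le> M"
  using qv_ge_2 by simp

text \<open>Stated for general coefficients because it serves the rows \<open>R\<close> and also the
  telescoping terms \<open>Y\<close>.\<close>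

lemma weighted_sum_bound:
  fixes f y :: "nat \<Rightarrow> 'c"
  assumes "\<And>j. j < d \<Longrightarrow> absv (f j) \<le> M ^ (n div dv)" "\<And>j. j < d \<Longrightarrow> absv (y j) \<le> c" "0 \<le> c"
  shows "absv (\<Sum>j<d. f j * y j ^ (q ^ n)) \<le> M ^ (n div dv) * c ^ (q ^ n)"
proof (rule absv_sum_le)
  fix j assume "j \<in> {..<d}"
  hence "absv (f j) * absv (y j) ^ (q ^ n) \<le> M ^ (n div dv) * c ^ (q ^ n)"
    using assms M_ge_1 by (intro mult_mono power_mono) auto
  thus "absv (f j * y j ^ (q ^ n)) \<le> M ^ (n div dv) * c ^ (q ^ n)"
    by (simp add: absv_mult absv_power)
qed (use assms(3) in simp)

lemma weighted_sum_tendsto_0: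
  fixes f :: "nat \<Rightarrow> nat \<Rightarrow> 'c"
  assumes "\<And>n j. j < d \<Longrightarrow> absv (f n j) \<le> M ^ (n div dv)" "small y"
  shows "(\<lambda>n. absv (\<Sum>j<d. f n j * y j ^ (q ^ n))) \<longlonglongrightarrow> 0"
proof -
  define c where "c = Max (insert 0 ((\<lambda>j. absv (y j)) ` {..<d}))"
  have "c < 1" using assms(2) by (auto simp: c_def small_def)
  moreover have c: "0 \<le> c" "\<And>j. j < d \<Longrightarrow> absv (y j) \<le> c" by (auto simp: c_def)
  ultimately have lim: "(\<lambda>n. M ^ n * c ^ (q ^ n)) \<longlonglongrightarrow> 0"
    using M_ge_1 q_ge_2 by (intro double_exponential_decay) auto
  have "absv (\<Sum>j<d. f n j * y j ^ (q ^ n)) \<le> M ^ n * c ^ (q ^ n)" for n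
  proof -
    have "absv (\<Sum>j<d. f n j * y j ^ (q ^ n)) \<le> M ^ (n div dv) * c ^ (q ^ n)"
      by (rule weighted_sum_bound[OF assms(1) c(2,1)])
    \<comment> \<open>For convergence alone the coarser power M^n suffices, as it is dominated by
      the exponent q^n.\<close>
    also have "\<dots> \<le> M ^ n * c ^ (q ^ n)"
      using M_ge_1 c(1) by (intro mult_right_mono power_increasing) auto
    finally show ?thesis .
  qed
  thus ?thesis by (intro tendsto_sandwich[OF _ _ tendsto_const lim]) auto
qed

lemma L_limit:
  assumes "small y"
  shows "(\<lambda>N. \<Sum>n<N. Lt y n) \<longlonglongrightarrow> L y"
proof -
  have "convergent (\<lambda>N. \<Sum>n<N. Lt y n)"
    unfolding Lt_def
    by (rule convergent_sum_nonarch, rule weighted_sum_tendsto_0[OF R_bound assms])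
  then obtain l where l: "(\<lambda>N. \<Sum>n<N. Lt y n) \<longlonglongrightarrow> l" by (auto simp: convergent_def)
  hence "l = L y" unfolding L_def by (intro sums_unique) (simp add: sums_def)
  thus ?thesis using l by simp
qed

text \<open>The terms that telescope in the sum over \<open>n\<close> of \<open>Lt (S y) n - \<theta> Lt y n\<close>.\<close>

definition Y :: "nat \<Rightarrow> nat \<Rightarrow> 'c" where
  "Y n k = (if n = 0 then 0 else \<Sum>j<d. R (n - 1) j * EE j k ^ (q ^ (n - 1)))"

text \<open>The recursion for the rows with the bracket expanded, in a form that includes n = 0:
  there \<open>Y\<close> is 0, and the row is not moved by N because \<open>i0\<close> ends its
  block.\<close>

lemma R_rec:
  assumes "k < d"
  shows "R n k * \<theta> ^ (q ^ n) + (if has_prev k then R n (k - 1) else 0) = \<theta> * R n k - Y n k"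
proof (cases n)
  case 0
  thus ?thesis using assms not_has_next_i0 by (auto simp: Y_def R_0)
next
  case (Suc m)
  define p where "p = (if has_prev k then R n (k - 1) else 0)"
  have "em (bracket n) * R n k = - p - Y n k"
    using R_Suc[OF assms, of m] unfolding p_def Y_def Suc by simp
  thus ?thesis unfolding p_def[symmetric] em_bracket by (simp add: algebra_simps)
qed

lemma Y_bound:
  assumes "k < d"
  shows "absv (Y n k) \<le> M ^ (n div dv)"
proof (cases n)
  case (Suc m)
  have "absv (\<Sum>j<d. R m j * EE j k ^ (q ^ m)) \<le> M ^ (m div dv) * 1 ^ (q ^ m)"
    by (rule weighted_sum_bound) (use R_bound range_em_absv[OF EE_em] assms in auto)
  also have "\<dots> \<le> M ^ (n div dv)"
    using M_ge_1 Suc by (simp add: power_increasing div_le_mono)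
  finally show ?thesis using Suc by (simp add: Y_def)
qed (simp add: Y_def)

lemma S_frobn:
  assumes "j < d"
  shows "S y j ^ (q ^ n) =
    (\<Sum>k<d. tm_lin \<iota> t $$ (j, k) ^ (q ^ n) * y k ^ (q ^ n)) + (\<Sum>k<d. EE j k ^ (q ^ n) * y k ^ (q ^ Suc n))"
proof -
  have "(\<Sum>k<d. EE j k * y k ^ q) ^ (q ^ n) = (\<Sum>k<d. EE j k ^ (q ^ n) * y k ^ (q ^ Suc n))"
    by (simp add: frobn_sum power_mult_distrib power_mult)
  moreover have "(if has_next t j then y (Suc j) else 0) ^ (q ^ n) = (if has_next t j then y (Suc j) ^ (q ^ n) else 0)"
    using q_ge_2 by simp
  ultimately show ?thesis
    using assms by (simp only: S_def frobn_add power_mult_distrib lin_sum_left_frob if_True)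
qed

text \<open>The contribution of E to the n-th term carries the exponent q^(n+1), so it is the
  \<open>Y\<close>-part belonging to the next index; the linear part is rewritten by
  \<open>R_rec\<close>.\<close>

lemma Lt_S: "Lt (S y) n = \<theta> * Lt y n - (\<Sum>k<d. Y n k * y k ^ (q ^ n)) + (\<Sum>k<d. Y (Suc n) k * y k ^ (q ^ Suc n))"
proof -
  have "Lt (S y) n = (\<Sum>j<d. R n j * (\<Sum>k<d. tm_lin \<iota> t $$ (j, k) ^ (q ^ n) * y k ^ (q ^ n)))
      + (\<Sum>j<d. R n j * (\<Sum>k<d. EE j k ^ (q ^ n) * y k ^ (q ^ Suc n)))"
    by (simp add: Lt_def S_frobn distrib_left sum.distrib del: power_Suc)
  also have "(\<Sum>j<d. R n j * (\<Sum>k<d. tm_lin \<iota> t $$ (j, k) ^ (q ^ n) * y k ^ (q ^ n))) =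
      (\<Sum>k<d. (\<Sum>j<d. R n j * tm_lin \<iota> t $$ (j, k) ^ (q ^ n)) * y k ^ (q ^ n))"
    unfolding sum_distrib_left sum_distrib_right by (subst sum.swap) (simp add: mult.assoc)
  also have "\<dots> = (\<Sum>k<d. (\<theta> * R n k - Y n k) * y k ^ (q ^ n))"
    by (intro sum.cong refl arg_cong2[where f = "(*)"]) (simp add: lin_sum_right flip: R_rec)
  also have "\<dots> = \<theta> * Lt y n - (\<Sum>k<d. Y n k * y k ^ (q ^ n))"
    by (simp add: Lt_def left_diff_distrib sum_subtractf sum_distrib_left mult.assoc)
  also have "(\<Sum>j<d. R n j * (\<Sum>k<d. EE j k ^ (q ^ n) * y k ^ (q ^ Suc n))) =
      (\<Sum>k<d. Y (Suc n) k * y k ^ (q ^ Suc n))"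
    unfolding sum_distrib_left Y_def
    by (subst sum.swap) (simp add: mult.assoc sum_distrib_right del: power_Suc)
  finally show ?thesis .
qed

lemma small_S:
  assumes "small y"
  shows "small (S y)"
proof -
  have "absv (S y i) < 1" if "i < d" for i
  proof -
    have 1: "absv (\<theta> * y i) < 1"
      using assms that by (intro absv_mult_less_1 absv_theta_le_1) (auto simp: small_def)
    have 2: "absv (if has_next t i then y (Suc i) else 0) < 1"
      using assms has_next_less[of t i] by (auto simp: small_def)
    have 3: "absv (\<Sum>k<d. EE i k * y k ^ q) < 1"
      by (intro absv_sum_less absv_mult_less_1 range_em_absv EE_em)
        (use assms that q_ge_2 in \<open>auto simp: small_def absv_power power_less_one_iff\<close>)
    have "S y i = (\<theta> * y i + (if has_next t i then y (Suc i) else 0)) + (\<Sum>k<d. EE i k * y k ^ q)"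
      using that by (simp add: S_def)
    also have "absv \<dots> < 1"
      using absv_ultrametric[of "\<theta> * y i + (if has_next t i then y (Suc i) else 0)" "\<Sum>k<d. EE i k * y k ^ q"]
        absv_ultrametric[of "\<theta> * y i" "if has_next t i then y (Suc i) else 0"] 1 2 3
      by linarith
    finally show ?thesis .
  qed
  thus ?thesis by (simp add: small_def)
qed

text \<open>The functional equation of the logarithm at \<open>i0\<close>, where N contributes
  nothing to the output. The partial sums differ from the claim by the single telescoped term
  \<open>X\<close>, which tends to 0 on the open polydisc.\<close>

lemma L_S:
  assumes "small y"
  shows "L (S y) = \<theta> * L y"
proof -
  define X where "X n = (\<Sum>k<d. Y n k * y k ^ (q ^ n))" for n
  have "(\<lambda>n. absv (X n)) \<longlonglongrightarrow> 0"
    unfolding X_def by (rule weighted_sum_tendsto_0[OF Y_bound assms])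
  hence X: "X \<longlonglongrightarrow> 0" by (subst tendsto_dist_iff)
  have "(\<Sum>n<N. Lt (S y) n) = \<theta> * (\<Sum>n<N. Lt y n) + X N" for N
  proof (induction N)
    case 0
    show ?case by (simp add: X_def Y_def)
  next
    case (Suc N)
    have "Lt (S y) N = \<theta> * Lt y N - X N + X (Suc N)" unfolding X_def by (rule Lt_S)
    thus ?case using Suc by (simp add: algebra_simps)
  qed
  hence "(\<lambda>N. \<Sum>n<N. Lt (S y) n) \<longlonglongrightarrow> \<theta> * L y + 0"
    using tendsto_addv[OF tendsto_scalev[OF L_limit[OF assms]] X] by simp
  thus ?thesis using L_limit[OF small_S[OF assms]] LIMSEQ_unique by fastforce
qed

lemma L_add: "small y \<Longrightarrow> small z \<Longrightarrow> L (\<lambda>j. y j + z j) = L y + L z"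
  and small_add: "small y \<Longrightarrow> small z \<Longrightarrow> small (\<lambda>j. y j + z j)"
proof -
  assume y: "small y" and z: "small z"
  show yz: "small (\<lambda>j. y j + z j)"
    using y z absv_ultrametric[of "y _" "z _"] unfolding small_def
    by (metis max_less_iff_conj order_le_less_trans)
  have "(\<Sum>n<N. Lt (\<lambda>j. y j + z j) n) = (\<Sum>n<N. Lt y n) + (\<Sum>n<N. Lt z n)" for N
    by (simp add: Lt_def frobn_add distrib_left sum.distrib)
  thus "L (\<lambda>j. y j + z j) = L y + L z"
    using tendsto_addv[OF L_limit[OF y] L_limit[OF z]] L_limit[OF yz] LIMSEQ_unique by simp
qed

lemma L_kappa: "small y \<Longrightarrow> L (\<lambda>j. kappa c * y j) = kappa c * L y"
  and small_kappa: "small y \<Longrightarrow> small (\<lambda>j. kappa c * y j)"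
proof -
  assume y: "small y"
  show cy: "small (\<lambda>j. kappa c * y j)"
    using y absv_mult_less_1[OF absv_kappa_le_1] by (simp add: small_def)
  have "(\<Sum>n<N. Lt (\<lambda>j. kappa c * y j) n) = kappa c * (\<Sum>n<N. Lt y n)" for N
    by (simp add: Lt_def power_mult_distrib kappa_frobn sum_distrib_left mult.left_commute)
  thus "L (\<lambda>j. kappa c * y j) = kappa c * L y"
    using tendsto_scalev[OF L_limit[OF y], of "kappa c"] L_limit[OF cy] LIMSEQ_unique by simp
qed

lemma L_act: "small y \<Longrightarrow> small (act a y) \<and> L (act a y) = em a * L y"
proof (induction a arbitrary: y)
  case 0
  have "act 0 y = (\<lambda>j. kappa 0 * y j)" by (rule ext) (simp add: act_simps)
  thus ?case using L_kappa[OF 0, of 0] small_kappa[OF 0, of 0] by simp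
next
  case (pCons c a)
  have eq: "act (pCons c a) y = (\<lambda>j. kappa c * y j + act a (S y) j)" by (rule ext) (simp add: act_simps)
  have IH: "small (act a (S y))" "L (act a (S y)) = em a * L (S y)"
    using pCons.IH[OF small_S[OF pCons.prems]] by auto
  show ?case
    unfolding eq L_add[OF small_kappa[OF pCons.prems] IH(1)]
      L_kappa[OF pCons.prems] IH(2) L_S[OF pCons.prems] em_pCons
    by (intro conjI small_add[OF small_kappa[OF pCons.prems] IH(1)]) (simp add: algebra_simps)
qed

lemma act_commute: "act a (act b y) = act b (act a y)"
  by (simp add: mult.commute flip: act_simps(5))

text \<open>Both points lie in the domain of linearity even if \<open>y\<close> does not; evaluating
  \<open>L\<close> at the image of \<open>y\<close> under the product of \<open>a\<close> and
  \<open>b\<close> in two ways gives the equality.\<close>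

lemma L_act_independent:
  assumes "small (act a y)" "small (act b y)" "a \<noteq> 0" "b \<noteq> 0"
  shows "L (act a y) / em a = L (act b y) / em b"
proof -
  have "em b * L (act a y) = em a * L (act b y)"
    using L_act[OF assms(1), of b] L_act[OF assms(2), of a] act_commute[of a b y] by simp
  thus ?thesis using assms(3,4) by (simp add: frac_eq_eq mult.commute)
qed

lemma L_bound:
  assumes "\<And>j. j < d \<Longrightarrow> absv (y j) \<le> 1 / real qv"
    and B: "\<And>m. B \<le> real qv ^ m - real m * real (sum_list t)"
  shows "absv (L y) \<le> real qv powr (- B)"
proof -
  have "1 / real qv < 1" using qv_ge_2 by simp
  hence "small y" unfolding small_def using assms(1) by (meson le_less_trans)
  moreover have "absv (\<Sum>n<N. Lt y n) \<le> real qv powr (- B)" for N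
  proof (rule absv_sum_le)
    fix n
    let ?m = "n div dv"
    have "absv (Lt y n) \<le> M ^ ?m * (1 / real qv) ^ (q ^ n)"
      unfolding Lt_def by (rule weighted_sum_bound[OF R_bound assms(1)]) auto
    also have "M ^ ?m = real qv powr (real ?m * real (sum_list t))"
      using qv_ge_2 powr_realpow[of "real qv" "?m * sum_list t"]
      by (simp add: power_mult mult.commute[of ?m] mult.commute[of "real ?m"])
    also have "(1 / real qv) ^ (q ^ n) = real qv powr (- real (q ^ n))"
      using qv_ge_2 powr_realpow[of "real qv" "q ^ n"] by (simp add: powr_minus_divide power_one_over)
    also have "real qv powr (real ?m * real (sum_list t)) * real qv powr (- real (q ^ n)) =
        real qv powr (real ?m * real (sum_list t) - real (q ^ n))"
      by (simp flip: powr_add)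
    also have "\<dots> \<le> real qv powr (- B)"
    proof (rule powr_mono)
      \<comment> \<open>With m the quotient of n by \<open>dv\<close>, q^n is at least q_v^m, so the
        n-th term is covered by the expression for B at m.\<close>
      have "qv ^ ?m = q ^ (dv * ?m)" by (simp add: qv_eq power_mult)
      also have "\<dots> \<le> q ^ n" using q_ge_2 by (intro power_increasing) auto
      finally have "real (qv ^ ?m) \<le> real (q ^ n)" by (rule of_nat_mono)
      thus "real ?m * real (sum_list t) - real (q ^ n) \<le> - B" using B[of ?m] by simp
    qed (use qv_ge_2 in simp)
    finally show "absv (Lt y n) \<le> real qv powr (- B)" .
  qed simp
  ultimately show ?thesis using absv_limit_le[OF L_limit] by blast
qed

text \<open>The partial sums lie in k, and \<open>k_at\<close> is the closure of k.\<close>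

lemma L_in_k_at:
  assumes "small y" "\<And>j. j < d \<Longrightarrow> y j \<in> range em"
  shows "L y \<in> k_at \<iota>"
proof -
  have "(\<Sum>n<N. Lt y n) \<in> range \<iota>" for N
    unfolding Lt_def
    using R_range range_em_subset assms(2)
    by (intro range_iota_sum range_iota_mult range_iota_power) auto
  hence "\<forall>N. (\<Sum>n<N. Lt y n) \<in> range \<iota>" by blast
  thus ?thesis
    unfolding k_at_def closure_sequential using L_limit[OF assms(1)]
    by (intro exI[of _ "\<lambda>N. \<Sum>n<N. Lt y n"] conjI)
qed


section \<open>Evaluation of \<open>\<rho>\<^sub>a\<close>\<close>

abbreviation T :: "nat \<Rightarrow> nat \<Rightarrow> 'c mat" where "T \<equiv> tw_power q d (tm_rho_t \<iota> t w)"

text \<open>The value at x of the \<tau>^n-term of the k-th power of \<rho>_t. Separating the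
  \<tau>-degrees allows the formal product to be compared with iterates of \<open>S\<close>.\<close>

definition T_at :: "(nat \<Rightarrow> 'c) \<Rightarrow> nat \<Rightarrow> nat \<Rightarrow> nat \<Rightarrow> 'c" where
  "T_at x k n i = (\<Sum>l<d. T k n $$ (i, l) * x l ^ (q ^ n))"

lemma T_0: "T 0 n = (if n = 0 then 1\<^sub>m d else 0\<^sub>m d d)"
  by (simp add: tw_power_def tw_const_def)

lemma T_Suc: "T (Suc k) = tw_mult q d (tm_rho_t \<iota> t w) (T k)"
  by (simp add: tw_power_def)

lemma T_carrier: "T k n \<in> carrier_mat d d"
proof (cases k)
  case 0
  show ?thesis unfolding 0 T_0 by simp
next
  case (Suc k')
  show ?thesis unfolding Suc T_Suc by (simp add: tw_mult_def)
qed

lemma T_at_0: "i < d \<Longrightarrow> T_at x 0 n i = (if n = 0 then x i else 0)"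
  by (simp add: T_at_def T_0 if_distrib[of "\<lambda>y. y * _"] cong: if_cong)

lemma T_at_Suc:
  assumes "i < d"
  shows "T_at x (Suc k) n i = \<theta> * T_at x k n i + (if has_next t i then T_at x k n (Suc i) else 0)
    + (if n = 0 then 0 else \<Sum>m<d. EE i m * T_at x k (n - 1) m ^ q)"
proof -
  have "T_at x (Suc k) n i = (\<Sum>l<d. (\<theta> * T k n $$ (i, l) + (if has_next t i then T k n $$ (Suc i, l) else 0)
      + (if n = 0 then 0 else \<Sum>m<d. EE i m * T k (n - 1) $$ (m, l) ^ q)) * x l ^ (q ^ n))"
    unfolding T_at_def T_Suc
    by (intro sum.cong refl arg_cong2[where f = "(*)"] tw_mult_rho_t_left T_carrier) (use assms in auto)
  also have "\<dots> = \<theta> * T_at x k n i + (if has_next t i then T_at x k n (Suc i) else 0)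
      + (\<Sum>l<d. (if n = 0 then 0 else \<Sum>m<d. EE i m * T k (n - 1) $$ (m, l) ^ q) * x l ^ (q ^ n))"
    by (simp add: T_at_def distrib_right sum.distrib sum_distrib_left mult.assoc)
  also have "(\<Sum>l<d. (if n = 0 then 0 else \<Sum>m<d. EE i m * T k (n - 1) $$ (m, l) ^ q) * x l ^ (q ^ n)) =
      (if n = 0 then 0 else \<Sum>m<d. EE i m * T_at x k (n - 1) m ^ q)"
  proof (cases n)
    case (Suc n')
    have "T_at x k n' m ^ q = (\<Sum>l<d. T k n' $$ (m, l) ^ q * x l ^ (q ^ Suc n'))" for m
      using frobn_sum[of "\<lambda>l. T k n' $$ (m, l) * x l ^ (q ^ n')" "{..<d}" 1]
      by (simp add: T_at_def power_mult_distrib mult.commute[of q] flip: power_mult)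
    hence "(\<Sum>m<d. EE i m * T_at x k n' m ^ q) =
        (\<Sum>m<d. \<Sum>l<d. EE i m * T k n' $$ (m, l) ^ q * x l ^ (q ^ Suc n'))"
      by (simp add: sum_distrib_left mult.assoc)
    also have "\<dots> = (\<Sum>l<d. (\<Sum>m<d. EE i m * T k n' $$ (m, l) ^ q) * x l ^ (q ^ Suc n'))"
      unfolding sum_distrib_right by (rule sum.swap)
    finally show ?thesis using Suc by simp
  qed simp
  finally show ?thesis .
qed

lemma T_at_eq_0: "k < n \<Longrightarrow> i < d \<Longrightarrow> T_at x k n i = 0"
proof (induction k arbitrary: n i)
  case 0
  thus ?case by (simp add: T_at_0)
next
  case (Suc k)
  have "T_at x k n j = 0" "T_at x k (n - 1) j = 0" if "j < d" for j
    using Suc that by auto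
  thus ?case using Suc.prems q_ge_2 has_next_less[of t i] by (simp add: T_at_Suc)
qed

text \<open>Evaluation turns composition of operators into iteration of \<open>S\<close>. The k-th
  power of \<rho>_t has \<tau>-degree at most k, whence the condition on \<open>N\<close>.\<close>

lemma T_at_sum: "k \<le> N \<Longrightarrow> i < d \<Longrightarrow> (\<Sum>n\<le>N. T_at x k n i) = (S ^^ k) x i"
proof (induction k arbitrary: N i)
  case 0
  thus ?case by (simp add: T_at_0)
next
  case (Suc k)
  \<comment> \<open>The E-term raises the \<tau>-degree by one, so for it the induction hypothesis
    is needed with the bound N - 1.\<close>
  obtain N' where N: "N = Suc N'" "k \<le> N'" using Suc.prems by (cases N) auto
  have 1: "(\<Sum>n\<le>N. T_at x k n j) = (S ^^ k) x j" if "j < d" for j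
    by (rule Suc.IH) (use Suc.prems that in auto)
  have 2: "(\<Sum>n\<le>N'. T_at x k n j) = (S ^^ k) x j" if "j < d" for j
    by (rule Suc.IH) (use N that in auto)
  have 3: "(\<Sum>n\<le>N. if n = 0 then 0 else \<Sum>m<d. EE i m * T_at x k (n - 1) m ^ q) =
      (\<Sum>m<d. EE i m * (S ^^ k) x m ^ q)"
  proof -
    have "(\<Sum>n\<le>N. if n = 0 then 0 else \<Sum>m<d. EE i m * T_at x k (n - 1) m ^ q) =
        (\<Sum>n\<le>N'. \<Sum>m<d. EE i m * T_at x k n m ^ q)"
      unfolding N(1) by (subst sum.atMost_Suc_shift) simp
    also have "\<dots> = (\<Sum>m<d. EE i m * (\<Sum>n\<le>N'. T_at x k n m ^ q))"
      unfolding sum_distrib_left by (rule sum.swap)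
    also have "\<dots> = (\<Sum>m<d. EE i m * (S ^^ k) x m ^ q)"
      using frobn_sum[of _ "{..N'}" 1] 2 by (simp flip: 2)
    finally show ?thesis .
  qed
  have 4: "(\<Sum>n\<le>N. if has_next t i then T_at x k n (Suc i) else 0) =
      (if has_next t i then (S ^^ k) x (Suc i) else 0)"
    using 1[of "Suc i"] has_next_less[of t i] by simp
  have "(\<Sum>n\<le>N. T_at x (Suc k) n i) = \<theta> * (\<Sum>n\<le>N. T_at x k n i)
      + (\<Sum>n\<le>N. if has_next t i then T_at x k n (Suc i) else 0)
      + (\<Sum>n\<le>N. if n = 0 then 0 else \<Sum>m<d. EE i m * T_at x k (n - 1) m ^ q)"
    by (simp only: T_at_Suc[OF Suc.prems(2)] sum.distrib sum_distrib_left)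
  also have "\<dots> = (S ^^ Suc k) x i"
    unfolding 1[OF Suc.prems(2)] 3 4 using Suc.prems(2) by (simp add: S_def)
  finally show ?case .
qed

definition pt :: "nat \<Rightarrow> 'c" where "pt j = tm_point t w $ j"

lemma pt_em: "j < d \<Longrightarrow> pt j \<in> range em"
  unfolding pt_def tm_point_def
  by (auto intro!: range_em_sum range_em_mult range_em_prod range_em_power range_em_minus w_nth_em)

lemma rho_point_index:
  assumes "i < d"
  shows "tm_rho_point \<iota> t w a $ i = act a pt i"
proof -
  have car: "tm_rho \<iota> t w a n \<in> carrier_mat d d" for n by (simp add: tm_rho_def)
  have summand: "(tm_rho \<iota> t w a n *\<^sub>v map_vec (\<lambda>y. y ^ (q ^ n)) (tm_point t w)) $ i =
      (\<Sum>k\<le>degree a. kappa (coeff a k) * T_at pt k n i)" for n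
  proof -
    have "(tm_rho \<iota> t w a n *\<^sub>v map_vec (\<lambda>y. y ^ (q ^ n)) (tm_point t w)) $ i =
        (\<Sum>l<d. (\<Sum>k\<le>degree a. kappa (coeff a k) * T k n $$ (i, l)) * pt l ^ (q ^ n))"
      using assms
      by (subst mult_mat_vec_index[OF car])
        (simp_all add: tm_point_def pt_def tm_rho_def q_card kappa_def)
    also have "\<dots> = (\<Sum>l<d. \<Sum>k\<le>degree a. kappa (coeff a k) * (T k n $$ (i, l) * pt l ^ (q ^ n)))"
      by (simp add: sum_distrib_right mult.assoc)
    also have "\<dots> = (\<Sum>k\<le>degree a. kappa (coeff a k) * T_at pt k n i)"
      unfolding T_at_def sum_distrib_left by (rule sum.swap)
    finally show ?thesis .
  qed
  have "tm_rho_point \<iota> t w a $ i =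
      (\<Sum>n. \<Sum>k\<le>degree a. kappa (coeff a k) * T_at pt k n i)"
    using assms by (simp add: tm_rho_point_def tw_eval_def q_card summand)
  \<comment> \<open>The series is finite: \<open>T_at\<close> vanishes once n exceeds the exponent
    k, which is at most the degree of \<open>a\<close>.\<close>
  also have "\<dots> = (\<Sum>n\<le>degree a. \<Sum>k\<le>degree a. kappa (coeff a k) * T_at pt k n i)"
    by (rule suminf_finite) (use assms in \<open>auto simp: T_at_eq_0\<close>)
  also have "\<dots> = (\<Sum>k\<le>degree a. kappa (coeff a k) * (\<Sum>n\<le>degree a. T_at pt k n i))"
    unfolding sum_distrib_left by (rule sum.swap)
  also have "\<dots> = (\<Sum>k\<le>degree a. kappa (coeff a k) * (S ^^ k) pt i)"
    by (rule sum.cong) (use assms in \<open>auto simp: T_at_sum\<close>)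
  finally show ?thesis by (simp add: act_def pact_def)
qed

lemma log_at_rho_point:
  "tw_eval q d (tm_log \<iota> t w) (tm_rho_point \<iota> t w a) $ i0 = L (act a pt)"
proof -
  have "(tm_log \<iota> t w n *\<^sub>v map_vec (\<lambda>y. y ^ (q ^ n)) (tm_rho_point \<iota> t w a)) $ i0 = Lt (act a pt) n" for n
  proof -
    have car: "tm_log \<iota> t w n \<in> carrier_mat d d"
      using log_coeffs_tm_log by (simp add: log_coeffs_def)
    have dim: "dim_vec (tm_rho_point \<iota> t w a) = d" by (simp add: tm_rho_point_def tw_eval_def)
    hence vec: "map_vec (\<lambda>y. y ^ (q ^ n)) (tm_rho_point \<iota> t w a) \<in> carrier_vec d"
      by (intro carrier_vecI) simp
    show ?thesis
      unfolding mult_mat_vec_index[OF car vec i0_less] Lt_def R_def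
      by (intro sum.cong refl) (simp add: dim rho_point_index)
  qed
  thus ?thesis using i0_less by (simp add: tw_eval_def L_def)
qed

lemma admissible_iff: "admissible \<iota> t w a \<longleftrightarrow> a \<noteq> 0 \<and> small (act a pt)"
  by (simp add: admissible_def small_def rho_point_index)

lemma act_annihilator_pt:
  assumes "j < d"
  shows "act annihilator pt j \<in> range em" "absv (act annihilator pt j) < 1"
  using act_annihilator[of pt j] pt_em assms by blast+

lemma annihilator_nz: "annihilator \<noteq> 0"
  using absv_annihilator by auto

lemma admissible_annihilator: "admissible \<iota> t w annihilator"
  unfolding admissible_iff small_def using act_annihilator_pt(2) annihilator_nz by blast

lemma log_at_admissible:
  assumes "admissible \<iota> t w a"
  shows "tw_eval q d (tm_log \<iota> t w) (tm_rho_point \<iota> t w a) $ i0 / em a = L (act annihilator pt) / em annihilator"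
  unfolding log_at_rho_point
  by (rule L_act_independent) (use assms admissible_annihilator in \<open>auto simp: admissible_iff\<close>)

lemma L_annihilator_bound:
  assumes "\<And>m. B \<le> real qv ^ m - real m * real (sum_list t)"
  shows "absv (L (act annihilator pt)) \<le> real qv powr (- B)"
proof (rule L_bound[OF _ assms])
  fix j assume "j < d"
  thus "absv (act annihilator pt j) \<le> 1 / real qv"
    using act_annihilator_pt[of j] absv_em_less_1 by auto
qed

end

section \<open>Estimate and rationality of a single star polylogarithm\<close>

context place begin

lemma k_at_add: "x \<in> k_at \<iota> \<Longrightarrow> y \<in> k_at \<iota> \<Longrightarrow> x + y \<in> k_at \<iota>"
  unfolding k_at_def closure_sequential
proof (elim exE conjE)
  fix X Y assume "\<forall>n. X n \<in> range \<iota>" "X \<longlonglongrightarrow> x" "\<forall>n. Y n \<in> range \<iota>" "Y \<longlonglongrightarrow> y"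
  thus "\<exists>Z. (\<forall>n. Z n \<in> range \<iota>) \<and> Z \<longlonglongrightarrow> x + y"
    by (intro exI[of _ "\<lambda>n. X n + Y n"] conjI allI range_iota_add tendsto_addv) auto
qed

lemma k_at_scale: "c \<in> range \<iota> \<Longrightarrow> x \<in> k_at \<iota> \<Longrightarrow> c * x \<in> k_at \<iota>"
  unfolding k_at_def closure_sequential
proof (elim exE conjE)
  fix X assume "c \<in> range \<iota>" "\<forall>n. X n \<in> range \<iota>" "X \<longlonglongrightarrow> x"
  thus "\<exists>Z. (\<forall>n. Z n \<in> range \<iota>) \<and> Z \<longlonglongrightarrow> c * x"
    by (intro exI[of _ "\<lambda>n. c * X n"] conjI allI range_iota_mult tendsto_scalev) auto
qed

lemma k_at_0: "0 \<in> k_at \<iota>"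
  unfolding k_at_def using closure_subset[of "range \<iota>"] range_iota_0 by blast

lemma k_at_sum: "(\<And>i. i \<in> I \<Longrightarrow> f i \<in> k_at \<iota>) \<Longrightarrow> (\<Sum>i\<in>I. f i) \<in> k_at \<iota>"
  by (induction I rule: infinite_finite_induct) (simp_all add: k_at_add k_at_0)

lemma neg_one_power_range: "(- 1) ^ n \<in> range \<iota>"
  by (intro range_iota_power range_iota_minus) simp

lemma Li_star_bound:
  assumes s: "s \<noteq> []" "\<forall>n\<in>set s. 1 \<le> n" and u: "length u = length s" "set u \<subseteq> range em"
    and B: "\<And>m. B \<le> real qv ^ m - real m * real (sum_list s)"
  shows "absv (Li_star \<iota> s u) \<le> real qv powr (- B)" and "Li_star \<iota> s u \<in> k_at \<iota>"
proof -
  interpret tmodule v \<iota> q "rev s" "rev u"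
    by unfold_locales (use s u in auto)
  define a where "a = (SOME a. admissible \<iota> (rev s) (rev u) a)"
  have a: "admissible \<iota> (rev s) (rev u) a"
    unfolding a_def by (rule someI) (rule admissible_annihilator)
  have i0: "sum_list s - 1 = i0" by (simp add: i0_def)
  \<comment> \<open>The chosen \<open>a\<close> is exchanged for \<open>annihilator\<close>, whose
    value at \<theta> is a v-adic unit.\<close>
  have Li: "Li_star \<iota> s u = (- 1) ^ (length s - 1) / em annihilator * L (act annihilator pt)"
  proof -
    have "Li_star \<iota> s u = (- 1) ^ (length s - 1) *
        (tw_eval q d (tm_log \<iota> (rev s) (rev u)) (tm_rho_point \<iota> (rev s) (rev u) a) $ i0 / em a)"
      unfolding Li_star_def Let_def a_def[symmetric] i0 q_card by simp
    thus ?thesis unfolding log_at_admissible[OF a] by simp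
  qed
  show "absv (Li_star \<iota> s u) \<le> real qv powr (- B)"
    using L_annihilator_bound[of B] B by (simp add: Li absv_mult absv_divide absv_annihilator)
  have "L (act annihilator pt) \<in> k_at \<iota>"
    using admissible_annihilator act_annihilator_pt(1)
    by (intro L_in_k_at) (auto simp: admissible_iff)
  moreover have "(- 1) ^ (length s - 1) / em annihilator \<in> range \<iota>"
    using range_em_subset by (intro range_iota_divide neg_one_power_range) auto
  ultimately show "Li_star \<iota> s u \<in> k_at \<iota>" unfolding Li by (rule k_at_scale[rotated])
qed

end

section \<open>Merging\<close>

text \<open>The commas removed depend on \<open>w\<close> alone, so the merged index and the merged
  arguments keep matching lengths although their operations differ.\<close>

lemma length_merge: "length xs = length ys \<Longrightarrow> length (merge f w xs) = length (merge g w ys)"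
proof (induction f w xs arbitrary: ys rule: merge.induct)
  case (1 f b bs x y xs)
  then obtain x' y' ys' where ys: "ys = x' # y' # ys'" "length xs = length ys'"
    by (auto simp: length_Suc_conv Suc_length_conv)
  show ?case
    using "1.IH"(1)[of "g x' y' # ys'"] "1.IH"(2)[of "y' # ys'"] ys by auto
next
  case ("2_1" f xs)
  thus ?case by simp
next
  case ("2_2" f w)
  thus ?case by simp
next
  case ("2_3" f w x)
  then obtain x' where "ys = [x']" by (auto simp: length_Suc_conv Suc_length_conv)
  thus ?case by simp
qed

lemma merge_Nil_iff [simp]: "merge f w xs = [] \<longleftrightarrow> xs = []"
  by (induction f w xs rule: merge.induct) auto

text \<open>The weight survives merging, so all polylogarithms in the zeta value share the same
  bound.\<close>

lemma sum_list_merge: "sum_list (merge (+) w xs) = sum_list (xs :: nat list)"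
  by (induction "(+) :: nat \<Rightarrow> nat \<Rightarrow> nat" w xs rule: merge.induct) auto

lemma set_merge_subset:
  "(\<And>x y. x \<in> A \<Longrightarrow> y \<in> A \<Longrightarrow> f x y \<in> A) \<Longrightarrow> set xs \<subseteq> A \<Longrightarrow> set (merge f w xs) \<subseteq> A"
  by (induction f w xs rule: merge.induct) auto


section \<open>Carlitz factorials\<close>

lemma sum_digits: "(\<Sum>j<J. n div b ^ j mod b * b ^ j) = n mod (b :: nat) ^ J"
proof (induction J)
  case (Suc J)
  have "n mod b ^ Suc J = b ^ J * (n div b ^ J mod b) + n mod b ^ J"
    using mod_mult2_eq[of n "b ^ J" b] by (simp add: mult.commute)
  thus ?case using Suc by (simp add: mult.commute)
qed simp

context place begin

lemma carlitz_D_rec: "(carlitz_D (Suc j) :: 'a poly) = bracket (Suc j) * carlitz_D j ^ q"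
proof -
  have "(\<Prod>k=1..j. bracket k ^ (q ^ (Suc j - k))) = (\<Prod>k=1..j. (bracket k ^ (q ^ (j - k))) ^ q :: 'a poly)"
    by (intro prod.cong refl) (simp add: Suc_diff_le mult.commute flip: power_mult)
  thus ?thesis by (simp add: carlitz_D_def q_card prod_power_distrib mult.commute)
qed

text \<open>The order of D_j is the sum of q^(j-k) over the multiples k of \<open>dv\<close> with 1
  \<le> k \<le> j, a geometric series in q_v. The closed form is verified through the recursion
  D_(j+1) = [j+1] D_j^q.\<close>

lemma absv_carlitz_D:
  "absv (em (carlitz_D j)) = real qv powr (- ((real q ^ j - real q ^ (j mod dv)) / (real qv - 1)))"
proof (induction j)
  case 0
  thus ?case using qv_ge_2 by (simp add: carlitz_D_def)
next
  case (Suc j)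
  let ?e = "\<lambda>j. (real q ^ j - real q ^ (j mod dv)) / (real qv - 1)"
  have br: "absv (em (bracket (Suc j))) = real qv powr (- (if dv dvd Suc j then 1 else 0))"
    using absv_bracket[of "Suc j"] qv_ge_2 by (simp add: powr_minus_divide)
  have "absv (em (carlitz_D (Suc j))) =
      real qv powr (- (if dv dvd Suc j then 1 else 0)) * (real qv powr (- ?e j)) ^ q"
    by (simp add: carlitz_D_rec em.hom_mult em.hom_power absv_mult absv_power br Suc)
  also have "(real qv powr (- ?e j)) ^ q = real qv powr (- ?e j * real q)"
    using qv_ge_2 by (simp add: powr_realpow[symmetric] powr_powr del: powr_realpow)
  also have "real qv powr (- (if dv dvd Suc j then 1 else 0)) * real qv powr (- ?e j * real q) =
      real qv powr (- ((if dv dvd Suc j then 1 else 0) + ?e j * real q))"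
    by (simp flip: powr_add)
  also have "(if dv dvd Suc j then 1 else 0) + ?e j * real q = ?e (Suc j)"
  proof (cases "dv dvd Suc j")
    case True
    hence m: "Suc (j mod dv) = dv" by (simp add: mod_Suc dvd_eq_mod_eq_0 split: if_splits)
    \<comment> \<open>At a multiple of \<open>dv\<close> the remainder drops from \<open>dv\<close>
      - 1 to 0, and the difference q_v - 1 accounts for the new factor v.\<close>
    have "real q ^ (j mod dv) * real q = real qv"
      by (subst qv_eq, subst m[symmetric]) simp
    thus ?thesis using True qv_ge_2 by (simp add: field_simps dvd_eq_mod_eq_0)
  next
    case False
    hence "Suc j mod dv = Suc (j mod dv)" by (simp add: mod_Suc dvd_eq_mod_eq_0 split: if_splits)
    thus ?thesis using False by (simp add: field_simps)
  qed
  finally show ?case .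
qed

lemma absv_carlitz_D_ge: "real qv powr (- ((real q ^ j - 1) / (real qv - 1))) \<le> absv (em (carlitz_D j))"
  unfolding absv_carlitz_D
proof (rule powr_mono)
  have "1 \<le> real q ^ (j mod dv)" using q_ge_2 by simp
  thus "- ((real q ^ j - 1) / (real qv - 1)) \<le> - ((real q ^ j - real q ^ (j mod dv)) / (real qv - 1))"
    using qv_ge_2 by (simp add: divide_right_mono)
qed (use qv_ge_2 in simp)

lemma absv_carlitz_D_eq_1: "j < dv \<Longrightarrow> absv (em (carlitz_D j)) = 1"
  unfolding absv_carlitz_D using qv_ge_2 by simp

lemma absv_carlitz_gamma:
  "absv (em (carlitz_gamma m)) = (\<Prod>j<m. absv (em (carlitz_D j)) ^ ((m - 1) div q ^ j mod q))"
  by (simp add: carlitz_gamma_def q_card em.hom_prod em.hom_power absv_prod absv_power)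

text \<open>For m \<ge> 1 this is the share m - 1 - [m \<noteq> 1] of an entry m in wt - dep -
  ht.\<close>

definition gamma_exp :: "nat \<Rightarrow> real" where
  "gamma_exp m = (if m \<le> 1 then 0 else real m - 2)"

text \<open>As in Legendre's formula, weighting the digits of n = m - 1 by q^j - 1 gives n minus the
  digit sum. The digit sum is at least 1 unless n = 0, which is the origin of the height in the
  bound.\<close>

lemma absv_carlitz_gamma_ge:
  assumes "1 \<le> m"
  shows "real qv powr (- (gamma_exp m / (real qv - 1))) \<le> absv (em (carlitz_gamma m))"
proof -
  define n where "n = m - 1"
  define dg where "dg j = n div q ^ j mod q" for j
  \<comment> \<open>This makes the first m digits all the digits of n.\<close>
  have "m < 2 ^ m" by (rule less_exp)
  also have "(2::nat) ^ m \<le> q ^ m" using q_ge_2 by (rule power_mono) simp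
  finally have "n < q ^ m" by (simp add: n_def)
  hence n: "(\<Sum>j<m. dg j * q ^ j) = n" by (simp add: dg_def sum_digits)
  have le: "(\<Sum>j<m. real (dg j) * (real q ^ j - 1)) \<le> gamma_exp m"
  proof -
    have "real n = real (\<Sum>j<m. dg j * q ^ j)" by (simp only: n)
    hence eq: "(\<Sum>j<m. real (dg j) * (real q ^ j - 1)) = real n - real (\<Sum>j<m. dg j)"
      by (simp add: right_diff_distrib sum_subtractf)
    show ?thesis
    proof (cases "m = 1")
      case True
      hence "n = 0" by (simp add: n_def)
      thus ?thesis unfolding eq using True by (simp add: gamma_exp_def)
    next
      case False
      hence "n \<noteq> 0" using assms by (simp add: n_def)
      hence "(\<Sum>j<m. dg j) \<noteq> 0" using n by (intro notI) simp
      hence "1 \<le> real (\<Sum>j<m. dg j)" by linarith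
      moreover have "gamma_exp m = real m - 2" "real n = real m - 1"
        using False assms by (simp_all add: gamma_exp_def n_def of_nat_diff)
      ultimately show ?thesis unfolding eq by linarith
    qed
  qed
  have "real qv powr (- (gamma_exp m / (real qv - 1))) \<le>
      real qv powr (\<Sum>j<m. - ((real q ^ j - 1) / (real qv - 1)) * real (dg j))"
  proof (rule powr_mono)
    have "(\<Sum>j<m. - ((real q ^ j - 1) / (real qv - 1)) * real (dg j)) =
        - ((\<Sum>j<m. real (dg j) * (real q ^ j - 1)) / (real qv - 1))"
      by (simp add: sum_divide_distrib sum_negf mult.commute)
    thus "- (gamma_exp m / (real qv - 1)) \<le> (\<Sum>j<m. - ((real q ^ j - 1) / (real qv - 1)) * real (dg j))"
      using le qv_ge_2 by (simp add: divide_right_mono)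
  qed (use qv_ge_2 in simp)
  also have "\<dots> = (\<Prod>j<m. (real qv powr (- ((real q ^ j - 1) / (real qv - 1)))) ^ dg j)"
    using qv_ge_2 by (simp add: powr_sum powr_powr flip: powr_realpow)
  also have "\<dots> \<le> (\<Prod>j<m. absv (em (carlitz_D j)) ^ dg j)"
    by (intro prod_mono conjI power_mono absv_carlitz_D_ge) auto
  also have "\<dots> = absv (em (carlitz_gamma m))"
    by (simp add: absv_carlitz_gamma dg_def n_def)
  finally show ?thesis .
qed

text \<open>Digits of m - 1 < q_v occur only at positions below \<open>dv\<close>, where D_j is a
  v-adic unit. This exact value avoids the fractional loss of the general bound in the integrality
  statement.\<close>

lemma absv_carlitz_gamma_eq_1:
  assumes "1 \<le> m" "m \<le> qv"
  shows "absv (em (carlitz_gamma m)) = 1"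
  unfolding absv_carlitz_gamma
proof (intro prod.neutral ballI)
  fix j
  show "absv (em (carlitz_D j)) ^ ((m - 1) div q ^ j mod q) = 1"
  proof (cases "j < dv")
    case True
    thus ?thesis by (simp add: absv_carlitz_D_eq_1)
  next
    case False
    hence "qv \<le> q ^ j" unfolding qv_eq using q_ge_2 by (intro power_increasing) auto
    hence "m - 1 < q ^ j" using assms by linarith
    thus ?thesis by simp
  qed
qed

lemma absv_gamma_prod_ge:
  assumes "\<forall>n\<in>set s. 1 \<le> n"
  shows "real qv powr (- ((real (wt s) - real (dep s) - real (ht s)) / (real qv - 1)))
    \<le> absv (em (prod_list (map carlitz_gamma s)))"
proof -
  have ht: "ht s = length (filter (\<lambda>x. x \<noteq> 1) s)" for s
    by (simp add: ht_def length_filter_conv_card)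
  show ?thesis using assms
  proof (induction s)
    case Nil
    thus ?case using qv_ge_2 by (simp add: wt_def dep_def ht)
  next
    case (Cons m s)
    let ?e = "\<lambda>s. (real (wt s) - real (dep s) - real (ht s)) / (real qv - 1)"
    have "real (wt (m # s)) - real (dep (m # s)) - real (ht (m # s)) =
        gamma_exp m + (real (wt s) - real (dep s) - real (ht s))"
      using Cons.prems by (auto simp: wt_def dep_def ht gamma_exp_def)
    hence "real qv powr (- ?e (m # s)) = real qv powr (- (gamma_exp m / (real qv - 1))) * real qv powr (- ?e s)"
      by (simp add: add_divide_distrib flip: powr_add)
    also have "\<dots> \<le> absv (em (carlitz_gamma m)) * absv (em (prod_list (map carlitz_gamma s)))"
      using Cons by (intro mult_mono absv_carlitz_gamma_ge) auto
    finally show ?case by (simp add: em.hom_mult absv_mult)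
  qed
qed

lemma absv_gamma_prod_eq_1:
  "\<forall>n\<in>set s. 1 \<le> n \<and> n \<le> qv \<Longrightarrow> absv (em (prod_list (map carlitz_gamma s))) = 1"
  by (induction s) (simp_all add: em.hom_mult absv_mult absv_carlitz_gamma_eq_1)


section \<open>The constant \<open>B\<close>\<close>

text \<open>\<open>LEAST\<close> over the integers needs a lower bound. It comes from q_v^n \<ge>
  n^2 - 1 and nw \<le> n^2 + w^2.\<close>

lemma B_at_attained:
  obtains n where "B_at w v = int (qv ^ n) - int (n * w)"
    and "\<And>m. B_at w v \<le> int (qv ^ m) - int (m * w)"
proof -
  define f where "f n = int (qv ^ n) - int (n * w)" for n
  have low: "- int (w * w) - 1 \<le> f n" for n
  proof -
    \<comment> \<open>The summand 1 is there for n = 3, the only case with n^2 > 2^n.\<close>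
    have "n * n \<le> 2 ^ n + 1"
    proof (induction n rule: nat_less_induct)
      case (1 n)
      consider "n < 4" | m where "n = Suc m" "3 \<le> m" by (cases n) force+
      thus ?case
      proof cases
        case 1
        hence "n \<in> {0, 1, 2, 3}" by auto
        thus ?thesis by auto
      next
        case 2
        hence "m * m \<le> 2 ^ m + 1" using "1.IH" by simp
        moreover have "2 * m + 1 \<le> m * m - 1"
        proof -
          have "3 * m \<le> m * m" using 2 by simp
          thus ?thesis using 2 by linarith
        qed
        ultimately show ?thesis using 2 by simp
      qed
    qed
    also have "(2::nat) ^ n \<le> qv ^ n" using qv_ge_2 by (rule power_mono) simp
    finally have 1: "int (n * n) \<le> int (qv ^ n) + 1" by linarith
    have "0 \<le> (int n - int w) ^ 2" by simp
    hence "2 * (int n * int w) \<le> int n * int n + int w * int w"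
      by (simp add: power2_eq_square algebra_simps)
    moreover have "0 \<le> int n * int w" by simp
    ultimately have "int n * int w \<le> int n * int n + int w * int w" by linarith
    thus ?thesis using 1 by (simp add: f_def)
  qed
  \<comment> \<open>Shifting by the lower bound makes all values nonnegative, so minimality can be
    taken among natural numbers.\<close>
  obtain n0 where n0: "\<And>n. nat (f n0 + int (w * w) + 1) \<le> nat (f n + int (w * w) + 1)"
    using ex_has_least_nat[of "\<lambda>_. True" 0 "\<lambda>n. nat (f n + int (w * w) + 1)"] by auto
  have "\<And>n. f n0 \<le> f n" subgoal for n using n0[of n] low[of n] low[of n0] by linarith done
  moreover from this have "B_at w v = f n0"
    unfolding B_at_def f_def[symmetric] by (intro Least_equality) auto
  ultimately show ?thesis using that[of n0] by (simp add: f_def)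
qed

text \<open>For n \<ge> 1 one has n \<le> 2^(n-1) \<le> q_v^(n-1), and w \<le> q_v supplies the
  remaining factor; n = 0 gives the value 1.\<close>

lemma B_at_nonneg:
  assumes "w \<le> qv"
  shows "0 \<le> B_at w v"
proof -
  have ge: "0 \<le> int (qv ^ n) - int (n * w)" for n
  proof (cases n)
    case (Suc m)
    have "n \<le> 2 ^ m" using less_exp[of m] Suc by (simp add: Suc_leI)
    also have "(2::nat) ^ m \<le> qv ^ m" using qv_ge_2 by (rule power_mono) simp
    finally have "n * w \<le> qv ^ m * qv" using assms by (rule mult_le_mono)
    thus ?thesis using Suc by (simp add: mult.commute flip: of_nat_mult)
  qed simp
  obtain n where "B_at w v = int (qv ^ n) - int (n * w)" by (rule B_at_attained)
  thus ?thesis using ge[of n] by simp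
qed

section \<open>Estimate and rationality of the multiple zeta value\<close>

lemma index_u_em: "set (index_u \<iota> s j) \<subseteq> range em"
  by (auto simp: index_u_def)

lemma zeta_at_bound:
  assumes s: "s \<noteq> []" "\<forall>n\<in>set s. 1 \<le> n"
  shows "absv (zeta_at \<iota> s) \<le> real qv powr (- real_of_int (B_at (wt s) v))
      / absv (em (prod_list (map carlitz_gamma s)))"
    and "zeta_at \<iota> s \<in> k_at \<iota>"
proof -
  define B where "B = real_of_int (B_at (wt s) v)"
  define Li where "Li j w = Li_star \<iota> (merge (+) w s) (merge (*) w (index_u \<iota> s j))" for j w
  have B: "B \<le> real qv ^ m - real m * real (sum_list s)" for m
  proof -
    have "B_at (wt s) v \<le> int (qv ^ m) - int (m * wt s)" using B_at_attained by metis
    hence "B \<le> real_of_int (int (qv ^ m) - int (m * wt s))" unfolding B_def by (rule of_int_le_iff[THEN iffD2])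
    thus ?thesis by (simp add: wt_def)
  qed
  have Li: "absv (Li j w) \<le> real qv powr (- B)" "Li j w \<in> k_at \<iota>" for j w
  proof -
    have 1: "merge (+) w s \<noteq> []" using s by simp
    have 2: "\<forall>n\<in>set (merge (+) w s). 1 \<le> n"
      using set_merge_subset[of "{1..}" "(+)" s w] s by auto
    have 3: "length (merge (*) w (index_u \<iota> s j)) = length (merge (+) w s)"
      by (rule length_merge) (simp add: index_u_def)
    have 4: "set (merge (*) w (index_u \<iota> s j)) \<subseteq> range em"
      by (rule set_merge_subset[OF range_em_mult index_u_em])
    have 5: "B \<le> real qv ^ m - real m * real (sum_list (merge (+) w s))" for m
      using B[of m] by (simp add: sum_list_merge)
    show "absv (Li j w) \<le> real qv powr (- B)" "Li j w \<in> k_at \<iota>"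
      unfolding Li_def using Li_star_bound[OF 1 2 3 4 5] by auto
  qed
  define c where "c j w = (- 1) ^ (length s - 1) * \<theta> ^ sum_list j * (- 1) ^ (length (merge (+) w s) - 1)"
    for j w
  define Z where "Z = (\<Sum>j\<in>index_J TYPE('a) s. \<Sum>w\<in>{w. length w = length s - 1}. c j w * Li j w)"
  have zeta: "zeta_at \<iota> s = 1 / em (prod_list (map carlitz_gamma s)) * Z"
    by (simp add: zeta_at_def Z_def c_def Li_def)
  have "absv (c j w * Li j w) \<le> real qv powr (- B)" for j w
  proof -
    have "absv (c j w) \<le> 1"
      using absv_theta_le_1 by (simp add: c_def absv_mult absv_power power_le_one)
    hence "absv (c j w) * absv (Li j w) \<le> 1 * real qv powr (- B)"
      using Li(1) by (intro mult_mono) auto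
    thus ?thesis by (simp add: absv_mult)
  qed
  hence "absv Z \<le> real qv powr (- B)"
    unfolding Z_def by (intro absv_sum_le) auto
  thus "absv (zeta_at \<iota> s) \<le> real qv powr (- B) / absv (em (prod_list (map carlitz_gamma s)))"
    by (simp add: zeta absv_mult absv_divide divide_right_mono)
  have "c j w \<in> range \<iota>" for j w
    using range_em_theta range_em_subset unfolding c_def
    by (intro range_iota_mult neg_one_power_range range_iota_power) blast
  hence "Z \<in> k_at \<iota>"
    unfolding Z_def by (intro k_at_sum k_at_scale Li)
  moreover have "1 / em (prod_list (map carlitz_gamma s)) \<in> range \<iota>"
    using range_em_subset by (intro range_iota_divide) auto
  ultimately show "zeta_at \<iota> s \<in> k_at \<iota>" unfolding zeta by (intro k_at_scale)
qed

lemma ord_at_ge: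
  assumes "absv (x :: 'c) \<le> real qv powr (- e)"
  shows "ereal e \<le> ord_at v x"
proof (cases "x = 0")
  case False
  have "log (real qv) (absv x) \<le> log (real qv) (real qv powr (- e))"
    using False assms qv_ge_2 by (intro log_mono) auto
  thus ?thesis using False qv_ge_2 by (simp add: ord_at_def)
qed (simp add: ord_at_def)

end

theorem theorem4p4:
  fixes v :: "'a::{finite,field} poly"
    and \<iota> :: "'a poly fract \<Rightarrow> 'c::{alg_closed_field,complete_space}"
    and s :: "nat list"
  assumes "lead_coeff v = 1" and "irreducible v"
    and "C_at v \<iota>"
    and "s \<noteq> []" and "\<forall>n\<in>set s. n \<ge> 1"
  shows "ord_at v (zeta_at \<iota> s) \<ge>
           ereal (real_of_int (B_at (wt s) v)
             - (real (wt s) - real (dep s) - real (ht s)) / (real (q_at v) - 1))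
         \<and> (q_at v \<ge> wt s \<longrightarrow> zeta_at \<iota> s \<in> A_at \<iota>)"
proof (intro conjI impI)
  interpret C_at v \<iota> by fact
  interpret place v \<iota> "CARD('a)"
    by unfold_locales (use assms in auto)
  let ?B = "real_of_int (B_at (wt s) v)"
  let ?G = "absv (em (prod_list (map carlitz_gamma s)))"
  define e where "e = (real (wt s) - real (dep s) - real (ht s)) / (real qv - 1)"
  note zeta = zeta_at_bound[OF assms(4,5)]
  have "real qv powr (- ?B) / ?G \<le> real qv powr (- ?B) / real qv powr (- e)"
    using absv_gamma_prod_ge[OF assms(5)] qv_ge_2 by (intro frac_le) (auto simp: e_def)
  also have "\<dots> = real qv powr (- (?B - e))" by (simp flip: powr_diff)
  finally have "absv (zeta_at \<iota> s) \<le> real qv powr (- (?B - e))" using zeta(1) by linarith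
  thus "ereal (?B - (real (wt s) - real (dep s) - real (ht s)) / (real (q_at v) - 1))
      \<le> ord_at v (zeta_at \<iota> s)"
    unfolding e_def by (rule ord_at_ge)
  assume le: "wt s \<le> q_at v"
  \<comment> \<open>Entries are bounded by the weight, so the gamma factor is a unit here and
    dividing by it loses nothing; B \<ge> 0 then suffices.\<close>
  have "n \<le> qv" if "n \<in> set s" for n
    using member_le_sum_list[OF that] le by (simp add: wt_def)
  hence "?G = 1" using assms(5) by (intro absv_gamma_prod_eq_1) auto
  moreover have "real qv powr (- ?B) \<le> real qv powr 0"
    using B_at_nonneg[OF le] qv_ge_2 by (intro powr_mono) auto
  ultimately have "absv (zeta_at \<iota> s) \<le> 1" using zeta(1) qv_ge_2 by simp
  thus "zeta_at \<iota> s \<in> A_at \<iota>" using zeta(2) by (simp add: A_at_def)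
qed

end
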